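(* Assume the Hardy--Littlewood prime-pair conjecture in the form stated in the context. Let $c$ be a fixed real number. Then, as $X\to+\infty$, $$\sum_{3\le n\le X}\frac{1}{d_n\,n\,(\log\log n)^c}=\begin{cases}\gamma_c+o(1) & \text{if } c>2,\\ \log\log\log X\,(1+o(1)) & \text{if } c=2,\\ \dfrac{(\log\log X)^{2-c}}{2-c}\,(1+o(1)) & \text{if } c<2,\end{cases}$$ where, for $c>2$, $\gamma_c$ is a (finite) constant depending only on $c$.
   Context: $p_n$ denotes the $n$-th prime number and $d_n=p_{n+1}-p_n$. For a natural number $d$, let $\pi(X;\{0,d\})=\#\{n\in\mathbb{N}: n+d\le X,\ n \text{ and } n+d \text{ are both prime}\}$, and for even $d\ge 2$ let $$\mathfrak{S}(\{0,d\})=2\prod_{p>2}\left(1-\frac{1}{(p-1)^2}\right)\prod_{p\mid d,\ p>2}\frac{p-1}{p-2},$$ the products being over primes $p$. Hardy--Littlewood prime-pair conjecture (the hypothesis): $\pi(X;\{0,d\})=\mathfrak{S}(\{0,d\})\frac{X}{\log^2 X}(1+o(1))$ as $X\to+\infty$, uniformly for even natural numbers $d\ll\log X$; that is, for every constant $C>0$, $$\sup_{\substack{2\le d\le C\log X\\ d\text{ even}}}\left|\frac{\pi(X;\{0,d\})}{\mathfrak{S}(\{0,d\})X/\log^2X}-1\right|\to 0\quad\text{as } X\to+\infty.$$ *)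

theory Defs
  imports
    "HOL-Analysis.Analysis"
    "HOL-Library.Infinite_Set"
    "HOL-Library.Landau_Symbols"
    "HOL-Computational_Algebra.Primes"
begin

text \<open>
  Primes are indexed from 1 (so \<open>nth_prime 1 = 2\<close>), whereas \<open>enumerate\<close> counts from 0;
  \<open>nth_prime 0\<close> is a junk value.
\<close>
definition nth_prime :: "nat \<Rightarrow> nat" where
  "nth_prime n = enumerate {p::nat. prime p} (n - 1)"

definition prime_gap :: "nat \<Rightarrow> nat" where
  "prime_gap n = nth_prime (n + 1) - nth_prime n"

definition prime_pair_count :: "real \<Rightarrow> nat \<Rightarrow> nat" where
  "prime_pair_count X d = card {n::nat. real (n + d) \<le> X \<and> prime n \<and> prime (n + d)}"

text \<open>The intended argument \<open>d\<close> is even and positive; the second product is over a finite set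
  only for \<open>d > 0\<close>.\<close>
definition singular_series :: "nat \<Rightarrow> real" where
  "singular_series d =
     2 * prodinf (\<lambda>p::nat. if prime p \<and> p > 2 then 1 - 1 / (real p - 1)\<^sup>2 else 1)
       * (\<Prod>p | prime p \<and> p dvd d \<and> p > 2. (real p - 1) / (real p - 2))"

text \<open>For each \<open>X\<close> the supremum is over a finite set, which is nonempty once \<open>C * ln X \<ge> 2\<close>,
  so the value of \<open>Sup {}\<close> on the reals plays no role in the limit.\<close>
definition hardy_littlewood_prime_pairs :: bool where
  "hardy_littlewood_prime_pairs \<longleftrightarrow>
     (\<forall>C::real. C > 0 \<longrightarrow> ((\<lambda>X::real.
        SUP d \<in> {d::nat. 2 \<le> d \<and> real d \<le> C * ln X \<and> even d}.
          \<bar>real (prime_pair_count X d) / (singular_series d * X / (ln X)\<^sup>2) - 1\<bar>)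
        \<longlongrightarrow> 0) at_top)"

definition gap_sum :: "real \<Rightarrow> real \<Rightarrow> real" where
  "gap_sum c X =
     (\<Sum>n::nat | 3 \<le> n \<and> real n \<le> X. 1 / (real (prime_gap n) * real n * ln (ln (real n)) powr c))"

end

(* The prime pair conjecture is the only analytic input; the prime number theorem is not needed.

   Counting primes in windows of length h = C ln N and applying Cauchy-Schwarz, the pair
   asymptotics give pi(N) <= (1 + o(1)) N / ln N, and Mertens' theorem then gives the Chebyshev
   lower bound.  Let S(n) be the sum of 1/d_m over m < n.  Summing the pair asymptotics with
   weights 1/d over even d <= ln N bounds S(n) from above.  For the lower bound, pairs that are not
   consecutive primes extend to triples; for d <= ln N / (ln ln N)^6 the Brun pure sieve makes
   these negligible, so S(n) ~ p_n ln ln p_n / (ln p_n)^2.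

   Partial summation reduces the claim to sums of b_n v_n, where b_n = p_n / (n ln n) and
   v_n = (ln ln n)^(1-c) / (n ln n).  Now b_n >= 1 - o(1) by the bound on pi(N), while
   Mertens' theorem says that 1/b_n has logarithmic mean 1; so b_n may be replaced by 1. *)

theory Submission
  imports Defs "HOL-Real_Asymp.Real_Asymp" "HOL-Number_Theory.Cong"
begin

subsection \<open>The Brun pure sieve\<close>


text \<open>A variance argument bounds pi(N) from one side only, so p_n ~ n ln n never becomes
  available, although the answer has an exact leading constant. What saves the constant is that the
  target is a logarithmic average, and such averages of the primes are governed by Mertens' theorem.
  Write l = ln ln N. Gaps longer than ln N contribute at most pi(N) / ln N = O(N / (ln N)^2) to
  S(n), a factor l below the main term, so counts of pairs at distance up to ln N suffice. The
  exponent 6 comes from the triples. Sieving by the primes between ln N and N^(1/(28 l)) gives a sum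
  of 1/p of at least l - 2 ln l - O(1): one ln l is lost at each end. With three residue classes per
  prime, the bound exceeds the expected N / (ln N)^3 by the factor l^6. A difference d has fewer
  than d middle positions, which the weight 1/d cancels, so D differences cost O(D N l^6 / (ln
  N)^3), and D = ln N / l^6 leaves O(N / (ln N)^2). The shorter range is harmless because ln D ~
  l.\<close>

lemma card_residue_class_eq:
  fixes N q a :: nat
  assumes "a < q"
  shows "card {n. n < N \<and> n mod q = a} = (N + (q - 1 - a)) div q"
proof (induction N)
  case 0
  then show ?case using assms by simp
next
  case (Suc N)
  have q: "q > 0" using assms by simp
  have eq: "{n. n < Suc N \<and> n mod q = a} =
      {n. n < N \<and> n mod q = a} \<union> (if N mod q = a then {N} else {})"
    by (auto simp: less_Suc_eq)
  \<comment> \<open>The quotient jumps exactly when its numerator reaches a multiple of q; the shift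
    by q - 1 - a places these jumps at the N with N mod q = a.\<close>
  have iff: "Suc (N + (q - 1 - a)) mod q = 0 \<longleftrightarrow> N mod q = a"
  proof -
    have "Suc (N + (q - 1 - a)) mod q = (N mod q + (q - a)) mod q"
      using assms by (subst mod_add_left_eq) (auto intro!: arg_cong[where f = "\<lambda>m. m mod q"])
    also have "\<dots> = 0 \<longleftrightarrow> N mod q = a"
    proof
      assume "(N mod q + (q - a)) mod q = 0"
      then have "q dvd N mod q + (q - a)" by auto
      then obtain k where k: "N mod q + (q - a) = q * k" by (auto elim: dvdE)
      have "N mod q < q" using q by simp
      then have "N mod q + (q - a) < q * 2" "N mod q + (q - a) > 0" using assms by linarith+
      with k have "k < 2" "k > 0" by (auto simp: zero_less_mult_iff)
      then have "k = 1" by simp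
      with k show "N mod q = a" using assms by simp
    qed (use assms in simp)
    finally show ?thesis .
  qed
  have "card {n. n < Suc N \<and> n mod q = a} =
      card {n. n < N \<and> n mod q = a} + (if N mod q = a then 1 else 0)"
    unfolding eq by (subst card_Un_disjoint) auto
  also have "\<dots> = (Suc N + (q - 1 - a)) div q"
    unfolding Suc.IH using iff by (simp add: div_Suc)
  finally show ?case .
qed

lemma card_residue_class:
  fixes N q a :: nat
  assumes "a < q"
  shows "\<bar>real (card {n. n < N \<and> n mod q = a}) - real N / real q\<bar> \<le> 1"
proof -
  define k where "k = (N + (q - 1 - a)) div q"
  have q: "q > 0" using assms by simp
  have "k * q \<le> N + (q - 1 - a)" unfolding k_def by simp
  moreover have "N + (q - 1 - a) < (k + 1) * q"
    unfolding k_def using q by (metis Suc_eq_plus1 dividend_less_div_times mult_Suc add.commute)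
  ultimately have "k * q \<le> N + q" "N \<le> (k + 1) * q" using assms by (auto simp: algebra_simps)
  then have "real k * q \<le> N + q" "real N \<le> (k + 1) * q"
    by (metis of_nat_add of_nat_le_iff of_nat_mult, metis of_nat_le_iff of_nat_mult)
  then have "\<bar>real k - real N / real q\<bar> \<le> 1"
    using q by (simp add: abs_le_iff field_simps)
  then show ?thesis unfolding card_residue_class_eq[OF assms] k_def .
qed

text \<open>By the Chinese remainder theorem every choice of one residue per prime is a single class
  modulo the product of the primes, met N / q times up to an error of 1, and there are k ^ card A
  choices. The error is two-sided because the sieve uses these counts with alternating
  signs.\<close>

lemma card_sieve_conditions:
  fixes A :: "nat set" and \<Omega> :: "nat \<Rightarrow> nat set" and N k :: nat
  assumes fin: "finite A" and pr: "\<And>p. p \<in> A \<Longrightarrow> prime p"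
    and \<Omega>: "\<And>p. p \<in> A \<Longrightarrow> \<Omega> p \<subseteq> {..<p}" "\<And>p. p \<in> A \<Longrightarrow> card (\<Omega> p) = k"
  shows "\<bar>real (card {n. n < N \<and> (\<forall>p\<in>A. n mod p \<in> \<Omega> p)}) - real N * (\<Prod>p\<in>A. real k / real p)\<bar>
           \<le> real k ^ card A"
proof -
  define q where "q = \<Prod>A"
  define C where "C u = {n. n < N \<and> (\<forall>p\<in>A. n mod p = u p)}" for u
  have pos: "p > 0" if "p \<in> A" for p using pr[OF that] by (rule prime_gt_0_nat)
  have q: "q > 0" unfolding q_def using pos by (intro prod_pos) auto
  have fin\<Omega>: "finite (\<Omega> p)" if "p \<in> A" for p using \<Omega>(1)[OF that] finite_subset by blast
  have UN: "{n. n < N \<and> (\<forall>p\<in>A. n mod p \<in> \<Omega> p)} = (\<Union>u\<in>PiE A \<Omega>. C u)"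
  proof (intro equalityI subsetI)
    fix n assume n: "n \<in> {n. n < N \<and> (\<forall>p\<in>A. n mod p \<in> \<Omega> p)}"
    then have "(\<lambda>p\<in>A. n mod p) \<in> PiE A \<Omega>" "n \<in> C (\<lambda>p\<in>A. n mod p)" by (auto simp: C_def)
    then show "n \<in> (\<Union>u\<in>PiE A \<Omega>. C u)" by blast
  qed (auto simp: C_def)
  have disj: "C u \<inter> C v = {}" if "u \<in> PiE A \<Omega>" "v \<in> PiE A \<Omega>" "u \<noteq> v" for u v
    using that PiE_ext[of u A \<Omega> v] by (fastforce simp: C_def)
  have finPi: "finite (PiE A \<Omega>)" using fin fin\<Omega> by (intro finite_PiE) auto
  have cardC: "real (card {n. n < N \<and> (\<forall>p\<in>A. n mod p \<in> \<Omega> p)}) = (\<Sum>u\<in>PiE A \<Omega>. real (card (C u)))"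
    unfolding UN using disj finPi
    by (subst card_UN_disjoint) (auto simp: C_def)
  have cardPi: "card (PiE A \<Omega>) = k ^ card A"
    using fin \<Omega>(2) by (simp add: card_PiE)
  have main: "real N * (\<Prod>p\<in>A. real k / real p) = (\<Sum>u\<in>PiE A \<Omega>. real N / real q)"
    using cardPi by (simp add: prod_dividef q_def)
  have "\<bar>real (card (C u)) - real N / real q\<bar> \<le> 1" if u: "u \<in> PiE A \<Omega>" for u
  proof -
    have up: "u p < p" if "p \<in> A" for p using u \<Omega>(1)[OF that] that by (auto simp: PiE_def Pi_def)
    have "\<exists>!x. x < (\<Prod>p\<in>A. p) \<and> (\<forall>p\<in>A. [x = u p] (mod p))"
      using fin pos pr by (intro chinese_remainder_unique_nat) (auto intro: primes_coprime)
    then obtain a where a: "a < q" "\<forall>p\<in>A. [a = u p] (mod p)"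
      and uniq: "\<And>b. b < q \<Longrightarrow> \<forall>p\<in>A. [b = u p] (mod p) \<Longrightarrow> b = a"
      unfolding q_def by auto
    have dvd: "p dvd q" if "p \<in> A" for p unfolding q_def using fin that by (rule dvd_prodI)
    have "C u = {n. n < N \<and> n mod q = a}"
    proof (intro equalityI subsetI)
      fix n assume n: "n \<in> C u"
      have "\<forall>p\<in>A. [n mod q = u p] (mod p)"
        using n up dvd by (auto simp: C_def cong_def mod_mod_cancel)
      then have "n mod q = a" using q by (intro uniq) auto
      then show "n \<in> {n. n < N \<and> n mod q = a}" using n by (auto simp: C_def)
    next
      fix n assume n: "n \<in> {n. n < N \<and> n mod q = a}"
      have "n mod p = u p" if p: "p \<in> A" for p
      proof -
        have "n mod p = (n mod q) mod p" using dvd[OF p] by (simp add: mod_mod_cancel)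
        also have "\<dots> = u p" using n a(2) p up[OF p] by (auto simp: cong_def)
        finally show ?thesis .
      qed
      then show "n \<in> C u" using n by (auto simp: C_def)
    qed
    then show ?thesis using card_residue_class[OF a(1)] by simp
  qed
  then have "\<bar>\<Sum>u\<in>PiE A \<Omega>. real (card (C u)) - real N / real q\<bar> \<le> (\<Sum>u\<in>PiE A \<Omega>. 1)"
    by (intro order.trans[OF sum_abs] sum_mono)
  then show ?thesis unfolding cardC main sum_subtractf[symmetric] using cardPi by simp
qed

text \<open>An alternating sum of binomial coefficients of m, cut off after j, is (-1)^j times the
  binomial coefficient of m - 1 over j. Cutting off at an even j therefore leaves something
  nonnegative, which is what an upper bound sieve requires.\<close>

lemma bonferroni_even:
  fixes D :: "'a set"
  assumes "finite D"
  shows "(if D = {} then 1 else 0 :: real) \<le> (\<Sum>A | A \<subseteq> D \<and> card A \<le> 2 * r. (-1) ^ card A)"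
proof (cases "D = {}")
  case True
  then have "{A. A \<subseteq> D \<and> card A \<le> 2 * r} = {{}}" by auto
  with True show ?thesis by simp
next
  case False
  have "{A. A \<subseteq> D \<and> card A \<le> 2 * r} = (\<Union>j\<le>2*r. {A. A \<subseteq> D \<and> card A = j})" by auto
  then have "(\<Sum>A | A \<subseteq> D \<and> card A \<le> 2 * r. (-1::real) ^ card A) =
      (\<Sum>j\<le>2*r. \<Sum>A | A \<subseteq> D \<and> card A = j. (-1) ^ card A)"
    using assms by (simp add: sum.UNION_disjoint disjoint_iff)
  also have "\<dots> = (\<Sum>j\<le>2*r. (real (card D) gchoose j) * (-1) ^ j)"
    using assms by (intro sum.cong) (auto simp: n_subsets binomial_gbinomial)
  also have "\<dots> = (real (card D) - 1 gchoose (2*r))"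
    by (subst gbinomial_sum_lower_neg) simp
  also have "real (card D) - 1 = real (card D - 1)"
    using False assms by (simp add: of_nat_diff card_gt_0_iff Suc_leI)
  finally show ?thesis using False by (simp add: binomial_gbinomial[symmetric])
qed

lemma sum_Pow_prod:
  fixes g :: "'a \<Rightarrow> 'b :: comm_semiring_1"
  assumes "finite P"
  shows "(\<Sum>A\<in>Pow P. \<Prod>p\<in>A. g p) = (\<Prod>p\<in>P. 1 + g p)"
  using prod_add[OF assms, of g "\<lambda>_. 1"] by (simp add: add.commute)

lemma prod_one_plus_le_exp:
  fixes g :: "'a \<Rightarrow> real"
  assumes "finite P" "\<And>p. p \<in> P \<Longrightarrow> g p \<ge> -1"
  shows "(\<Prod>p\<in>P. 1 + g p) \<le> exp (\<Sum>p\<in>P. g p)"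
  unfolding exp_sum[OF assms(1)] using assms(2) by (intro prod_mono) (force simp: exp_ge_add_one_self)

text \<open>Both truncation errors are estimated by Rankin's trick: the tail over large subsets is
  weighted by \<open>exp (card A - 2 * r)\<close>, the remainder terms by \<open>Y ^ (2 * r - card A)\<close>.\<close>

lemma brun_pure_sieve:
  fixes P :: "nat set" and \<Omega> :: "nat \<Rightarrow> nat set" and N k r :: nat and Y s :: real
  assumes fin: "finite P" and pr: "\<And>p. p \<in> P \<Longrightarrow> prime p"
    and \<Omega>: "\<And>p. p \<in> P \<Longrightarrow> \<Omega> p \<subseteq> {..<p}" "\<And>p. p \<in> P \<Longrightarrow> card (\<Omega> p) = k"
    and Y: "Y \<ge> 1" "Y \<ge> real (card P)"
  defines "s \<equiv> \<Sum>p\<in>P. 1 / real p"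
  shows "real (card {n. n < N \<and> (\<forall>p\<in>P. n mod p \<notin> \<Omega> p)})
     \<le> N * exp (- (k * s)) + N * exp (exp 1 * k * s - 2 * r) + Y ^ (2 * r) * exp k"
proof -
  define S where "S = {A. A \<subseteq> P \<and> card A \<le> 2 * r}"
  define g where "g A = (\<Prod>p\<in>A. real k / real p)" for A
  define c where "c A = real (card {n. n < N \<and> (\<forall>p\<in>A. n mod p \<in> \<Omega> p)})" for A
  have finS: "finite S" unfolding S_def using fin by simp
  have SP: "S \<subseteq> Pow P" by (auto simp: S_def)
  have gnn: "g A \<ge> 0" for A unfolding g_def by (intro prod_nonneg) auto
  have kp: "real k / real p \<le> 1" if p: "p \<in> P" for p
  proof -
    have "k \<le> p" using \<Omega>[OF p] card_mono[of "{..<p}" "\<Omega> p"] by simp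
    then show ?thesis using prime_gt_0_nat[OF pr[OF p]] by simp
  qed
  have "real (card {n. n < N \<and> (\<forall>p\<in>P. n mod p \<notin> \<Omega> p)}) =
      (\<Sum>n<N. if {p\<in>P. n mod p \<in> \<Omega> p} = {} then 1 else 0)"
  proof -
    have "{n. n < N \<and> (\<forall>p\<in>P. n mod p \<notin> \<Omega> p)} = {n\<in>{..<N}. {p\<in>P. n mod p \<in> \<Omega> p} = {}}" by auto
    then show ?thesis by (simp add: sum.If_cases Int_def)
  qed
  also have "\<dots> \<le> (\<Sum>n<N. \<Sum>A\<in>S. if \<forall>p\<in>A. n mod p \<in> \<Omega> p then (-1) ^ card A else 0)"
  proof (rule sum_mono)
    fix n
    have "{A. A \<subseteq> {p\<in>P. n mod p \<in> \<Omega> p} \<and> card A \<le> 2 * r} = {A\<in>S. \<forall>p\<in>A. n mod p \<in> \<Omega> p}"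
      by (auto simp: S_def)
    then have "(\<Sum>A | A \<subseteq> {p\<in>P. n mod p \<in> \<Omega> p} \<and> card A \<le> 2 * r. (-1::real) ^ card A) =
        (\<Sum>A\<in>S. if \<forall>p\<in>A. n mod p \<in> \<Omega> p then (-1) ^ card A else 0)"
      using finS by (simp add: sum.inter_filter[symmetric])
    then show "(if {p\<in>P. n mod p \<in> \<Omega> p} = {} then 1 else 0) \<le>
        (\<Sum>A\<in>S. if \<forall>p\<in>A. n mod p \<in> \<Omega> p then (-1) ^ card A else 0 :: real)"
      using bonferroni_even[of "{p\<in>P. n mod p \<in> \<Omega> p}" r] fin by simp
  qed
  also have "\<dots> = (\<Sum>A\<in>S. \<Sum>n<N. if \<forall>p\<in>A. n mod p \<in> \<Omega> p then (-1) ^ card A else 0)"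
    by (rule sum.swap)
  also have "\<dots> = (\<Sum>A\<in>S. (-1) ^ card A * c A)"
  proof (rule sum.cong)
    fix A
    have "{n. n < N \<and> (\<forall>p\<in>A. n mod p \<in> \<Omega> p)} = {n\<in>{..<N}. \<forall>p\<in>A. n mod p \<in> \<Omega> p}" by auto
    then show "(\<Sum>n<N. if \<forall>p\<in>A. n mod p \<in> \<Omega> p then (-1) ^ card A else 0) = (-1) ^ card A * c A"
      unfolding c_def by (simp add: sum.If_cases Int_def)
  qed simp
  also have "\<dots> \<le> (\<Sum>A\<in>S. (-1) ^ card A * (N * g A) + real k ^ card A)"
  proof (rule sum_mono)
    fix A assume A: "A \<in> S"
    then have "A \<subseteq> P" by (auto simp: S_def)
    then have "\<bar>c A - N * g A\<bar> \<le> real k ^ card A"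
      unfolding c_def g_def using fin pr \<Omega>
      by (intro card_sieve_conditions) (auto intro: finite_subset)
    then have "\<bar>(-1) ^ card A * (c A - N * g A)\<bar> \<le> real k ^ card A"
      by (simp add: abs_mult)
    then show "(-1) ^ card A * c A \<le> (-1) ^ card A * (N * g A) + real k ^ card A"
      by (simp add: algebra_simps abs_le_iff)
  qed
  also have "\<dots> = N * (\<Sum>A\<in>S. (-1) ^ card A * g A) + (\<Sum>A\<in>S. real k ^ card A)"
    by (simp add: sum.distrib sum_distrib_left mult_ac)
  finally have step: "real (card {n. n < N \<and> (\<forall>p\<in>P. n mod p \<notin> \<Omega> p)}) \<le>
    N * (\<Sum>A\<in>S. (-1) ^ card A * g A) + (\<Sum>A\<in>S. real k ^ card A)" .

  \<comment> \<open>Over all subsets the signed sum factors into a product over primes; discarding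
    the subsets with more than 2 * r elements then costs at most their unsigned sum.\<close>
  have "(\<Sum>A\<in>Pow P. (-1) ^ card A * g A) = (\<Prod>p\<in>P. 1 + - (real k / real p))"
    unfolding sum_Pow_prod[OF fin, symmetric] g_def by (simp add: prod_uminus)
  also have "\<dots> \<le> exp (\<Sum>p\<in>P. - (real k / real p))"
    using fin kp by (intro prod_one_plus_le_exp) auto
  also have "\<dots> = exp (- (k * s))" by (simp add: s_def sum_distrib_left sum_negf)
  finally have full: "(\<Sum>A\<in>Pow P. (-1) ^ card A * g A) \<le> exp (- (k * s))" .
  have "(\<Sum>A\<in>Pow P. (-1) ^ card A * g A) =
      (\<Sum>A\<in>S. (-1) ^ card A * g A) + (\<Sum>A\<in>Pow P - S. (-1) ^ card A * g A)"
    using sum.subset_diff[OF SP, of "\<lambda>A. (-1) ^ card A * g A"] fin by simp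
  moreover have "(\<Sum>A\<in>Pow P - S. (-1) ^ card A * g A) \<ge> - (\<Sum>A\<in>Pow P - S. g A)"
    unfolding sum_negf[symmetric] using gnn
    by (intro sum_mono) (auto simp: minus_one_power_iff)
  moreover have "(\<Sum>A\<in>Pow P - S. g A) \<le> exp (exp 1 * k * s - 2 * r)"
  proof -
    have "(\<Sum>A\<in>Pow P - S. g A) \<le> (\<Sum>A\<in>Pow P - S. exp (- (2 * real r)) * (exp 1 ^ card A * g A))"
    proof (rule sum_mono)
      fix A assume "A \<in> Pow P - S"
      then have "card A \<ge> 2 * r" by (auto simp: S_def)
      then have "exp (- (2 * real r)) * exp 1 ^ card A \<ge> 1"
        by (simp add: exp_of_nat_mult[symmetric] exp_add[symmetric])
      then show "g A \<le> exp (- (2 * real r)) * (exp 1 ^ card A * g A)"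
        using gnn[of A] by (metis mult.assoc mult_right_mono mult_1)
    qed
    also have "\<dots> \<le> (\<Sum>A\<in>Pow P. exp (- (2 * real r)) * (exp 1 ^ card A * g A))"
      using fin gnn by (intro sum_mono2) auto
    also have "\<dots> = exp (- (2 * real r)) * (\<Sum>A\<in>Pow P. \<Prod>p\<in>A. exp 1 * (real k / real p))"
      unfolding g_def sum_distrib_left by (simp only: prod.distrib prod_constant)
    also have "\<dots> = exp (- (2 * real r)) * (\<Prod>p\<in>P. 1 + exp 1 * (real k / real p))"
      using fin by (simp add: sum_Pow_prod)
    also have "\<dots> \<le> exp (- (2 * real r)) * exp (\<Sum>p\<in>P. exp 1 * (real k / real p))"
    proof (intro mult_left_mono prod_one_plus_le_exp fin)
      fix p
      have "exp (1::real) * (real k / real p) \<ge> 0" by simp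
      then show "exp (1::real) * (real k / real p) \<ge> -1" by linarith
    qed simp
    also have "\<dots> = exp (exp 1 * k * s - 2 * r)"
      by (simp add: s_def sum_distrib_left exp_add[symmetric] mult_ac)
    finally show ?thesis .
  qed
  ultimately have main: "(\<Sum>A\<in>S. (-1) ^ card A * g A) \<le> exp (- (k * s)) + exp (exp 1 * k * s - 2 * r)"
    using full by linarith

  have err: "(\<Sum>A\<in>S. real k ^ card A) \<le> Y ^ (2 * r) * exp k"
  proof -
    have "(\<Sum>A\<in>S. real k ^ card A) \<le> (\<Sum>A\<in>S. Y ^ (2 * r) * (\<Prod>p\<in>A. real k / Y))"
    proof (rule sum_mono)
      fix A assume "A \<in> S"
      then have "Y ^ card A \<le> Y ^ (2 * r)" using Y by (intro power_increasing) (auto simp: S_def)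
      then have "real k ^ card A * Y ^ card A \<le> Y ^ (2 * r) * real k ^ card A"
        using mult_left_mono[of "Y ^ card A" "Y ^ (2 * r)" "real k ^ card A"] by (simp add: mult_ac)
      then show "real k ^ card A \<le> Y ^ (2 * r) * (\<Prod>p\<in>A. real k / Y)"
        using Y by (simp add: power_divide field_simps)
    qed
    also have "\<dots> \<le> (\<Sum>A\<in>Pow P. Y ^ (2 * r) * (\<Prod>p\<in>A. real k / Y))"
      using fin SP Y by (intro sum_mono2) (auto intro!: mult_nonneg_nonneg)
    also have "\<dots> = Y ^ (2 * r) * (\<Prod>p\<in>P. 1 + real k / Y)"
      by (simp only: sum_distrib_left[symmetric] sum_Pow_prod[OF fin])
    also have "\<dots> \<le> Y ^ (2 * r) * exp (\<Sum>p\<in>P. real k / Y)"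
    proof (intro mult_left_mono prod_one_plus_le_exp fin)
      have "real k / Y \<ge> 0" using Y by simp
      then show "real k / Y \<ge> -1" by linarith
    qed (use Y in simp)
    also have "\<dots> \<le> Y ^ (2 * r) * exp k"
    proof -
      have "real (card P) * k \<le> Y * k" using Y by (intro mult_right_mono) auto
      then have "(\<Sum>p\<in>P. real k / Y) \<le> k" using Y by (simp add: field_simps)
      then show ?thesis using Y by (intro mult_left_mono) auto
    qed
    finally show ?thesis .
  qed
  have "N * (\<Sum>A\<in>S. (-1) ^ card A * g A) \<le> N * (exp (- (k * s)) + exp (exp 1 * k * s - 2 * r))"
    using main by (intro mult_left_mono) auto
  with step err show ?thesis by (simp add: algebra_simps)
qed

subsection \<open>The singular series on average\<close>

definition twin_factor :: "nat \<Rightarrow> real" where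
  "twin_factor p = (if prime p \<and> p > 2 then 1 - 1 / (real p - 1)\<^sup>2 else 1)"

text \<open>The twin prime constant. The singular series of d is 2 * \<open>twin_const\<close> times
  a finite product over the odd primes dividing d.\<close>

definition twin_const :: real where
  "twin_const = prodinf twin_factor"

lemma twin_factor_pos: "twin_factor p > 0"
proof (cases "prime p \<and> p > 2")
  case True
  then have "1 < real p - 1" by simp
  then have "(real p - 1)\<^sup>2 > 1" by (intro one_less_power) auto
  then show ?thesis using True by (simp add: twin_factor_def)
qed (auto simp: twin_factor_def)

lemma twin_factor_le_1: "twin_factor p \<le> 1"
  by (simp add: twin_factor_def)

text \<open>Averaging the singular series over d turns the factor 1 + 1 / (p - 2), present when p
  divides d, into 1 + 1 / (p * (p - 2)). That this inverts the local factor of the twin prime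
  constant is why the average comes out as exactly 1. The algebra is (p - 1)^2 - 1 = p * (p -
  2).\<close>

lemma twin_factor_inverse:
  assumes "prime p" "p > 2"
  shows "1 + 1 / (real p * (real p - 2)) = inverse (twin_factor p)"
proof -
  have "real p > 2" using assms by simp
  then have "(real p - 1)\<^sup>2 > 0" "real p * (real p - 2) > 0" by simp_all
  moreover have "(real p - 1)\<^sup>2 = real p * (real p - 2) + 1"
    by (simp add: power2_eq_square algebra_simps)
  moreover have "twin_factor p = ((real p - 1)\<^sup>2 - 1) / (real p - 1)\<^sup>2"
    using assms \<open>(real p - 1)\<^sup>2 > 0\<close> by (simp add: twin_factor_def diff_divide_distrib)
  ultimately show ?thesis
    by (metis add_diff_cancel_right' add_divide_distrib divide_self inverse_divide less_irrefl)
qed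

lemma convergent_prod_twin_factor: "convergent_prod twin_factor"
proof -
  have "summable (\<lambda>n::nat. 4 * (1 / real n ^ 2))"
    by (intro summable_mult) (use inverse_power_summable[of 2, where ?'a = real] in \<open>simp add: inverse_eq_divide\<close>)
  then have "summable (\<lambda>p. norm (twin_factor p - 1))"
  proof (rule summable_comparison_test_ev[rotated], intro always_eventually allI)
    fix p :: nat
    show "norm (norm (twin_factor p - 1)) \<le> 4 * (1 / real p ^ 2)"
    proof (cases "prime p \<and> p > 2")
      case True
      then have "real p > 2" by simp
      then have "(real p / 2)\<^sup>2 \<le> (real p - 1)\<^sup>2" by (intro power_mono) auto
      then have "1 / (real p - 1)\<^sup>2 \<le> 1 / (real p / 2)\<^sup>2"
        using \<open>real p > 2\<close> by (intro divide_left_mono) auto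
      then show ?thesis using True by (simp add: twin_factor_def power_divide)
    qed (auto simp: twin_factor_def)
  qed
  then show ?thesis
    by (intro abs_convergent_prod_imp_convergent_prod summable_imp_abs_convergent_prod)
qed

lemma twin_factor_LIMSEQ: "(\<lambda>n. \<Prod>i\<le>n. twin_factor i) \<longlonglongrightarrow> twin_const"
  unfolding twin_const_def by (rule convergent_prod_LIMSEQ[OF convergent_prod_twin_factor])

lemma twin_const_pos: "twin_const > 0"
proof -
  have "twin_const \<noteq> 0" unfolding twin_const_def
    by (intro prodinf_nonzero convergent_prod_twin_factor) (use twin_factor_pos in \<open>metis less_irrefl\<close>)
  moreover have "twin_const \<ge> 0"
    by (rule LIMSEQ_le_const[OF twin_factor_LIMSEQ])
      (auto intro!: exI[of _ 0] prod_pos less_imp_le twin_factor_pos)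
  ultimately show ?thesis by simp
qed

lemma twin_const_le:
  assumes "finite P"
  shows "twin_const \<le> (\<Prod>p\<in>P. twin_factor p)"
proof (rule LIMSEQ_le_const2[OF twin_factor_LIMSEQ])
  obtain N where N: "P \<subseteq> {..N}" using assms finite_nat_set_iff_bounded_le by auto
  show "\<exists>N. \<forall>n\<ge>N. (\<Prod>i\<le>n. twin_factor i) \<le> (\<Prod>p\<in>P. twin_factor p)"
  proof (intro exI[of _ N] allI impI)
    fix n assume "n \<ge> N"
    then have P: "P \<subseteq> {..n}" using N by auto
    have "(\<Prod>i\<le>n. twin_factor i) = (\<Prod>p\<in>{..n} - P. twin_factor p) * (\<Prod>p\<in>P. twin_factor p)"
      using P by (intro prod.subset_diff) auto
    also have "\<dots> \<le> 1 * (\<Prod>p\<in>P. twin_factor p)"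
      using twin_factor_pos twin_factor_le_1
      by (intro mult_right_mono prod_le_1 prod_nonneg) (auto intro: less_imp_le)
    finally show "(\<Prod>i\<le>n. twin_factor i) \<le> (\<Prod>p\<in>P. twin_factor p)" by simp
  qed
qed

text \<open>For lower bounds: a set of primes fixed in advance involves only finitely many moduli,
  so their rounding errors stay bounded as the range of d grows.\<close>

lemma twin_const_approx:
  assumes "\<epsilon> > 0"
  obtains P where "finite P" "\<And>p. p \<in> P \<Longrightarrow> prime p \<and> p > 2"
    "twin_const \<ge> (1 - \<epsilon>) * (\<Prod>p\<in>P. twin_factor p)"
proof -
  have "(\<lambda>n. (1 - \<epsilon>) * (\<Prod>i\<le>n. twin_factor i)) \<longlonglongrightarrow> (1 - \<epsilon>) * twin_const"
    by (intro tendsto_intros twin_factor_LIMSEQ)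
  moreover have "(1 - \<epsilon>) * twin_const < twin_const" using assms twin_const_pos by simp
  ultimately have "\<forall>\<^sub>F n in sequentially. (1 - \<epsilon>) * (\<Prod>i\<le>n. twin_factor i) < twin_const"
    by (rule order_tendstoD)
  then obtain n where n: "(1 - \<epsilon>) * (\<Prod>i\<le>n. twin_factor i) < twin_const"
    by (auto dest: eventually_happens)
  have "(\<Prod>i\<le>n. twin_factor i) = (\<Prod>p | p \<le> n \<and> prime p \<and> p > 2. twin_factor p)"
    by (rule prod.mono_neutral_right) (auto simp: twin_factor_def)
  with n show ?thesis by (intro that[of "{p. p \<le> n \<and> prime p \<and> p > 2}"]) auto
qed

text \<open>Since (p - 1) / (p - 2) = 1 + 1 / (p - 2), the product expands into a sum over
  squarefree odd divisors of d, encoded as sets of primes. In this form the sum over d can be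
  exchanged with it.\<close>

lemma singular_series_eq:
  assumes "d > 0"
  shows "singular_series d =
    2 * twin_const * (\<Sum>A\<in>Pow {p. prime p \<and> p dvd d \<and> p > 2}. \<Prod>p\<in>A. 1 / (real p - 2))"
proof -
  have fin: "finite {p. prime p \<and> p dvd d \<and> p > 2}"
    by (rule finite_subset[of _ "{..d}"]) (use assms in \<open>auto dest: dvd_imp_le\<close>)
  have "(\<Sum>A\<in>Pow {p. prime p \<and> p dvd d \<and> p > 2}. \<Prod>p\<in>A. 1 / (real p - 2)) =
     (\<Prod>p | prime p \<and> p dvd d \<and> p > 2. 1 + 1 / (real p - 2))"
    by (rule sum_Pow_prod[OF fin])
  also have "\<dots> = (\<Prod>p | prime p \<and> p dvd d \<and> p > 2. (real p - 1) / (real p - 2))"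
    by (intro prod.cong) (auto simp: field_simps)
  finally show ?thesis
    by (simp add: singular_series_def twin_const_def twin_factor_def[abs_def])
qed

lemma singular_series_pos:
  assumes "d > 0"
  shows "singular_series d > 0"
proof -
  have "(\<Prod>p | prime p \<and> p dvd d \<and> p > 2. (real p - 1) / (real p - 2)) > 0"
    by (intro prod_pos) auto
  then show ?thesis using twin_const_pos
    by (simp add: singular_series_def twin_const_def twin_factor_def[abs_def])
qed

section \<open>Averages over even differences\<close>

definition evens_upto :: "nat \<Rightarrow> nat set" where
  "evens_upto n = {d. 2 \<le> d \<and> d \<le> n \<and> even d}"

lemma finite_evens_upto [simp, intro]: "finite (evens_upto n)"
  by (rule finite_subset[of _ "{..n}"]) (auto simp: evens_upto_def)

lemma prod_primes_dvd_iff: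
  fixes A :: "nat set"
  assumes "finite A" "\<And>p. p \<in> A \<Longrightarrow> prime p"
  shows "\<Prod>A dvd d \<longleftrightarrow> (\<forall>p\<in>A. p dvd d)"
proof
  assume "\<Prod>A dvd d"
  then show "\<forall>p\<in>A. p dvd d" using assms(1) by (meson dvd_prodI dvd_trans prod_dvd_prod_subset)
next
  assume "\<forall>p\<in>A. p dvd d"
  with assms show "\<Prod>A dvd d"
  proof (induction A rule: finite_induct)
    case (insert p A)
    have "coprime p (\<Prod>A)"
      using insert by (intro prod_coprime_right) (auto intro: primes_coprime)
    then show ?case using insert by (simp add: divides_mult)
  qed simp
qed

lemma sum_evens_dvd:
  fixes A :: "nat set" and w :: "nat \<Rightarrow> real"
  assumes "finite A" "\<And>p. p \<in> A \<Longrightarrow> prime p \<and> p > 2"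
  shows "(\<Sum>d | d \<in> evens_upto n \<and> (\<forall>p\<in>A. p dvd d). w d) =
    (\<Sum>m=1..n div (2 * \<Prod>A). w (2 * \<Prod>A * m))"
proof -
  have "odd (\<Prod>A)"
    using assms by (subst even_prod_iff) (auto dest: prime_odd_nat)
  then have cop: "coprime 2 (\<Prod>A)" by (simp add: coprime_left_2_iff_odd)
  have pos: "\<Prod>A > 0" using assms by (intro prod_pos) (auto intro: prime_gt_0_nat)
  have "{d. d \<in> evens_upto n \<and> (\<forall>p\<in>A. p dvd d)} = (\<lambda>m. 2 * \<Prod>A * m) ` {1..n div (2 * \<Prod>A)}"
  proof (intro equalityI subsetI)
    fix d assume d: "d \<in> {d. d \<in> evens_upto n \<and> (\<forall>p\<in>A. p dvd d)}"
    then have "\<Prod>A dvd d" using assms by (subst prod_primes_dvd_iff) auto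
    then have "2 * \<Prod>A dvd d" using d cop by (intro divides_mult) (auto simp: evens_upto_def)
    then obtain m where m: "d = 2 * \<Prod>A * m" by (auto elim: dvdE)
    then have "m \<ge> 1" "2 * \<Prod>A * m \<le> n" using d by (auto simp: evens_upto_def)
    then have "m \<in> {1..n div (2 * \<Prod>A)}" using pos by (simp add: less_eq_div_iff_mult_less_eq mult.commute)
    then show "d \<in> (\<lambda>m. 2 * \<Prod>A * m) ` {1..n div (2 * \<Prod>A)}" using m by blast
  next
    fix d assume "d \<in> (\<lambda>m. 2 * \<Prod>A * m) ` {1..n div (2 * \<Prod>A)}"
    then have "\<exists>m\<in>{1..n div (2 * \<Prod>A)}. d = 2 * \<Prod>A * m" by (simp only: image_iff)
    then obtain m where m: "d = 2 * \<Prod>A * m" "m \<in> {1..n div (2 * \<Prod>A)}" by blast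
    then have "m \<ge> 1" "m \<le> n div (2 * \<Prod>A)" by simp_all
    then have le: "2 * \<Prod>A * m \<le> n" using pos by (simp add: less_eq_div_iff_mult_less_eq mult.commute)
    have "d \<noteq> 0" using m pos by simp
    moreover have "even d" using m by simp
    ultimately have "2 \<le> d" by (metis dvd_imp_le gr0I)
    moreover have "p dvd d" if "p \<in> A" for p
      using dvd_prodI[OF assms(1) that, of "\<lambda>x. x"] m(1) by (simp add: dvd_mult dvd_mult2)
    ultimately show "d \<in> {d. d \<in> evens_upto n \<and> (\<forall>p\<in>A. p dvd d)}"
      using le m \<open>even d\<close> by (auto simp: evens_upto_def)
  qed
  moreover have "inj_on (\<lambda>m. 2 * \<Prod>A * m) {1..n div (2 * \<Prod>A)}" using pos by (auto simp: inj_on_def)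
  ultimately show ?thesis by (simp add: sum.reindex)
qed

text \<open>The expansion of the singular series is truncated to divisors composed of primes in P.
  If P holds all odd primes up to n, nothing is lost, which gives the upper bound; a fixed P gives a
  minorant, since all terms are nonnegative, and hence the lower bound.\<close>

lemma sum_singular_series_restrict:
  fixes w :: "nat \<Rightarrow> real"
  assumes "finite P" "\<And>p. p \<in> P \<Longrightarrow> prime p \<and> p > 2"
  shows "(\<Sum>d\<in>evens_upto n. (\<Sum>A | A \<subseteq> P \<and> (\<forall>p\<in>A. p dvd d). \<Prod>p\<in>A. 1 / (real p - 2)) * w d)
    = (\<Sum>A\<in>Pow P. (\<Prod>p\<in>A. 1 / (real p - 2)) * (\<Sum>m=1..n div (2 * \<Prod>A). w (2 * \<Prod>A * m)))"
    (is "?L = ?R")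
proof -
  have "?L = (\<Sum>d\<in>evens_upto n. \<Sum>A\<in>Pow P. if \<forall>p\<in>A. p dvd d then (\<Prod>p\<in>A. 1 / (real p - 2)) * w d else 0)"
  proof (rule sum.cong)
    fix d
    have "{A. A \<subseteq> P \<and> (\<forall>p\<in>A. p dvd d)} = {A\<in>Pow P. \<forall>p\<in>A. p dvd d}" by auto
    then show "(\<Sum>A | A \<subseteq> P \<and> (\<forall>p\<in>A. p dvd d). \<Prod>p\<in>A. 1 / (real p - 2)) * w d =
      (\<Sum>A\<in>Pow P. if \<forall>p\<in>A. p dvd d then (\<Prod>p\<in>A. 1 / (real p - 2)) * w d else 0)"
      using assms(1) by (simp only: sum_distrib_right) (subst sum.inter_filter, auto)
  qed simp
  also have "\<dots> = (\<Sum>A\<in>Pow P. \<Sum>d\<in>evens_upto n. if \<forall>p\<in>A. p dvd d then (\<Prod>p\<in>A. 1 / (real p - 2)) * w d else 0)"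
    by (rule sum.swap)
  also have "\<dots> = ?R"
  proof (rule sum.cong)
    fix A assume "A \<in> Pow P"
    then have A: "finite A" "\<And>p. p \<in> A \<Longrightarrow> prime p \<and> p > 2" using assms by (auto intro: finite_subset)
    have "(\<Sum>d\<in>evens_upto n. if \<forall>p\<in>A. p dvd d then (\<Prod>p\<in>A. 1 / (real p - 2)) * w d else 0) =
      (\<Prod>p\<in>A. 1 / (real p - 2)) * (\<Sum>d | d \<in> evens_upto n \<and> (\<forall>p\<in>A. p dvd d). w d)"
      by (simp only: sum_distrib_left) (subst sum.inter_filter, auto)
    then show "(\<Sum>d\<in>evens_upto n. if \<forall>p\<in>A. p dvd d then (\<Prod>p\<in>A. 1 / (real p - 2)) * w d else 0) =
      (\<Prod>p\<in>A. 1 / (real p - 2)) * (\<Sum>m=1..n div (2 * \<Prod>A). w (2 * \<Prod>A * m))"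
      using sum_evens_dvd[OF A, where n = n and w = w] by simp
  qed simp
  finally show ?thesis .
qed

lemma sum_Pow_twin:
  assumes "finite P" "\<And>p. p \<in> P \<Longrightarrow> prime p \<and> p > 2"
  shows "(\<Sum>A\<in>Pow P. (\<Prod>p\<in>A. 1 / (real p - 2)) * (1 / real (\<Prod>A))) = inverse (\<Prod>p\<in>P. twin_factor p)"
proof -
  have "(\<Prod>p\<in>A. 1 / (real p - 2)) * (1 / real (\<Prod>A)) = (\<Prod>p\<in>A. 1 / (real p * (real p - 2)))" for A :: "nat set"
    by (simp add: prod_dividef of_nat_prod prod.distrib mult.commute)
  then have "(\<Sum>A\<in>Pow P. (\<Prod>p\<in>A. 1 / (real p - 2)) * (1 / real (\<Prod>A))) =
    (\<Sum>A\<in>Pow P. \<Prod>p\<in>A. 1 / (real p * (real p - 2)))" by simp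
  also have "\<dots> = (\<Prod>p\<in>P. 1 + 1 / (real p * (real p - 2)))" by (rule sum_Pow_prod[OF assms(1)])
  also have "\<dots> = (\<Prod>p\<in>P. inverse (twin_factor p))"
    using assms(2) by (intro prod.cong twin_factor_inverse) auto
  finally show ?thesis using prod_inversef[of twin_factor P] by (simp add: comp_def)
qed

text \<open>The singular series has mean value 1 over all integers. The hypothesis says that the
  multiples of 2 * q carry at most the share 1 / (2 * q) of the mass W; summed over the divisors,
  these shares give W times \<open>twin_const\<close> over a finite product of twin factors, a ratio
  of at most 1.\<close>

lemma sum_singular_series_le:
  fixes w :: "nat \<Rightarrow> real"
  assumes W: "\<And>q. q \<ge> 1 \<Longrightarrow> (\<Sum>m=1..n div (2 * q). w (2 * q * m)) \<le> W / (2 * real q)" and "W \<ge> 0"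
  shows "(\<Sum>d\<in>evens_upto n. singular_series d * w d) \<le> W"
proof -
  define P where "P = {p. p \<le> n \<and> prime p \<and> p > (2::nat)}"
  have P: "finite P" "\<And>p. p \<in> P \<Longrightarrow> prime p \<and> p > 2" by (auto simp: P_def)
  have "(\<Sum>d\<in>evens_upto n. singular_series d * w d) =
    2 * twin_const * (\<Sum>d\<in>evens_upto n. (\<Sum>A | A \<subseteq> P \<and> (\<forall>p\<in>A. p dvd d). \<Prod>p\<in>A. 1 / (real p - 2)) * w d)"
    unfolding sum_distrib_left
  proof (rule sum.cong)
    fix d assume d: "d \<in> evens_upto n"
    then have "p \<le> n" if "p dvd d" for p
      using dvd_imp_le[OF that] by (auto simp: evens_upto_def)
    then have "{A. A \<subseteq> P \<and> (\<forall>p\<in>A. p dvd d)} = Pow {p. prime p \<and> p dvd d \<and> p > 2}"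
      by (auto simp: P_def)
    then show "singular_series d * w d =
      2 * twin_const * ((\<Sum>A | A \<subseteq> P \<and> (\<forall>p\<in>A. p dvd d). \<Prod>p\<in>A. 1 / (real p - 2)) * w d)"
      using d by (simp add: singular_series_eq evens_upto_def)
  qed simp
  also have "\<dots> = 2 * twin_const * (\<Sum>A\<in>Pow P. (\<Prod>p\<in>A. 1 / (real p - 2)) * (\<Sum>m=1..n div (2 * \<Prod>A). w (2 * \<Prod>A * m)))"
    using P by (subst sum_singular_series_restrict) auto
  also have "\<dots> \<le> 2 * twin_const * (\<Sum>A\<in>Pow P. (\<Prod>p\<in>A. 1 / (real p - 2)) * (W / (2 * real (\<Prod>A))))"
  proof (intro mult_left_mono sum_mono)
    fix A assume A: "A \<in> Pow P"
    then have "\<Prod>A > 0" by (intro prod_pos) (auto simp: P_def prime_gt_0_nat)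
    then have "\<Prod>A \<ge> 1" by simp
    then show "(\<Sum>m=1..n div (2 * \<Prod>A). w (2 * \<Prod>A * m)) \<le> W / (2 * real (\<Prod>A))" by (rule W)
    show "0 \<le> (\<Prod>p\<in>A. 1 / (real p - 2))" using A by (intro prod_nonneg) (auto simp: P_def)
  qed (use twin_const_pos in auto)
  also have "\<dots> = twin_const * W * (\<Sum>A\<in>Pow P. (\<Prod>p\<in>A. 1 / (real p - 2)) * (1 / real (\<Prod>A)))"
    by (simp add: sum_distrib_left algebra_simps)
  also have "\<dots> = W * (twin_const * inverse (\<Prod>p\<in>P. twin_factor p))"
    using P by (subst sum_Pow_twin) auto
  also have "\<dots> \<le> W * 1"
  proof (intro mult_left_mono \<open>W \<ge> 0\<close>)
    have "(\<Prod>p\<in>P. twin_factor p) > 0" by (intro prod_pos) (auto simp: twin_factor_pos)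
    then show "twin_const * inverse (\<Prod>p\<in>P. twin_factor p) \<le> 1"
      using twin_const_le[OF P(1)] by (simp add: field_simps)
  qed
  finally show ?thesis by simp
qed

lemma sum_singular_series_upto_le: "(\<Sum>d\<in>evens_upto n. singular_series d) \<le> real n"
proof -
  have "(\<Sum>d\<in>evens_upto n. singular_series d * 1) \<le> real n"
  proof (rule sum_singular_series_le)
    fix q :: nat
    have "real (n div (2 * q)) \<le> real n / real (2 * q)" by (rule of_nat_div_le_of_nat)
    then show "(\<Sum>m=1..n div (2 * q). 1) \<le> real n / (2 * real q)" by simp
  qed simp
  then show ?thesis by simp
qed

lemma sum_inverse_multiples:
  "(\<Sum>m=1..N. 1 / real (2 * q * m)) = harm N / (2 * real q)"
  by (simp add: harm_def sum_divide_distrib inverse_eq_divide mult.commute)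

lemma sum_singular_series_div_le: "(\<Sum>d\<in>evens_upto n. singular_series d / real d) \<le> harm n"
proof -
  have "(\<Sum>d\<in>evens_upto n. singular_series d * (1 / real d)) \<le> harm n"
  proof (rule sum_singular_series_le)
    fix q :: nat assume "q \<ge> 1"
    then show "(\<Sum>m=1..n div (2 * q). 1 / real (2 * q * m)) \<le> harm n / (2 * real q)"
      unfolding sum_inverse_multiples by (intro divide_right_mono harm_mono) auto
  qed (simp add: harm_nonneg)
  then show ?thesis by simp
qed

text \<open>With the primes limited to a fixed finite set, every harmonic sum over multiples of 2 *
  q loses only the bounded amount ln (2 * q). The limitation itself costs a factor 1 -
  \<epsilon>.\<close>

lemma sum_singular_series_div_ge:
  assumes "\<epsilon> > 0"
  obtains K where "\<And>n. n \<ge> 1 \<Longrightarrow> (\<Sum>d\<in>evens_upto n. singular_series d / real d) \<ge> (1 - \<epsilon>) * ln n - K"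
proof -
  obtain P where P: "finite P" "\<And>p. p \<in> P \<Longrightarrow> prime p \<and> p > 2"
    and appr: "twin_const \<ge> (1 - \<epsilon>) * (\<Prod>p\<in>P. twin_factor p)"
    using twin_const_approx[OF assms] by metis
  define F where "F = (\<Prod>p\<in>P. twin_factor p)"
  \<comment> \<open>The product over all of P is the largest modulus that occurs, so one constant
    serves every subset A.\<close>
  define K where "K = ln (2 * real (\<Prod>P))"
  have Fpos: "F > 0" unfolding F_def by (intro prod_pos) (auto simp: twin_factor_pos)
  have le1: "twin_const / F \<le> 1" using twin_const_le[OF P(1)] Fpos by (simp add: F_def)
  have ge: "twin_const / F \<ge> 1 - \<epsilon>" using appr Fpos by (simp add: F_def field_simps)
  have Ppos: "\<Prod>A > 0" if "A \<subseteq> P" for A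
    using that P(2) by (intro prod_pos) (auto simp: prime_gt_0_nat)
  have hnn: "0 \<le> (\<Prod>p\<in>A. 1 / (real p - 2))" if "A \<subseteq> P" for A
    using that P(2) by (intro prod_nonneg) (auto simp: less_imp_le)
  have "1 \<le> \<Prod>P" using Ppos[of P] by simp
  then have "1 \<le> real (\<Prod>P)" by (metis of_nat_1 of_nat_le_iff)
  then have K0: "K \<ge> 0" unfolding K_def by (intro ln_ge_zero) linarith
  show ?thesis
  proof (rule that[of K])
    fix n :: nat assume n: "n \<ge> 1"
    have scale: "twin_const * x * (\<Sum>A\<in>Pow P. (\<Prod>p\<in>A. 1 / (real p - 2)) * (1 / real (\<Prod>A))) =
      2 * twin_const * (\<Sum>A\<in>Pow P. (\<Prod>p\<in>A. 1 / (real p - 2)) * (x / (2 * real (\<Prod>A))))" for x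
      by (simp add: sum_distrib_left algebra_simps)
    have "twin_const / F * (ln n - K) = twin_const * (ln n - K) * (\<Sum>A\<in>Pow P. (\<Prod>p\<in>A. 1 / (real p - 2)) * (1 / real (\<Prod>A)))"
      using sum_Pow_twin[OF P] by (simp add: F_def field_simps)
    also have "\<dots> = 2 * twin_const * (\<Sum>A\<in>Pow P. (\<Prod>p\<in>A. 1 / (real p - 2)) * ((ln n - K) / (2 * real (\<Prod>A))))"
      by (rule scale)
    also have "\<dots> \<le> 2 * twin_const * (\<Sum>A\<in>Pow P. (\<Prod>p\<in>A. 1 / (real p - 2)) * (\<Sum>m=1..n div (2 * \<Prod>A). 1 / real (2 * \<Prod>A * m)))"
    proof (intro mult_left_mono sum_mono)
      fix A assume A: "A \<in> Pow P"
      define q where "q = \<Prod>A"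
      have q: "q > 0" using Ppos A by (auto simp: q_def)
      have "q dvd \<Prod>P" unfolding q_def using A P(1) by (intro prod_dvd_prod_subset) auto
      then have qle: "q \<le> \<Prod>P" using Ppos[of P] by (auto dest: dvd_imp_le)
      have "real q \<le> real (\<Prod>P)" using qle by (simp only: of_nat_le_iff)
      then have "ln (2 * real q) \<le> K" unfolding K_def using q by (intro ln_mono) linarith+
      then have "ln n - K \<le> ln n - ln (2 * real q)" by simp
      also have "\<dots> = ln (real n / real (2 * q))" using n q by (simp add: ln_div)
      also have "\<dots> \<le> ln (real (n div (2 * q)) + 1)"
      proof (rule ln_mono)
        have "real n / real (2 * q) < real (n div (2 * q)) + 1"
          using floor_correct[of "real n / real (2 * q)"]
          unfolding floor_divide_of_nat_eq by simp
        then show "real n / real (2 * q) \<le> real (n div (2 * q)) + 1" by simp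
      qed (use n q in auto)
      also have "\<dots> \<le> harm (n div (2 * q))" by (rule ln_le_harm)
      finally show "(ln n - K) / (2 * real (\<Prod>A)) \<le> (\<Sum>m=1..n div (2 * \<Prod>A). 1 / real (2 * \<Prod>A * m))"
        unfolding sum_inverse_multiples q_def by (intro divide_right_mono) (auto intro!: prod_nonneg)
      show "0 \<le> (\<Prod>p\<in>A. 1 / (real p - 2))" using A hnn by auto
    qed (use twin_const_pos in auto)
    also have "\<dots> = 2 * twin_const * (\<Sum>d\<in>evens_upto n. (\<Sum>A | A \<subseteq> P \<and> (\<forall>p\<in>A. p dvd d). \<Prod>p\<in>A. 1 / (real p - 2)) * (1 / real d))"
      using P by (subst sum_singular_series_restrict) auto
    also have "\<dots> \<le> (\<Sum>d\<in>evens_upto n. singular_series d * (1 / real d))"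
      unfolding sum_distrib_left
    proof (rule sum_mono)
      fix d assume d: "d \<in> evens_upto n"
      then have d0: "d > 0" by (auto simp: evens_upto_def)
      have fin: "finite {p. prime p \<and> p dvd d \<and> p > 2}"
        by (rule finite_subset[of _ "{..d}"]) (use d0 in \<open>auto dest: dvd_imp_le\<close>)
      have "(\<Sum>A | A \<subseteq> P \<and> (\<forall>p\<in>A. p dvd d). \<Prod>p\<in>A. 1 / (real p - 2)) \<le>
         (\<Sum>A\<in>Pow {p. prime p \<and> p dvd d \<and> p > 2}. \<Prod>p\<in>A. 1 / (real p - 2))"
        using fin P(2) by (intro sum_mono2) (auto intro!: prod_nonneg)
      then have "2 * twin_const * (\<Sum>A | A \<subseteq> P \<and> (\<forall>p\<in>A. p dvd d). \<Prod>p\<in>A. 1 / (real p - 2)) \<le> singular_series d"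
        unfolding singular_series_eq[OF d0] using twin_const_pos by (intro mult_left_mono) auto
      then have "2 * twin_const * (\<Sum>A | A \<subseteq> P \<and> (\<forall>p\<in>A. p dvd d). \<Prod>p\<in>A. 1 / (real p - 2)) * (1 / real d)
          \<le> singular_series d * (1 / real d)"
        by (intro mult_right_mono) auto
      then show "2 * twin_const * ((\<Sum>A | A \<subseteq> P \<and> (\<forall>p\<in>A. p dvd d). \<Prod>p\<in>A. 1 / (real p - 2)) * (1 / real d))
          \<le> singular_series d * (1 / real d)"
        by (simp only: mult.assoc)
    qed
    finally have main: "twin_const / F * (ln n - K) \<le> (\<Sum>d\<in>evens_upto n. singular_series d / real d)" by simp
    have "(1 - \<epsilon>) * ln n \<le> twin_const / F * ln n" using ge n by (intro mult_right_mono) auto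
    moreover have "twin_const / F * K \<le> 1 * K" using le1 K0 by (intro mult_right_mono) auto
    ultimately show "(\<Sum>d\<in>evens_upto n. singular_series d / real d) \<ge> (1 - \<epsilon>) * ln n - K"
      using main by (simp add: right_diff_distrib)
  qed
qed

subsection \<open>The upper bound in the prime number theorem from the second moment\<close>

definition prime_count :: "nat \<Rightarrow> nat" where
  "prime_count N = card {p. prime p \<and> p \<le> N}"

definition prime_pairs :: "nat \<Rightarrow> nat \<Rightarrow> nat set" where
  "prime_pairs N d = {p. prime p \<and> prime (p + d) \<and> p + d \<le> N}"

lemma finite_primes_le [simp, intro]: "finite {p::nat. prime p \<and> p \<le> N}"
  by (rule finite_subset[of _ "{..N}"]) auto

lemma finite_prime_pairs [simp, intro]: "finite (prime_pairs N d)"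
  by (rule finite_subset[of _ "{..N}"]) (auto simp: prime_pairs_def)

lemma prime_count_le: "prime_count N \<le> N"
proof -
  have "prime_count N \<le> card {1..N}"
    unfolding prime_count_def by (intro card_mono) (auto dest: prime_ge_1_nat)
  then show ?thesis by simp
qed

text \<open>The supremum bounds each single d because its index set is finite, hence its image
  bounded above. Multiplying out the relative error leaves an inequality free of division by the
  main term.\<close>

lemma HL_prime_pairs:
  assumes HL: "hardy_littlewood_prime_pairs" and "C > 0" "\<epsilon> > 0"
  shows "\<forall>\<^sub>F N in sequentially. \<forall>d. 2 \<le> d \<and> real d \<le> C * ln N \<and> even d \<longrightarrow>
    \<bar>real (card (prime_pairs N d)) - singular_series d * N / (ln N)\<^sup>2\<bar> \<le> \<epsilon> * (singular_series d * N / (ln N)\<^sup>2)"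
proof -
  define F where "F X d = \<bar>real (prime_pair_count X d) / (singular_series d * X / (ln X)\<^sup>2) - 1\<bar>" for X d
  define D where "D X = {d::nat. 2 \<le> d \<and> real d \<le> C * ln X \<and> even d}" for X
  have "((\<lambda>X. SUP d\<in>D X. F X d) \<longlongrightarrow> 0) at_top"
    using HL \<open>C > 0\<close> unfolding hardy_littlewood_prime_pairs_def F_def D_def by blast
  then have "\<forall>\<^sub>F X in at_top. (SUP d\<in>D X. F X d) < \<epsilon>" using \<open>\<epsilon> > 0\<close> by (rule order_tendstoD)
  then have "\<forall>\<^sub>F N in sequentially. (SUP d\<in>D (real N). F (real N) d) < \<epsilon>"
    using filterlim_real_sequentially by (rule eventually_compose_filterlim)
  moreover have "\<forall>\<^sub>F N::nat in sequentially. N \<ge> 3" by (rule eventually_ge_at_top)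
  ultimately show ?thesis
  proof eventually_elim
    case (elim N)
    show ?case
    proof (intro allI impI)
      fix d assume d: "2 \<le> d \<and> real d \<le> C * ln N \<and> even d"
      have "D N \<subseteq> {..nat \<lfloor>C * ln N\<rfloor>}" by (auto simp: D_def le_nat_floor)
      then have "finite (D N)" by (rule finite_subset) simp
      then have "F N d \<le> (SUP d\<in>D (real N). F (real N) d)"
        using d by (intro cSUP_upper bdd_above_finite finite_imageI) (auto simp: D_def)
      then have F: "F N d \<le> \<epsilon>" using elim by simp
      have eq: "prime_pair_count N d = card (prime_pairs N d)"
        unfolding prime_pair_count_def prime_pairs_def of_nat_le_iff by (rule arg_cong[where f = card]) auto
      have pos: "singular_series d * N / (ln N)\<^sup>2 > 0"
        using singular_series_pos[of d] d elim by simp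
      define M where "M = singular_series d * N / (ln N)\<^sup>2"
      have "real (card (prime_pairs N d)) - M = (real (card (prime_pairs N d)) / M - 1) * M"
        using pos by (simp add: M_def[symmetric] left_diff_distrib)
      then have "\<bar>real (card (prime_pairs N d)) - M\<bar> = \<bar>real (card (prime_pairs N d)) / M - 1\<bar> * M"
        using pos by (simp add: M_def[symmetric] abs_mult)
      also have "\<dots> \<le> \<epsilon> * M"
        using F pos by (intro mult_right_mono) (auto simp: F_def eq M_def)
      finally show "\<bar>real (card (prime_pairs N d)) - singular_series d * N / (ln N)\<^sup>2\<bar> \<le> \<epsilon> * (singular_series d * N / (ln N)\<^sup>2)"
        by (simp add: M_def)
    qed
  qed
qed

text \<open>Cauchy--Schwarz for the number of primes in the windows \<open>(m - h, m]\<close>.\<close>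

lemma prime_count_second_moment:
  fixes N h :: nat
  shows "(real h * real (prime_count N))\<^sup>2 \<le>
    real (N + h) * (real h * real (prime_count N) +
      2 * (\<Sum>d\<in>{1..<h}. real (h - d) * real (card (prime_pairs N d))))"
proof -
  define Q where "Q = {p::nat. prime p \<and> p \<le> N}"
  define I :: "nat \<Rightarrow> nat \<Rightarrow> real" where "I p m = (if p \<le> m \<and> m < p + h then 1 else 0)" for p m
  have fin: "finite Q" by (simp add: Q_def)
  have cQ: "card Q = prime_count N" by (simp add: Q_def prime_count_def)
  \<comment> \<open>Primes at distance q - p share h - (q - p) windows; truncated subtraction gives
    the correct value 0 when the distance is h or more.\<close>
  have inter: "(\<Sum>m<N+h. I p m * I q m) = real (h - (q - p))" if "p \<in> Q" "q \<in> Q" "p \<le> q" for p q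
  proof -
    have "(\<Sum>m<N+h. I p m * I q m) = (\<Sum>m<N+h. if m \<in> {q..<p+h} then 1 else 0)"
      using that by (intro sum.cong) (auto simp: I_def)
    also have "\<dots> = real (card ({..<N+h} \<inter> {m. m \<in> {q..<p+h}}))" by (subst sum.If_cases) auto
    also have "{..<N+h} \<inter> {m. m \<in> {q..<p+h}} = {q..<p+h}" using that by (auto simp: Q_def)
    finally show ?thesis using that by simp
  qed
  have single: "(\<Sum>m<N+h. I p m) = real h" if "p \<in> Q" for p
  proof -
    have "(\<Sum>m<N+h. I p m) = (\<Sum>m<N+h. I p m * I p m)" by (intro sum.cong) (auto simp: I_def)
    then show ?thesis using inter[OF that that] by simp
  qed
  have upper: "(\<Sum>p\<in>Q. \<Sum>q | q \<in> Q \<and> p < q. \<Sum>m<N+h. I p m * I q m) =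
     (\<Sum>d\<in>{1..<h}. real (h - d) * real (card (prime_pairs N d)))"
  proof -
    have "(\<Sum>p\<in>Q. \<Sum>q | q \<in> Q \<and> p < q. \<Sum>m<N+h. I p m * I q m) =
       (\<Sum>p\<in>Q. \<Sum>d | d \<in> {1..<h} \<and> p + d \<in> Q. real (h - d))"
    proof (rule sum.cong)
      fix p assume p: "p \<in> Q"
      have "(\<Sum>q | q \<in> Q \<and> p < q. \<Sum>m<N+h. I p m * I q m) = (\<Sum>q | q \<in> Q \<and> p < q. real (h - (q - p)))"
        using p inter by (intro sum.cong) auto
      also have "\<dots> = (\<Sum>q | q \<in> Q \<and> p < q \<and> q < p + h. real (h - (q - p)))"
        using fin by (intro sum.mono_neutral_right) auto
      also have "\<dots> = (\<Sum>d | d \<in> {1..<h} \<and> p + d \<in> Q. real (h - d))"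
        by (rule sum.reindex_bij_witness[of _ "\<lambda>d. p + d" "\<lambda>q. q - p"]) auto
      finally show "(\<Sum>q | q \<in> Q \<and> p < q. \<Sum>m<N+h. I p m * I q m) =
        (\<Sum>d | d \<in> {1..<h} \<and> p + d \<in> Q. real (h - d))" .
    qed simp
    also have "\<dots> = (\<Sum>p\<in>Q. \<Sum>d\<in>{1..<h}. if p + d \<in> Q then real (h - d) else 0)"
      by (intro sum.cong refl sum.inter_filter) simp
    also have "\<dots> = (\<Sum>d\<in>{1..<h}. \<Sum>p\<in>Q. if p + d \<in> Q then real (h - d) else 0)"
      by (rule sum.swap)
    also have "\<dots> = (\<Sum>d\<in>{1..<h}. real (h - d) * real (card (prime_pairs N d)))"
    proof (rule sum.cong)
      fix d
      have "{p \<in> Q. p + d \<in> Q} = prime_pairs N d" by (auto simp: Q_def prime_pairs_def)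
      then show "(\<Sum>p\<in>Q. if p + d \<in> Q then real (h - d) else 0) = real (h - d) * real (card (prime_pairs N d))"
        using fin by (simp add: sum.inter_filter[symmetric])
    qed simp
    finally show ?thesis .
  qed
  have lower: "(\<Sum>p\<in>Q. \<Sum>q | q \<in> Q \<and> q < p. \<Sum>m<N+h. I p m * I q m) =
      (\<Sum>p\<in>Q. \<Sum>q | q \<in> Q \<and> p < q. \<Sum>m<N+h. I p m * I q m)"
    using fin by (subst sum.swap_restrict) (auto simp: mult.commute)
  have first: "(\<Sum>m<N+h. \<Sum>p\<in>Q. I p m) = real h * real (prime_count N)"
    by (subst sum.swap) (simp add: single cQ mult.commute)
  have "(\<Sum>m<N+h. (\<Sum>p\<in>Q. I p m)\<^sup>2) = (\<Sum>m<N+h. \<Sum>p\<in>Q. \<Sum>q\<in>Q. I p m * I q m)"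
    by (simp add: power2_eq_square sum_product)
  also have "\<dots> = (\<Sum>p\<in>Q. \<Sum>m<N+h. \<Sum>q\<in>Q. I p m * I q m)" by (rule sum.swap)
  also have "\<dots> = (\<Sum>p\<in>Q. \<Sum>q\<in>Q. \<Sum>m<N+h. I p m * I q m)" by (intro sum.cong refl sum.swap)
  also have "\<dots> = (\<Sum>p\<in>Q. real h + (\<Sum>q | q \<in> Q \<and> p < q. \<Sum>m<N+h. I p m * I q m)
      + (\<Sum>q | q \<in> Q \<and> q < p. \<Sum>m<N+h. I p m * I q m))"
  proof (rule sum.cong)
    fix p assume p: "p \<in> Q"
    have "Q = insert p ({q\<in>Q. p < q} \<union> {q\<in>Q. q < p})" using p by auto
    then have "(\<Sum>q\<in>Q. \<Sum>m<N+h. I p m * I q m) =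
      (\<Sum>q\<in>insert p ({q\<in>Q. p < q} \<union> {q\<in>Q. q < p}). \<Sum>m<N+h. I p m * I q m)" by simp
    also have "\<dots> = (\<Sum>m<N+h. I p m * I p m) +
       (\<Sum>q\<in>{q\<in>Q. p < q} \<union> {q\<in>Q. q < p}. \<Sum>m<N+h. I p m * I q m)"
      using fin by (subst sum.insert) auto
    also have "(\<Sum>q\<in>{q\<in>Q. p < q} \<union> {q\<in>Q. q < p}. \<Sum>m<N+h. I p m * I q m) =
      (\<Sum>q | q \<in> Q \<and> p < q. \<Sum>m<N+h. I p m * I q m) + (\<Sum>q | q \<in> Q \<and> q < p. \<Sum>m<N+h. I p m * I q m)"
      using fin by (intro sum.union_disjoint) auto
    finally show "(\<Sum>q\<in>Q. \<Sum>m<N+h. I p m * I q m) = real h + (\<Sum>q | q \<in> Q \<and> p < q. \<Sum>m<N+h. I p m * I q m)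
      + (\<Sum>q | q \<in> Q \<and> q < p. \<Sum>m<N+h. I p m * I q m)" using inter[OF p p] by simp
  qed simp
  also have "\<dots> = real h * real (prime_count N) +
      2 * (\<Sum>d\<in>{1..<h}. real (h - d) * real (card (prime_pairs N d)))"
    by (simp add: sum.distrib lower upper cQ mult.commute)
  finally have second: "(\<Sum>m<N+h. (\<Sum>p\<in>Q. I p m)\<^sup>2) = real h * real (prime_count N) +
      2 * (\<Sum>d\<in>{1..<h}. real (h - d) * real (card (prime_pairs N d)))" .
  have "(\<Sum>m<N+h. \<Sum>p\<in>Q. I p m)\<^sup>2 \<le> (\<Sum>m<N+h. (\<Sum>p\<in>Q. I p m)\<^sup>2) * real (card {..<N+h})"
    by (rule sum_squared_le_sum_of_squares)
  then show ?thesis unfolding first second by (simp add: mult.commute)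
qed

text \<open>Odd differences also occur in the second moment, but there the smaller prime must be 2.
  With weights at most h, they contribute at most h^2 altogether.\<close>

lemma card_prime_pairs_odd:
  assumes "odd d"
  shows "card (prime_pairs N d) \<le> 1"
proof -
  have "prime_pairs N d \<subseteq> {2}"
  proof
    fix p assume p: "p \<in> prime_pairs N d"
    show "p \<in> {2}"
    proof (rule ccontr)
      assume "p \<notin> {2}"
      then have "odd p" using p prime_odd_nat[of p] prime_ge_2_nat[of p] by (auto simp: prime_pairs_def)
      then have "even (p + d)" using assms by simp
      moreover have "prime (p + d)" "p + d > 2"
        using p prime_ge_2_nat[of p] odd_pos[OF assms] by (auto simp: prime_pairs_def)
      ultimately show False using prime_odd_nat by blast
    qed
  qed
  then show ?thesis using card_mono[of "{2}" "prime_pairs N d"] by simp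
qed

text \<open>Raising h by one raises every weight h - d by one, so the increment is the unweighted
  sum, which is at most h by the mean value 1.\<close>

lemma sum_weighted_singular_series_le:
  "(\<Sum>d\<in>evens_upto h. real (h - d) * singular_series d) \<le> (real h)\<^sup>2 / 2"
proof (induction h)
  case (Suc h)
  have "(\<Sum>d\<in>evens_upto (Suc h). real (Suc h - d) * singular_series d) =
      (\<Sum>d\<in>evens_upto h. real (Suc h - d) * singular_series d)"
    by (rule sum.mono_neutral_right) (auto simp: evens_upto_def le_Suc_eq)
  also have "\<dots> = (\<Sum>d\<in>evens_upto h. real (h - d) * singular_series d) + (\<Sum>d\<in>evens_upto h. singular_series d)"
    unfolding sum.distrib[symmetric]
  proof (rule sum.cong)
    fix d assume "d \<in> evens_upto h"
    then have "real (Suc h - d) = real (h - d) + 1" by (auto simp: evens_upto_def Suc_diff_le)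
    then show "real (Suc h - d) * singular_series d = real (h - d) * singular_series d + singular_series d"
      by (simp only: distrib_right mult_1)
  qed simp
  also have "\<dots> \<le> (real h)\<^sup>2 / 2 + real h"
    using Suc.IH sum_singular_series_upto_le[of h] by simp
  also have "\<dots> \<le> (real (Suc h))\<^sup>2 / 2" by (simp add: power2_eq_square algebra_simps)
  finally show ?case .
qed (simp add: evens_upto_def)

text \<open>Here a stands for pi(N) ln N / N. On the right, a * \<delta> comes from the diagonal of
  the second moment, 1 + \<delta> from the prime pairs, a further \<delta> from the odd differences,
  and the outer 1 + \<delta> from the number of windows. If a > 1, replacing 1 by a in the bracket
  lets a cancel.\<close>

lemma prime_count_upper_aux:
  fixes \<delta> a :: real
  assumes "0 < \<delta>" "\<delta> \<le> 1" "a\<^sup>2 \<le> (1 + \<delta>) * (a * \<delta> + 1 + 2 * \<delta>)"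
  shows "a \<le> 1 + 7 * \<delta>"
proof (rule ccontr)
  assume *: "\<not> a \<le> 1 + 7 * \<delta>"
  then have a: "a > 1" using assms by simp
  have "a * (1 + 7 * \<delta>) < a * a" using * a by (intro mult_strict_left_mono) auto
  also have "\<dots> \<le> (1 + \<delta>) * (a * \<delta> + 1 + 2 * \<delta>)" using assms by (simp add: power2_eq_square)
  also have "\<dots> \<le> (1 + \<delta>) * (a * \<delta> + a * (1 + 2 * \<delta>))"
    using a assms by (intro mult_left_mono) auto
  also have "\<dots> = a * (1 + 4 * \<delta> + 3 * (\<delta> * \<delta>))" by (simp add: algebra_simps)
  also have "\<dots> \<le> a * (1 + 7 * \<delta>)"
    using a assms mult_left_mono[of \<delta> 1 \<delta>] by (intro mult_left_mono) auto
  finally show False by simp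
qed

text \<open>The pairs contribute exactly what density 1 / ln N predicts, since the singular series
  has mean value 1; hence the constant 1. The argument is one-sided because Cauchy-Schwarz discards
  the variance of the window counts.\<close>

lemma prime_count_upper:
  fixes \<epsilon> :: real
  assumes HL: "hardy_littlewood_prime_pairs" and \<epsilon>: "\<epsilon> > 0"
  shows "\<forall>\<^sub>F N in sequentially. real (prime_count N) \<le> (1 + \<epsilon>) * N / ln N"
proof -
  define \<delta> where "\<delta> = min 1 (\<epsilon> / 7)"
  have \<delta>: "0 < \<delta>" "\<delta> \<le> 1" "7 * \<delta> \<le> \<epsilon>" using \<epsilon> by (auto simp: \<delta>_def)
  \<comment> \<open>At density 1 / ln N such a window holds about 1 / \<delta> primes, so the
    diagonal is only a proportion \<delta> of the second moment.\<close>
  define h where "h N = nat \<lceil>ln (real N) / \<delta>\<rceil>" for N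
  have "\<forall>\<^sub>F N::nat in sequentially. (ln (real N) / \<delta> + 1) / N \<le> \<delta>"
    using \<delta> by real_asymp
  moreover have "\<forall>\<^sub>F N::nat in sequentially. 2 * (ln (real N))\<^sup>2 / N \<le> \<delta>"
    using \<delta> by real_asymp
  moreover have "\<forall>\<^sub>F N::nat in sequentially. N \<ge> 3" by (rule eventually_ge_at_top)
  moreover have "1 / \<delta> > 0" using \<delta> by simp
  note HL_prime_pairs[OF HL this \<delta>(1)]
  ultimately show ?thesis
  proof eventually_elim
    case (elim N)
    define L where "L = ln (real N)"
    define H where "H = real (h N)"
    define \<pi> where "\<pi> = real (prime_count N)"
    have L: "L > 0" using elim by (simp add: L_def)
    have N: "real N > 0" using elim by simp
    have H1: "H \<ge> L / \<delta>" "H \<le> L / \<delta> + 1" "H > 0"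
      using L \<delta> by (auto simp: H_def h_def L_def of_nat_ceiling)
    have S: "(\<Sum>d\<in>{1..<h N}. real (h N - d) * real (card (prime_pairs N d))) \<le>
        (1 + \<delta>) * (N / L\<^sup>2) * (H\<^sup>2 / 2) + H\<^sup>2"
    proof -
      have "(\<Sum>d\<in>{1..<h N}. real (h N - d) * real (card (prime_pairs N d))) \<le>
        (\<Sum>d\<in>{1..<h N}. (if even d then real (h N - d) * ((1 + \<delta>) * (N / L\<^sup>2) * singular_series d) else 0) + H)"
      proof (rule sum_mono)
        fix d assume d: "d \<in> {1..<h N}"
        show "real (h N - d) * real (card (prime_pairs N d)) \<le>
          (if even d then real (h N - d) * ((1 + \<delta>) * (N / L\<^sup>2) * singular_series d) else 0) + H"
        proof (cases "even d")
          case True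
          then have "2 \<le> d" using d by (auto elim: evenE)
          moreover have "real d \<le> 1 / \<delta> * ln N"
          proof -
            have "int d < \<lceil>ln (real N) / \<delta>\<rceil>" using d by (simp add: h_def zless_nat_eq_int_zless)
            then show ?thesis by (simp add: less_ceiling_iff)
          qed
          ultimately have "\<bar>real (card (prime_pairs N d)) - singular_series d * N / (ln N)\<^sup>2\<bar> \<le> \<delta> * (singular_series d * N / (ln N)\<^sup>2)"
            using elim True by blast
          then have "real (card (prime_pairs N d)) \<le> (1 + \<delta>) * (N / L\<^sup>2) * singular_series d"
            by (simp add: L_def abs_le_iff algebra_simps add_divide_distrib)
          then have "real (h N - d) * real (card (prime_pairs N d)) \<le>
              real (h N - d) * ((1 + \<delta>) * (N / L\<^sup>2) * singular_series d)" by (rule mult_left_mono) simp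
          then show ?thesis using True H1 by simp
        next
          case False
          then have "real (h N - d) * real (card (prime_pairs N d)) \<le> real (h N) * 1"
            using card_prime_pairs_odd[of d N] by (intro mult_mono) auto
          then show ?thesis using False by (simp add: H_def)
        qed
      qed
      also have "\<dots> = (\<Sum>d\<in>{1..<h N}. if even d then real (h N - d) * ((1 + \<delta>) * (N / L\<^sup>2) * singular_series d) else 0)
          + real (h N - 1) * H" by (simp add: sum.distrib)
      also have "(\<Sum>d\<in>{1..<h N}. if even d then real (h N - d) * ((1 + \<delta>) * (N / L\<^sup>2) * singular_series d) else 0) =
         (\<Sum>d | d \<in> {1..<h N} \<and> even d. real (h N - d) * ((1 + \<delta>) * (N / L\<^sup>2) * singular_series d))"
        by (rule sum.inter_filter[symmetric]) simp
      also have "\<dots> = (\<Sum>d\<in>evens_upto (h N). real (h N - d) * ((1 + \<delta>) * (N / L\<^sup>2) * singular_series d))"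
        by (rule sum.mono_neutral_left) (auto simp: evens_upto_def elim!: evenE)
      also have "\<dots> = (1 + \<delta>) * (N / L\<^sup>2) * (\<Sum>d\<in>evens_upto (h N). real (h N - d) * singular_series d)"
        by (simp add: sum_distrib_left mult_ac)
      also have "\<dots> \<le> (1 + \<delta>) * (N / L\<^sup>2) * (H\<^sup>2 / 2)"
        unfolding H_def using \<delta> by (intro mult_left_mono sum_weighted_singular_series_le) auto
      also have "real (h N - 1) * H \<le> H * H" unfolding H_def by (intro mult_right_mono) auto
      finally show ?thesis by (simp add: power2_eq_square)
    qed
    have factor: "(N + H) * (H * \<pi> + 2 * ((1 + \<delta>) * M * (H\<^sup>2 / 2) + H\<^sup>2)) =
      H\<^sup>2 * ((N + H) * (\<pi> / H + (1 + \<delta>) * M + 2))" for M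
      using H1 by (simp add: power2_eq_square field_simps)
    have "(H * \<pi>)\<^sup>2 \<le> (N + H) * (H * \<pi> + 2 * (\<Sum>d\<in>{1..<h N}. real (h N - d) * real (card (prime_pairs N d))))"
      using prime_count_second_moment[of "h N" N] by (simp add: H_def \<pi>_def)
    also have "\<dots> \<le> (N + H) * (H * \<pi> + 2 * ((1 + \<delta>) * (N / L\<^sup>2) * (H\<^sup>2 / 2) + H\<^sup>2))"
      using S N H1 by (intro mult_left_mono add_left_mono) auto
    also have "\<dots> = H\<^sup>2 * ((N + H) * (\<pi> / H + (1 + \<delta>) * (N / L\<^sup>2) + 2))"
      by (rule factor)
    finally have "H\<^sup>2 * \<pi>\<^sup>2 \<le> H\<^sup>2 * ((N + H) * (\<pi> / H + (1 + \<delta>) * (N / L\<^sup>2) + 2))"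
      by (simp add: power_mult_distrib)
    then have A: "\<pi>\<^sup>2 \<le> (N + H) * (\<pi> / H + (1 + \<delta>) * (N / L\<^sup>2) + 2)"
      using H1 by simp
    also have "\<dots> \<le> (N * (1 + \<delta>)) * (\<pi> * \<delta> / L + (1 + \<delta>) * (N / L\<^sup>2) + \<delta> * N / L\<^sup>2)"
    proof (intro mult_mono add_mono order_refl)
      have "H / N \<le> (L / \<delta> + 1) / N" using H1 by (intro divide_right_mono) auto
      then have "H / N \<le> \<delta>" using elim by (simp add: L_def)
      then show "N + H \<le> N * (1 + \<delta>)" using N by (simp add: field_simps)
      have "\<pi> / H \<le> \<pi> / (L / \<delta>)" using H1 L \<delta> by (intro divide_left_mono) (auto simp: \<pi>_def)
      then show "\<pi> / H \<le> \<pi> * \<delta> / L" by simp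
      show "2 \<le> \<delta> * N / L\<^sup>2" using elim N L by (simp add: L_def field_simps)
    qed (use H1 \<delta> L in \<open>auto simp: \<pi>_def\<close>)
    finally have B: "\<pi>\<^sup>2 \<le> (N * (1 + \<delta>)) * (\<pi> * \<delta> / L + (1 + \<delta>) * (N / L\<^sup>2) + \<delta> * N / L\<^sup>2)" .
    define a where "a = \<pi> * L / N"
    have \<pi>a: "\<pi> = a * (N / L)" using L N by (simp add: a_def)
    have "(N / L)\<^sup>2 * a\<^sup>2 \<le> (N / L)\<^sup>2 * ((1 + \<delta>) * (a * \<delta> + 1 + 2 * \<delta>))"
      using B N L unfolding \<pi>a by (simp add: power2_eq_square field_simps)
    then have "a\<^sup>2 \<le> (1 + \<delta>) * (a * \<delta> + 1 + 2 * \<delta>)" using N L by simp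
    then have "a \<le> 1 + 7 * \<delta>" using \<delta> by (intro prime_count_upper_aux) auto
    then have "a \<le> 1 + \<epsilon>" using \<delta> by simp
    then show ?case using N L by (simp add: a_def \<pi>_def L_def field_simps)
  qed
qed

subsection \<open>Mertens' first theorem and the Chebyshev lower bound\<close>

lemma ln_nat_eq_sum_multiplicity:
  fixes m N :: nat
  assumes "1 \<le> m" "m \<le> N"
  shows "ln (real m) = (\<Sum>p::nat | prime p \<and> p \<le> N. real (multiplicity p m) * ln p)"
proof -
  have "real m = real (\<Prod>p\<in>prime_factors m. p ^ multiplicity p m)"
    using assms by (subst prod_prime_factors) auto
  also have "\<dots> = (\<Prod>p\<in>prime_factors m. real p ^ multiplicity p m)" by simp
  also have "ln \<dots> = (\<Sum>p\<in>prime_factors m. ln (real p ^ multiplicity p m))"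
    by (intro ln_prod) (auto intro!: zero_less_power prime_gt_0_nat)
  also have "\<dots> = (\<Sum>p\<in>prime_factors m. real (multiplicity p m) * ln p)"
    by (intro sum.cong) (auto simp: ln_realpow prime_gt_0_nat in_prime_factors_iff)
  also have "\<dots> = (\<Sum>p::nat | prime p \<and> p \<le> N. real (multiplicity p m) * ln p)"
  proof (rule sum.mono_neutral_left)
    show "prime_factors m \<subseteq> {p. prime p \<and> p \<le> N}"
      using assms by (auto simp: in_prime_factors_iff intro: order.trans[OF dvd_imp_le])
    show "\<forall>i\<in>{p. prime p \<and> p \<le> N} - prime_factors m. real (multiplicity i m) * ln i = 0"
      using assms by (auto simp: in_prime_factors_iff not_dvd_imp_multiplicity_0)
  qed simp
  finally show ?thesis .
qed

lemma multiplicity_eq_card_powers: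
  fixes p m N :: nat
  assumes "prime p" "1 \<le> m" "m \<le> N"
  shows "multiplicity p m = card {k\<in>{1..N}. p ^ k dvd m}"
proof -
  have iff: "p ^ k dvd m \<longleftrightarrow> k \<le> multiplicity p m" for k
    using assms by (intro power_dvd_iff_le_multiplicity) auto
  have "2 ^ multiplicity p m \<le> p ^ multiplicity p m"
    using prime_ge_2_nat[OF assms(1)] by (rule power_mono) simp
  also have "\<dots> \<le> m" using assms by (intro dvd_imp_le multiplicity_dvd) auto
  finally have "multiplicity p m \<le> N" using assms less_exp[of "multiplicity p m"] by linarith
  then have "{k\<in>{1..N}. p ^ k dvd m} = {1..multiplicity p m}" by (auto simp: iff)
  then show ?thesis by simp
qed

lemma card_multiples:
  fixes q N :: nat
  assumes "q > 0"
  shows "card {m\<in>{1..N}. q dvd m} = N div q"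
proof -
  have "{m\<in>{1..N}. q dvd m} = (\<lambda>j. q * j) ` {1..N div q}"
    using assms by (force elim!: dvdE simp: less_eq_div_iff_mult_less_eq mult.commute)
  moreover have "inj_on (\<lambda>j. q * j) {1..N div q}" using assms by (auto simp: inj_on_def)
  ultimately show ?thesis by (simp add: card_image)
qed

text \<open>Legendre's formula for the exponent of p in N!. The upper bound drops the floors and
  sums a geometric series; the lower bound keeps only the term k = 1.\<close>

lemma sum_multiplicity_bounds:
  fixes p N :: nat
  assumes p: "prime p"
  shows "(\<Sum>m=1..N. real (multiplicity p m)) \<le> N / (real p - 1)"
    and "(\<Sum>m=1..N. real (multiplicity p m)) \<ge> N / real p - 1"
proof -
  have p1: "real p > 1" using prime_gt_1_nat[OF p] by simp
  have "(\<Sum>m=1..N. real (multiplicity p m)) = (\<Sum>m=1..N. \<Sum>k=1..N. if p ^ k dvd m then 1 else 0)"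
    using p by (intro sum.cong refl) (simp add: multiplicity_eq_card_powers[of p _ N] sum.inter_filter[symmetric])
  also have "\<dots> = (\<Sum>k=1..N. \<Sum>m=1..N. if p ^ k dvd m then 1 else 0)" by (rule sum.swap)
  also have "\<dots> = (\<Sum>k=1..N. real (N div p ^ k))"
    using prime_gt_0_nat[OF p] by (intro sum.cong refl) (simp add: sum.inter_filter[symmetric] card_multiples[symmetric])
  finally have eq: "(\<Sum>m=1..N. real (multiplicity p m)) = (\<Sum>k=1..N. real (N div p ^ k))" .
  have "(\<Sum>k=1..N. real (N div p ^ k)) \<le> (\<Sum>k=1..N. N * (1 / real p) ^ k)"
  proof (rule sum_mono)
    fix k
    have "real (N div p ^ k) \<le> real N / real (p ^ k)" by (rule of_nat_div_le_of_nat)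
    then show "real (N div p ^ k) \<le> N * (1 / real p) ^ k" by (simp add: power_divide)
  qed
  also have "\<dots> = N * (\<Sum>k=1..N. (1 / real p) ^ k)" by (simp add: sum_distrib_left)
  also have "\<dots> \<le> N * (1 / (real p - 1))"
  proof (intro mult_left_mono)
    have "(\<Sum>k=1..n. (1 / real p) ^ k) * (real p - 1) = 1 - (1 / real p) ^ n" for n
    proof (induction n)
      case (Suc n)
      define S y where "S = (\<Sum>k=1..n. (1 / real p) ^ k)" and "y = (1 / real p) ^ Suc n"
      have "(S + y) * (real p - 1) = S * (real p - 1) + y * real p - y" by (simp add: algebra_simps)
      moreover have "y * real p = (1 / real p) ^ n" using p1 by (simp add: y_def)
      moreover have "(\<Sum>k=1..Suc n. (1 / real p) ^ k) = S + y" by (simp add: S_def y_def)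
      ultimately show ?case using Suc unfolding S_def[symmetric] y_def[symmetric] by simp
    qed simp
    then have "(\<Sum>k=1..N. (1 / real p) ^ k) = (1 - (1 / real p) ^ N) / (real p - 1)"
      using p1 by (simp add: eq_divide_eq)
    then show "(\<Sum>k=1..N. (1 / real p) ^ k) \<le> 1 / (real p - 1)"
      using p1 by (simp add: divide_right_mono)
  qed simp
  finally show "(\<Sum>m=1..N. real (multiplicity p m)) \<le> N / (real p - 1)" using eq by simp
  show "(\<Sum>m=1..N. real (multiplicity p m)) \<ge> N / real p - 1"
  proof (cases "N = 0")
    case False
    have "N / real p - 1 \<le> real (N div p)"
      using floor_correct[of "real N / real p"] unfolding floor_divide_of_nat_eq by simp
    also have "\<dots> = (\<Sum>k\<in>{1}. real (N div p ^ k))" by simp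
    also have "\<dots> \<le> (\<Sum>k=1..N. real (N div p ^ k))" using False by (intro sum_mono2) auto
    finally show ?thesis using eq by simp
  qed simp
qed

lemma ln_fact_eq:
  "ln (fact N :: real) = (\<Sum>p::nat | prime p \<and> p \<le> N. (\<Sum>m=1..N. real (multiplicity p m)) * ln p)"
proof -
  have "ln (fact N :: real) = (\<Sum>m=1..N. ln (real m))"
    unfolding fact_prod by (subst ln_prod[symmetric]) auto
  also have "\<dots> = (\<Sum>m=1..N. \<Sum>p::nat | prime p \<and> p \<le> N. real (multiplicity p m) * ln p)"
    by (intro sum.cong ln_nat_eq_sum_multiplicity) auto
  also have "\<dots> = (\<Sum>p::nat | prime p \<and> p \<le> N. \<Sum>m=1..N. real (multiplicity p m) * ln p)"
    by (rule sum.swap)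
  finally show ?thesis by (simp add: sum_distrib_right)
qed

lemma ln_fact_ge: "ln (fact N :: real) \<ge> N * ln N - N"
proof (induction N)
  case (Suc N)
  show ?case
  proof (cases "N = 0")
    case False
    have "ln (real (Suc N)) - ln N \<le> 1 / N"
      using ln_diff_le[of "real (Suc N)" "real N"] False by simp
    then have "N * (ln (real (Suc N)) - ln N) \<le> N * (1 / N)" by (intro mult_left_mono) auto
    then have "N * (ln (real (Suc N)) - ln N) \<le> 1" using False by simp
    moreover have "ln (fact (Suc N) :: real) = ln (real (Suc N)) + ln (fact N)"
      by (simp add: ln_mult)
    ultimately show ?thesis using Suc by (simp add: algebra_simps)
  qed simp
qed simp

definition mertens_sum :: "nat \<Rightarrow> real" where
  "mertens_sum N = (\<Sum>p::nat | prime p \<and> p \<le> N. ln p / p)"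

text \<open>This half is unconditional: compare N ln N - N <= ln N! with the upper bounds N / (p -
  1) for the exponents. Passing from 1 / (p - 1) to 1 / p changes the sum by a convergent
  series.\<close>

lemma mertens_lower:
  obtains C where "\<And>N. N \<ge> 1 \<Longrightarrow> mertens_sum N \<ge> ln N - C"
proof -
  define u where "u n = ln (real n) / (real n * (real n - 1))" for n :: nat
  \<comment> \<open>The exponent -3/2 instead of -2 leaves room for the logarithm and is still
    summable.\<close>
  have "u \<in> O(\<lambda>n. real n powr (-3/2))" unfolding u_def by real_asymp
  then have su: "summable u"
    by (rule summable_comparison_test_bigo[rotated]) (simp add: summable_real_powr_iff)
  have unn: "u n \<ge> 0" for n
    by (cases "n \<le> 1") (auto simp: u_def le_Suc_eq)
  show ?thesis
  proof (rule that[of "1 + suminf u"])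
    fix N :: nat assume N: "N \<ge> 1"
    have "N * ln N - N \<le> ln (fact N :: real)" by (rule ln_fact_ge)
    also have "\<dots> \<le> (\<Sum>p::nat | prime p \<and> p \<le> N. N / (real p - 1) * ln p)"
      unfolding ln_fact_eq
      by (intro sum_mono mult_right_mono sum_multiplicity_bounds) (auto dest: prime_ge_1_nat)
    also have "\<dots> = N * (\<Sum>p::nat | prime p \<and> p \<le> N. ln p / (real p - 1))"
      by (simp add: sum_distrib_left)
    finally have "N * (ln N - 1) \<le> N * (\<Sum>p::nat | prime p \<and> p \<le> N. ln p / (real p - 1))"
      by (simp add: algebra_simps)
    then have A: "ln N - 1 \<le> (\<Sum>p::nat | prime p \<and> p \<le> N. ln p / (real p - 1))" using N by simp
    also have "\<dots> = (\<Sum>p::nat | prime p \<and> p \<le> N. ln p / p + u p)"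
    proof (rule sum.cong)
      fix p assume "p \<in> {p. prime p \<and> p \<le> N}"
      then have "real p > 1" using prime_gt_1_nat by auto
      then show "ln p / (real p - 1) = ln p / p + u p" by (simp add: u_def field_simps)
    qed simp
    also have "\<dots> = mertens_sum N + (\<Sum>p::nat | prime p \<and> p \<le> N. u p)"
      by (simp add: sum.distrib mertens_sum_def)
    also have "(\<Sum>p::nat | prime p \<and> p \<le> N. u p) \<le> suminf u"
      using su unn by (intro sum_le_suminf) auto
    finally show "mertens_sum N \<ge> ln N - (1 + suminf u)" by simp
  qed
qed

text \<open>In this direction each floor of N / p loses up to ln p, in total at most pi(N) ln N. The
  bound pi(N) <= 2 N / ln N, supplied by the second moment, makes the loss O(N).\<close>

lemma mertens_upper:
  assumes HL: "hardy_littlewood_prime_pairs"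
  obtains C where "\<forall>\<^sub>F N in sequentially. mertens_sum N \<le> ln N + C"
proof (rule that[of 2])
  have "\<forall>\<^sub>F N in sequentially. real (prime_count N) \<le> (1 + 1 :: real) * N / ln N"
    by (rule prime_count_upper[OF HL]) simp
  moreover have "\<forall>\<^sub>F N::nat in sequentially. N \<ge> 3" by (rule eventually_ge_at_top)
  ultimately show "\<forall>\<^sub>F N in sequentially. mertens_sum N \<le> ln N + 2"
  proof eventually_elim
    case (elim N)
    have lnN: "ln N > 0" using elim by simp
    have "(\<Sum>p::nat | prime p \<and> p \<le> N. (N / real p - 1) * ln p) \<le> ln (fact N :: real)"
      unfolding ln_fact_eq
      by (intro sum_mono mult_right_mono sum_multiplicity_bounds) (auto dest: prime_ge_1_nat)
    also have "\<dots> \<le> ln (real N ^ N)"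
      using fact_le_power[of N, where ?'a = real] elim by (intro ln_mono) auto
    also have "\<dots> = N * ln N" using elim by (simp add: ln_realpow)
    finally have A: "(\<Sum>p::nat | prime p \<and> p \<le> N. (N / real p - 1) * ln p) \<le> N * ln N" .
    have "(\<Sum>p::nat | prime p \<and> p \<le> N. (N / real p - 1) * ln p) =
        N * mertens_sum N - (\<Sum>p::nat | prime p \<and> p \<le> N. ln p)"
      by (simp add: mertens_sum_def left_diff_distrib sum_subtractf sum_distrib_left)
    moreover have "(\<Sum>p::nat | prime p \<and> p \<le> N. ln p) \<le> (\<Sum>p::nat | prime p \<and> p \<le> N. ln N)"
      by (intro sum_mono ln_mono) (auto dest: prime_gt_0_nat)
    moreover have "(\<Sum>p::nat | prime p \<and> p \<le> N. ln N) = prime_count N * ln N"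
      by (simp add: prime_count_def)
    moreover have "prime_count N * ln N \<le> 2 * N"
      using elim(1) lnN by (simp add: field_simps)
    ultimately have "N * mertens_sum N \<le> N * ln N + 2 * N" using A by linarith
    then have "N * mertens_sum N \<le> N * (ln N + 2)" by (simp add: algebra_simps)
    then show ?case using elim by simp
  qed
qed

text \<open>By Mertens, the sum of ln p / p over (N / k, N] is ln k up to a bounded error, hence at
  least 1 for a large fixed k. Each term there is at most k ln N / N, so at least N / (k ln N)
  primes are needed.\<close>

lemma prime_count_lower:
  assumes HL: "hardy_littlewood_prime_pairs"
  obtains c :: real where "c > 0" "\<forall>\<^sub>F N in sequentially. c * N / ln N \<le> prime_count N"
proof -
  obtain C1 where C1: "\<And>N. N \<ge> 1 \<Longrightarrow> mertens_sum N \<ge> ln N - C1" using mertens_lower by blast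
  obtain C2 where C2: "\<forall>\<^sub>F N in sequentially. mertens_sum N \<le> ln N + C2" by (rule mertens_upper[OF HL])
  then obtain N0 where N0: "\<And>N. N \<ge> N0 \<Longrightarrow> mertens_sum N \<le> ln N + C2"
    by (auto simp: eventually_sequentially)
  define k where "k = nat \<lceil>exp (C1 + C2 + 1)\<rceil>"
  have k: "real k \<ge> exp (C1 + C2 + 1)" unfolding k_def by (rule of_nat_ceiling)
  then have "real k > 0" by (rule less_le_trans[rotated]) simp
  then have k0: "k > 0" by simp
  have lnk: "ln k \<ge> C1 + C2 + 1" using ln_mono[OF k] by simp
  have "1 / real k * N / ln N \<le> prime_count N" if N: "N \<ge> k * (N0 + 1) + 3" for N
  proof -
    define M where "M = N div k"
    have "N0 + 1 \<le> M" unfolding M_def using N k0 by (simp add: less_eq_div_iff_mult_less_eq mult.commute)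
    then have M: "M \<ge> N0" "M \<ge> 1" by auto
    have MN: "M \<le> N" unfolding M_def by simp
    have kM: "real k * M \<le> N" unfolding M_def
      by (metis of_nat_le_iff of_nat_mult times_div_less_eq_dividend)
    have kM1: "N \<le> real k * (M + 1)"
      using floor_correct[of "real N / real k"] k0 unfolding floor_divide_of_nat_eq M_def
      by (simp add: field_simps)
    have lnN: "ln N > 0" using N by simp
    have "ln (real k * M) \<le> ln N" using kM M k0 by (intro ln_mono) auto
    then have "ln k + ln M \<le> ln N" using k0 M by (simp add: ln_mult)
    then have "1 \<le> mertens_sum N - mertens_sum M"
      using C1[of N] N0[OF M(1)] N lnk by linarith
    also have "\<dots> = (\<Sum>p::nat | prime p \<and> M < p \<and> p \<le> N. ln p / p)"
    proof -
      have "{p. prime p \<and> p \<le> N} = {p. prime p \<and> p \<le> M} \<union> {p. prime p \<and> M < p \<and> p \<le> N}"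
        using MN by auto
      moreover have "finite {p. prime p \<and> M < p \<and> p \<le> N}"
        by (rule finite_subset[OF _ finite_primes_le[of N]]) auto
      ultimately have "mertens_sum N = mertens_sum M + (\<Sum>p::nat | prime p \<and> M < p \<and> p \<le> N. ln p / p)"
        unfolding mertens_sum_def by (simp only:) (rule sum.union_disjoint, auto)
      then show ?thesis by simp
    qed
    also have "\<dots> \<le> (\<Sum>p::nat | prime p \<and> M < p \<and> p \<le> N. real k * ln N / N)"
    proof (rule sum_mono)
      fix p assume p: "p \<in> {p. prime p \<and> M < p \<and> p \<le> N}"
      then have p': "p > 0" "real p \<ge> M + 1" "p \<le> N" by (auto simp: prime_gt_0_nat)
      have "real k * (M + 1) \<le> real k * p" using p' by (intro mult_left_mono) auto
      then have "real N \<le> real k * p" using kM1 by simp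
      then have "1 / p \<le> real k / N" using p' N by (simp add: field_simps)
      moreover have "ln p \<le> ln N" using p' by (intro ln_mono) auto
      ultimately have "ln p * (1 / p) \<le> ln N * (real k / N)"
        using lnN p' by (intro mult_mono) auto
      then show "ln p / p \<le> real k * ln N / N" by (simp add: mult.commute)
    qed
    also have "\<dots> = card {p. prime p \<and> M < p \<and> p \<le> N} * (real k * ln N / N)" by simp
    also have "\<dots> \<le> prime_count N * (real k * ln N / N)"
    proof (intro mult_right_mono)
      have "card {p. prime p \<and> M < p \<and> p \<le> N} \<le> prime_count N"
        unfolding prime_count_def by (intro card_mono) auto
      then show "real (card {p. prime p \<and> M < p \<and> p \<le> N}) \<le> prime_count N" by simp
    qed (use lnN in auto)
    finally show ?thesis using lnN N k0 by (simp add: field_simps)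
  qed
  then have "\<forall>\<^sub>F N in sequentially. 1 / real k * N / ln N \<le> prime_count N"
    unfolding eventually_sequentially by blast
  then show ?thesis using k0 by (intro that[of "1 / real k"]) auto
qed

subsection \<open>Partial summation and Mertens' second theorem\<close>

text \<open>Summation by parts: each decrease of the weight multiplies a partial sum of e - f, which
  is at least - C, and the decreases together with the final weight add up to \<phi> a. The error is
  thus independent of N.\<close>

lemma abel_comparison:
  fixes \<phi> e f :: "nat \<Rightarrow> real"
  assumes dec: "\<And>n. n \<ge> a \<Longrightarrow> \<phi> (Suc n) \<le> \<phi> n" and nn: "\<And>n. n \<ge> a \<Longrightarrow> \<phi> n \<ge> 0"
    and le: "\<And>N. N \<ge> a \<Longrightarrow> (\<Sum>n=a..N. f n) \<le> (\<Sum>n=a..N. e n) + C"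
    and N: "N \<ge> a"
  shows "(\<Sum>n=a..N. \<phi> n * f n) \<le> (\<Sum>n=a..N. \<phi> n * e n) + C * \<phi> a"
proof -
  define g where "g n = e n - f n" for n
  define G where "G N = (\<Sum>n=a..N. g n)" for N
  have G: "G N \<ge> - C" if "N \<ge> a" for N
    using le[OF that] by (simp add: G_def g_def sum_subtractf)
  \<comment> \<open>Subtracting the boundary term is what makes the induction close; it is estimated
    separately afterwards.\<close>
  have "(\<Sum>n=a..N. \<phi> n * g n) - \<phi> N * G N \<ge> - C * (\<phi> a - \<phi> N)"
    using N
  proof (induction N rule: dec_induct)
    case base
    then show ?case by (simp add: G_def)
  next
    case (step N)
    have "(\<phi> N - \<phi> (Suc N)) * G N \<ge> (\<phi> N - \<phi> (Suc N)) * (- C)"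
      using dec[OF step(1)] G[OF step(1)] by (intro mult_left_mono) auto
    then show ?case using step by (simp add: G_def algebra_simps)
  qed
  moreover have "\<phi> N * G N \<ge> \<phi> N * (- C)" using nn[OF N] G[OF N] by (intro mult_left_mono) auto
  ultimately have "(\<Sum>n=a..N. \<phi> n * g n) \<ge> - C * \<phi> a" by (simp add: algebra_simps)
  then show ?thesis by (simp add: g_def sum_subtractf right_diff_distrib)
qed

lemma eventually_le_imp_bounded:
  fixes f :: "nat \<Rightarrow> real"
  assumes "\<forall>\<^sub>F n in sequentially. f n \<le> C"
  obtains C' where "C' \<ge> 0" "\<And>n. f n \<le> C'"
proof -
  obtain n0 where n0: "\<And>n. n \<ge> n0 \<Longrightarrow> f n \<le> C" using assms by (auto simp: eventually_sequentially)
  define C' where "C' = Max (insert 0 (insert C (f ` {..<n0})))"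
  have "0 \<le> C'" "C \<le> C'" unfolding C'_def by (rule Max_ge; simp)+
  moreover have "f n \<le> C'" for n
  proof (cases "n < n0")
    case True
    then show ?thesis unfolding C'_def by (intro Max_ge) auto
  next
    case False
    then show ?thesis using n0[of n] \<open>C \<le> C'\<close> by simp
  qed
  ultimately show ?thesis using that by blast
qed

lemma sum_abs_bounded:
  fixes g :: "nat \<Rightarrow> real"
  assumes "g \<in> O(\<lambda>n. real n powr (-3/2))"
  obtains B where "B \<ge> 0" "\<And>I. finite I \<Longrightarrow> \<bar>\<Sum>n\<in>I. g n\<bar> \<le> B"
proof -
  have "(\<lambda>n. \<bar>g n\<bar>) \<in> O(\<lambda>n. real n powr (-3/2))" using assms by simp
  then have su: "summable (\<lambda>n. \<bar>g n\<bar>)"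
    by (rule summable_comparison_test_bigo[rotated]) (simp add: summable_real_powr_iff)
  show ?thesis
  proof (rule that)
    show "suminf (\<lambda>n. \<bar>g n\<bar>) \<ge> 0" by (intro suminf_nonneg su) auto
    show "\<bar>\<Sum>n\<in>I. g n\<bar> \<le> suminf (\<lambda>n. \<bar>g n\<bar>)" if "finite I" for I
      using sum_le_suminf[OF su that] by (intro order.trans[OF sum_abs]) simp
  qed
qed

lemma sum_telescope_atLeastAtMost:
  fixes F :: "nat \<Rightarrow> real"
  assumes "a \<le> N"
  shows "(\<Sum>n=a..N. F (Suc n) - F n) = F (Suc N) - F a"
  using assms by (induction N rule: dec_induct) auto

lemma sum_inverse_n_ln_n:
  obtains C where "\<forall>\<^sub>F N in sequentially. \<bar>(\<Sum>n=2..N. 1 / (real n * ln n)) - ln (ln N)\<bar> \<le> C"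
proof -
  define F where "F n = ln (ln (real n))" for n :: nat
  define g where "g n = 1 / (real n * ln n) - (F (Suc n) - F n)" for n
  have "g \<in> O(\<lambda>n. real n powr (-3/2))" unfolding g_def F_def of_nat_Suc by real_asymp
  then obtain B where B: "B \<ge> 0" "\<And>I. finite I \<Longrightarrow> \<bar>\<Sum>n\<in>I. g n\<bar> \<le> B" by (rule sum_abs_bounded) blast
  have "\<forall>\<^sub>F N::nat in sequentially. \<bar>ln (ln (real N + 1)) - ln (ln (real N))\<bar> \<le> 1" by real_asymp
  moreover have "\<forall>\<^sub>F N::nat in sequentially. N \<ge> 2" by (rule eventually_ge_at_top)
  ultimately have "\<forall>\<^sub>F N in sequentially. \<bar>(\<Sum>n=2..N. 1 / (real n * ln n)) - ln (ln N)\<bar> \<le> B + \<bar>F 2\<bar> + 1"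
  proof eventually_elim
    case (elim N)
    have "(\<Sum>n=2..N. g n) = (\<Sum>n=2..N. 1 / (real n * ln n)) - (\<Sum>n=2..N. F (Suc n) - F n)"
      unfolding g_def by (rule sum_subtractf)
    then have "(\<Sum>n=2..N. g n) = (\<Sum>n=2..N. 1 / (real n * ln n)) - (F (Suc N) - F 2)"
      by (simp only: sum_telescope_atLeastAtMost[OF elim(2)])
    moreover have "\<bar>F (Suc N) - F N\<bar> \<le> 1" using elim by (simp add: F_def add.commute)
    ultimately show ?case using B(2)[of "{2..N}"] by (simp add: F_def)
  qed
  then show ?thesis by (rule that)
qed

lemma mertens_sum_eq: "mertens_sum N = (\<Sum>n=2..N::nat. if prime n then ln n / n else 0)"
proof -
  have "{p. prime p \<and> p \<le> N} = {n \<in> {2..N}. prime n}" by (auto dest: prime_ge_2_nat)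
  then show ?thesis by (simp add: mertens_sum_def sum.inter_filter[symmetric])
qed

text \<open>By Mertens' first theorem the sums of ln p / p and of 1 / n stay within a bounded
  distance. The decreasing weight 1 / ln n carries this over, in both directions, to the sums of 1 /
  p and of 1 / (n ln n). In the sieve the bounded error becomes a constant factor.\<close>

lemma sum_prime_reciprocals:
  assumes HL: "hardy_littlewood_prime_pairs"
  obtains C where "\<forall>\<^sub>F N in sequentially. \<bar>(\<Sum>p::nat | prime p \<and> p \<le> N. 1 / p) - ln (ln N)\<bar> \<le> C"
proof -
  obtain C1 where C1: "\<And>N. N \<ge> 1 \<Longrightarrow> mertens_sum N \<ge> ln N - C1" using mertens_lower by blast
  obtain C2 where "\<forall>\<^sub>F N in sequentially. mertens_sum N \<le> ln N + C2" using mertens_upper[OF HL] by blast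
  then have "\<forall>\<^sub>F N in sequentially. mertens_sum N - ln N \<le> C2" by (simp add: algebra_simps)
  then obtain C2' where C2: "\<And>N. mertens_sum N - ln N \<le> C2'" by (rule eventually_le_imp_bounded) blast
  obtain C3 where C3: "\<forall>\<^sub>F N in sequentially. \<bar>(\<Sum>n=2..N. 1 / (real n * ln n)) - ln (ln N)\<bar> \<le> C3"
    by (rule sum_inverse_n_ln_n)
  define e where "e n = (if prime n then ln (real n) / n else 0)" for n :: nat
  define \<phi> where "\<phi> n = 1 / ln (real n)" for n :: nat
  have harm: "(\<Sum>n=2..N. 1 / real n) = harm N - 1" if "N \<ge> 2" for N
  proof -
    have "{1..N} = insert 1 {2..N}" using that by auto
    then show ?thesis by (simp add: harm_def inverse_eq_divide)
  qed
  have h1: "(\<Sum>n=2..N. 1 / real n) \<le> ln N" if "N \<ge> 2" for N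
    using euler_mascheroni_sequence_decreasing[of 1 N] that harm[OF that] by (simp add: harm_expand)
  have h2: "(\<Sum>n=2..N. 1 / real n) \<ge> ln N - 1" if "N \<ge> 2" for N
    using euler_mascheroni_sequence_nonneg[of N] that harm[OF that] by simp
  have dec: "\<phi> (Suc n) \<le> \<phi> n" if "n \<ge> 2" for n
    unfolding \<phi>_def using that by (intro divide_left_mono) auto
  have nn: "\<phi> n \<ge> 0" if "n \<ge> 2" for n unfolding \<phi>_def using that by simp
  have \<phi>e: "(\<Sum>n=2..N. \<phi> n * e n) = (\<Sum>p::nat | prime p \<and> p \<le> N. 1 / p)" for N
  proof -
    have "(\<Sum>n=2..N. \<phi> n * e n) = (\<Sum>n=2..N. if prime n then 1 / real n else 0)"
      by (intro sum.cong) (auto simp: \<phi>_def e_def)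
    also have "\<dots> = (\<Sum>p | p \<in> {2..N} \<and> prime p. 1 / real p)"
      by (rule sum.inter_filter[symmetric]) simp
    also have "{p. p \<in> {2..N} \<and> prime p} = {p. prime p \<and> p \<le> N}" by (auto dest: prime_ge_2_nat)
    finally show ?thesis .
  qed
  have \<phi>f: "(\<Sum>n=2..N. \<phi> n * (1 / real n)) = (\<Sum>n=2..N. 1 / (real n * ln n))" for N
    by (intro sum.cong) (auto simp: \<phi>_def)
  have A: "(\<Sum>n=2..N. 1 / (real n * ln n)) \<le> (\<Sum>p::nat | prime p \<and> p \<le> N. 1 / p) + C1 * \<phi> 2" if "N \<ge> 2" for N
  proof -
    have "(\<Sum>n=2..N. \<phi> n * (1 / real n)) \<le> (\<Sum>n=2..N. \<phi> n * e n) + C1 * \<phi> 2"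
    proof (rule abel_comparison[where a = 2 and \<phi> = \<phi>, OF dec nn _ that])
      fix N :: nat assume N: "N \<ge> 2"
      show "(\<Sum>n=2..N. 1 / real n) \<le> (\<Sum>n=2..N. e n) + C1"
        using h1[OF N] C1[of N] N by (simp add: mertens_sum_eq e_def)
    qed
    then show ?thesis by (simp only: \<phi>e \<phi>f)
  qed
  have B: "(\<Sum>p::nat | prime p \<and> p \<le> N. 1 / p) \<le> (\<Sum>n=2..N. 1 / (real n * ln n)) + (C2' + 1) * \<phi> 2" if "N \<ge> 2" for N
  proof -
    have "(\<Sum>n=2..N. \<phi> n * e n) \<le> (\<Sum>n=2..N. \<phi> n * (1 / real n)) + (C2' + 1) * \<phi> 2"
    proof (rule abel_comparison[where a = 2 and \<phi> = \<phi>, OF dec nn _ that])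
      fix N :: nat assume N: "N \<ge> 2"
      show "(\<Sum>n=2..N. e n) \<le> (\<Sum>n=2..N. 1 / real n) + (C2' + 1)"
        using h2[OF N] C2[of N] N by (simp add: mertens_sum_eq e_def)
    qed
    then show ?thesis by (simp only: \<phi>e \<phi>f)
  qed
  have "\<forall>\<^sub>F N::nat in sequentially. N \<ge> 2" by (rule eventually_ge_at_top)
  with C3 have "\<forall>\<^sub>F N in sequentially. \<bar>(\<Sum>p::nat | prime p \<and> p \<le> N. 1 / p) - ln (ln N)\<bar>
      \<le> C3 + \<bar>C1 * \<phi> 2\<bar> + \<bar>(C2' + 1) * \<phi> 2\<bar>"
  proof eventually_elim
    case (elim N)
    then show ?case using A[of N] B[of N] by linarith
  qed
  then show ?thesis by (rule that)
qed

subsection \<open>The sequence of primes\<close>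

lemma prime_nth_prime [simp]: "prime (nth_prime n)"
  using enumerate_in_set[OF primes_infinite, of "n - 1"] by (simp add: nth_prime_def)

lemma nth_prime_less: "1 \<le> m \<Longrightarrow> m < n \<Longrightarrow> nth_prime m < nth_prime n"
  unfolding nth_prime_def by (intro enumerate_mono primes_infinite) auto

lemma nth_prime_le: "1 \<le> m \<Longrightarrow> m \<le> n \<Longrightarrow> nth_prime m \<le> nth_prime n"
  using nth_prime_less[of m n] by (cases "m = n") auto

lemma nth_prime_le_iff: "1 \<le> m \<Longrightarrow> 1 \<le> n \<Longrightarrow> nth_prime m \<le> nth_prime n \<longleftrightarrow> m \<le> n"
  using nth_prime_less[of n m] nth_prime_le[of m n] by (meson leD not_le)

lemma ex_nth_prime:
  assumes "prime p"
  obtains n where "n \<ge> 1" "p = nth_prime n"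
proof -
  obtain k where "enumerate {p. prime p} k = p"
    using enumerate_Ex[OF primes_infinite, of p] assms by auto
  then have "p = nth_prime (k + 1)" by (simp add: nth_prime_def)
  then show ?thesis using that[of "k + 1"] by simp
qed

lemma inj_on_nth_prime: "inj_on nth_prime {1..}"
  by (rule linorder_inj_onI) (use nth_prime_less in force)+

lemma primes_le_nth_prime:
  assumes "n \<ge> 1"
  shows "{p. prime p \<and> p \<le> nth_prime n} = nth_prime ` {1..n}"
proof (intro equalityI subsetI)
  fix p assume p: "p \<in> {p. prime p \<and> p \<le> nth_prime n}"
  then obtain m where m: "m \<ge> 1" "p = nth_prime m" using ex_nth_prime by blast
  then show "p \<in> nth_prime ` {1..n}" using p assms nth_prime_le_iff[of m n] by auto
qed (use assms nth_prime_le in auto)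

lemma prime_count_nth_prime: "n \<ge> 1 \<Longrightarrow> prime_count (nth_prime n) = n"
  unfolding prime_count_def primes_le_nth_prime
  by (subst card_image) (auto intro: inj_on_subset[OF inj_on_nth_prime])

lemma nth_prime_ge: "n \<ge> 1 \<Longrightarrow> n \<le> nth_prime n"
  using prime_count_le[of "nth_prime n"] prime_count_nth_prime[of n] by simp

lemma filterlim_nth_prime: "filterlim nth_prime at_top sequentially"
proof (rule filterlim_at_top_mono[OF filterlim_ident])
  show "\<forall>\<^sub>F n in sequentially. n \<le> nth_prime n"
    using eventually_ge_at_top[of 1] by eventually_elim (rule nth_prime_ge)
qed

lemma eventually_nth_prime:
  assumes "\<forall>\<^sub>F N in sequentially. P N"
  shows "\<forall>\<^sub>F n in sequentially. P (nth_prime n)"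
  using assms filterlim_nth_prime by (rule eventually_compose_filterlim)

section \<open>Size of the n-th prime\<close>

lemma nth_prime_lower:
  fixes \<epsilon> :: real
  assumes HL: "hardy_littlewood_prime_pairs" and \<epsilon>: "\<epsilon> > 0"
  shows "\<forall>\<^sub>F n in sequentially. n * ln n \<le> (1 + \<epsilon>) * nth_prime n"
proof -
  have "\<forall>\<^sub>F n in sequentially. prime_count (nth_prime n) \<le> (1 + \<epsilon>) * nth_prime n / ln (nth_prime n)"
    by (rule eventually_nth_prime[OF prime_count_upper[OF HL \<epsilon>]])
  then show ?thesis using eventually_ge_at_top[of 2]
  proof eventually_elim
    case (elim n)
    then have n: "real n \<le> (1 + \<epsilon>) * nth_prime n / ln (nth_prime n)" by (simp add: prime_count_nth_prime)
    have "n \<le> nth_prime n" using elim by (intro nth_prime_ge) simp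
    then have le: "ln n \<le> ln (nth_prime n)" "ln (real n) > 0" using elim by auto
    have "n * ln n \<le> n * ln (nth_prime n)" using le by (intro mult_left_mono) auto
    also have "\<dots> \<le> (1 + \<epsilon>) * nth_prime n" using n le by (simp add: field_simps)
    finally show ?case .
  qed
qed

lemma nth_prime_upper:
  assumes HL: "hardy_littlewood_prime_pairs"
  obtains K :: real where "K > 0" "\<forall>\<^sub>F n in sequentially. nth_prime n \<le> K * (n * ln n)"
proof -
  obtain c :: real where c: "c > 0" "\<forall>\<^sub>F N in sequentially. c * N / ln N \<le> prime_count N"
    by (rule prime_count_lower[OF HL])
  have "\<forall>\<^sub>F n in sequentially. c * nth_prime n / ln (nth_prime n) \<le> prime_count (nth_prime n)"
    by (rule eventually_nth_prime[OF c(2)])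
  \<comment> \<open>Bootstrap: combined with the Chebyshev bound this gives p_n <= n^2, hence ln p_n
    <= 2 ln n, and the Chebyshev bound used a second time gives the claim.\<close>
  moreover have "\<forall>\<^sub>F N::nat in sequentially. ln (real N) \<le> c * sqrt N" using c(1) by real_asymp
  then have "\<forall>\<^sub>F n in sequentially. ln (nth_prime n) \<le> c * sqrt (nth_prime n)"
    by (rule eventually_nth_prime)
  ultimately have "\<forall>\<^sub>F n in sequentially. nth_prime n \<le> (2 / c) * (n * ln n)"
    using eventually_ge_at_top[of 2]
  proof eventually_elim
    case (elim n)
    define p where "p = real (nth_prime n)"
    have n: "c * p / ln p \<le> n" using elim by (simp add: prime_count_nth_prime p_def)
    have "n \<le> nth_prime n" using elim by (intro nth_prime_ge) simp
    then have p: "p \<ge> n" "p > 1" using elim by (auto simp: p_def)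
    then have lnp: "ln p > 0" by simp
    have cp: "c * p \<le> n * ln p" using n lnp by (simp add: field_simps)
    also have "\<dots> \<le> n * (c * sqrt p)" using elim by (intro mult_left_mono) (auto simp: p_def)
    finally have "c * (sqrt p * sqrt p) \<le> c * (n * sqrt p)" using p by (simp add: mult_ac)
    then have "sqrt p * sqrt p \<le> n * sqrt p" using c(1) by (rule mult_left_le_imp_le)
    moreover have "sqrt p > 0" using p by simp
    ultimately have "sqrt p \<le> n" by (rule mult_right_le_imp_le)
    then have "p \<le> (real n)\<^sup>2" using p by (simp add: sqrt_le_D)
    then have "ln p \<le> ln ((real n)\<^sup>2)" using p by (intro ln_mono) auto
    also have "\<dots> = 2 * ln n" using elim by (simp add: ln_realpow)
    finally have "n * ln p \<le> n * (2 * ln n)" by (intro mult_left_mono) auto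
    with cp have "c * p \<le> n * (2 * ln n)" by simp
    then show ?case using c(1) by (simp add: p_def field_simps)
  qed
  then show ?thesis using c(1) by (intro that[of "2 / c"]) auto
qed

lemma ln_nth_prime_upper:
  assumes HL: "hardy_littlewood_prime_pairs" and \<epsilon>: "\<epsilon> > 0"
  shows "\<forall>\<^sub>F n in sequentially. ln (nth_prime n) \<le> (1 + \<epsilon>) * ln n"
proof -
  obtain K :: real where K: "K > 0" "\<forall>\<^sub>F n in sequentially. nth_prime n \<le> K * (n * ln n)"
    using nth_prime_upper[OF HL] by blast
  have "\<forall>\<^sub>F n::nat in sequentially. ln (K * (real n * ln n)) \<le> (1 + \<epsilon>) * ln n"
    using K(1) \<epsilon> by real_asymp
  with K(2) show ?thesis
  proof eventually_elim
    case (elim n)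
    have "ln (nth_prime n) \<le> ln (K * (n * ln n))"
      using elim prime_gt_0_nat[OF prime_nth_prime[of n]] by (intro ln_mono) auto
    then show ?case using elim by simp
  qed
qed

text \<open>Mertens' theorem indexed by the primes, weakened from ln p_n to ln n by p_n >= n. As ln
  p_m ~ ln m, the summand is close to 1 / m times the reciprocal of p_m / (m ln m), so this bounds
  the logarithmic mean of that reciprocal from below.\<close>

lemma sum_ln_nth_prime_div_lower:
  obtains C where "\<And>n. n \<ge> 1 \<Longrightarrow> (\<Sum>m=1..n. ln (nth_prime m) / nth_prime m) \<ge> ln n - C"
proof -
  obtain C where C: "\<And>N. N \<ge> 1 \<Longrightarrow> mertens_sum N \<ge> ln N - C" using mertens_lower by blast
  show ?thesis
  proof (rule that[of C])
    fix n :: nat assume n: "n \<ge> 1"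
    have "ln n - C \<le> ln (nth_prime n) - C" using nth_prime_ge[OF n] n by simp
    also have "\<dots> \<le> mertens_sum (nth_prime n)" using nth_prime_ge[OF n] n by (intro C) simp
    also have "\<dots> = (\<Sum>m=1..n. ln (nth_prime m) / nth_prime m)"
      unfolding mertens_sum_def primes_le_nth_prime[OF n]
      by (subst sum.reindex) (auto intro: inj_on_subset[OF inj_on_nth_prime])
    finally show "(\<Sum>m=1..n. ln (nth_prime m) / nth_prime m) \<ge> ln n - C" .
  qed
qed

subsection \<open>Prime triples\<close>

definition prime_triples :: "nat \<Rightarrow> nat \<Rightarrow> nat \<Rightarrow> nat set" where
  "prime_triples N d' d = {p. prime p \<and> prime (p + d') \<and> prime (p + d) \<and> p + d \<le> N}"

lemma finite_prime_triples [simp, intro]: "finite (prime_triples N d' d)"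
  by (rule finite_subset[of _ "{..N}"]) (auto simp: prime_triples_def)

text \<open>Sifting only by primes \<open>p > d\<close> makes the three residue classes \<open>0\<close>, \<open>-d'\<close>, \<open>-d\<close>
  distinct, so that no singular series of the triple enters.\<close>

lemma prime_triples_sieve:
  fixes N d d' D Z r :: nat and z s :: real
  assumes d: "0 < d'" "d' < d" "d \<le> D" and Z: "real Z \<le> z" "1 \<le> z"
    and s: "s = (\<Sum>p | prime p \<and> D < p \<and> p \<le> Z. 1 / real p)"
  shows "real (card (prime_triples N d' d)) \<le>
    z + (N * exp (- (3 * s)) + N * exp (exp 1 * 3 * s - 2 * r) + z ^ (2 * r) * exp 3)"
proof -
  define P where "P = {p. prime p \<and> D < p \<and> p \<le> Z}"
  define \<Omega> where "\<Omega> p = {0, p - d', p - d}" for p :: nat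
  have finP: "finite P" by (rule finite_subset[of _ "{..Z}"]) (auto simp: P_def)
  have "card P \<le> card {1..Z}" by (intro card_mono) (auto simp: P_def dest: prime_ge_1_nat)
  then have cardP: "real (card P) \<le> z" using Z by simp
  have "card (\<Omega> p) = 3 \<and> \<Omega> p \<subseteq> {..<p}" if "p \<in> P" for p
    using that d by (auto simp: P_def \<Omega>_def card_insert_if)
  then have sieve: "real (card {n. n < N \<and> (\<forall>p\<in>P. n mod p \<notin> \<Omega> p)}) \<le>
     N * exp (- (real 3 * s)) + N * exp (exp 1 * real 3 * s - 2 * r) + z ^ (2 * r) * exp (real 3)"
    unfolding s P_def[symmetric] using finP Z cardP by (intro brun_pure_sieve) (auto simp: P_def)
  \<comment> \<open>For n > Z the numbers n, n + d' and n + d exceed every sieving prime; being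
    prime, they cannot be divisible by one. The elements up to Z are counted trivially.\<close>
  have sub: "prime_triples N d' d \<subseteq> {1..Z} \<union> {n. n < N \<and> (\<forall>p\<in>P. n mod p \<notin> \<Omega> p)}"
  proof
    fix n assume n: "n \<in> prime_triples N d' d"
    show "n \<in> {1..Z} \<union> {n. n < N \<and> (\<forall>p\<in>P. n mod p \<notin> \<Omega> p)}"
    proof (cases "n \<le> Z")
      case True
      then show ?thesis using n by (auto simp: prime_triples_def dest: prime_ge_1_nat)
    next
      case False
      have "n mod p \<notin> \<Omega> p" if p: "p \<in> P" for p
      proof
        assume mem: "n mod p \<in> \<Omega> p"
        have pp: "prime p" "p \<le> Z" "d < p" using p d by (auto simp: P_def)
        have eq: "n = p * (n div p) + n mod p" by simp
        from mem consider "n mod p = 0" | "n mod p = p - d'" | "n mod p = p - d" by (auto simp: \<Omega>_def)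
        then obtain e where e: "p dvd n + e" "e \<in> {0, d', d}"
        proof cases
          case 2
          then have "n + d' = p * (n div p) + p" using eq pp d by linarith
          then have "p dvd n + d'" by (metis dvd_add dvd_refl dvd_triv_left)
          then show ?thesis using that[of d'] by simp
        next
          case 3
          then have "n + d = p * (n div p) + p" using eq pp d by linarith
          then have "p dvd n + d" by (metis dvd_add dvd_refl dvd_triv_left)
          then show ?thesis using that[of d] by simp
        qed (use that[of 0] in auto)
        have "prime (n + e)" using e(2) n by (auto simp: prime_triples_def)
        then have "p = n + e" using e(1) pp(1) by (simp add: primes_dvd_imp_eq)
        then show False using pp False by simp
      qed
      then show ?thesis using n d by (auto simp: prime_triples_def)
    qed
  qed
  have "card (prime_triples N d' d) \<le> card ({1..Z} \<union> {n. n < N \<and> (\<forall>p\<in>P. n mod p \<notin> \<Omega> p)})"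
    by (intro card_mono sub) auto
  also have "\<dots> \<le> Z + card {n. n < N \<and> (\<forall>p\<in>P. n mod p \<notin> \<Omega> p)}"
    using card_Un_le[of "{1..Z}"] by simp
  finally have "real (card (prime_triples N d' d)) \<le> Z + real (card {n. n < N \<and> (\<forall>p\<in>P. n mod p \<notin> \<Omega> p)})"
    by (simp flip: of_nat_add)
  then show ?thesis using sieve Z by simp
qed

text \<open>The sum s of 1 / p over the sieving primes is ln ln Z - ln ln D up to O(1). Up to
  constants the first is at least l - ln l and the second at most ln l, so exp (- (3 * s)) is at
  most a constant times l ^ 6 / L ^ 3. The cutoff z and the truncation r are balanced so that both
  errors of the pure sieve are no larger.\<close>

lemma prime_triples_upper:
  assumes HL: "hardy_littlewood_prime_pairs"
  obtains C :: real where "C > 0"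
    "\<forall>\<^sub>F N in sequentially. \<forall>d' d. 0 < d' \<and> d' < d \<and> real d \<le> ln N \<longrightarrow>
      real (card (prime_triples N d' d)) \<le> C * (N * ln (ln N) ^ 6 / ln N ^ 3)"
proof -
  obtain C0 where "\<forall>\<^sub>F N in sequentially. \<bar>(\<Sum>p::nat | prime p \<and> p \<le> N. 1 / p) - ln (ln N)\<bar> \<le> C0"
    using sum_prime_reciprocals[OF HL] by blast
  then obtain M0 where M0: "\<And>N. N \<ge> M0 \<Longrightarrow> \<bar>(\<Sum>p::nat | prime p \<and> p \<le> N. 1 / p) - ln (ln N)\<bar> \<le> C0"
    by (auto simp: eventually_sequentially)
  have C0: "C0 \<ge> 0" using M0[of M0] by linarith
  \<comment> \<open>Mertens' theorem is applied at both \<open>Z\<close> and \<open>D\<close>,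
    whence 2 * C0; and ln Z is at least half of ln z = L / (28 * l), whence 56.\<close>
  define K where "K = 2 * C0 + ln 56"
  \<comment> \<open>One summand each for the sieve product, for the tail over large subsets, and for
    the terms of size about sqrt N.\<close>
  define C where "C = exp (3 * K) + exp (9 * C0) + 1"
  have "C > 0" unfolding C_def by (intro add_pos_pos) auto
  moreover have "\<forall>\<^sub>F N in sequentially. \<forall>d' d. 0 < d' \<and> d' < d \<and> real d \<le> ln N \<longrightarrow>
      real (card (prime_triples N d' d)) \<le> C * (N * ln (ln N) ^ 6 / ln N ^ 3)"
  proof -
    have "\<forall>\<^sub>F N::nat in sequentially. ln (real N) \<ge> M0 + 3" by real_asymp
    moreover have "\<forall>\<^sub>F N::nat in sequentially. ln (real N) / (28 * ln (ln (real N))) \<ge> 2" by real_asymp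
    moreover have "\<forall>\<^sub>F N::nat in sequentially. exp (ln (real N) / (28 * ln (ln (real N)))) \<ge> ln (real N)" by real_asymp
    moreover have "\<forall>\<^sub>F N::nat in sequentially. ln (ln (real N)) \<ge> 1" by real_asymp
    moreover have "\<forall>\<^sub>F N::nat in sequentially. exp (ln (real N) / 2) * (1 + exp 3) \<le> real N * ln (ln (real N)) ^ 6 / ln (real N) ^ 3"
      by real_asymp
    ultimately show ?thesis
    proof eventually_elim
      case (elim N)
      define L where "L = ln (real N)"
      define l where "l = ln L"
      \<comment> \<open>Since 2 * r will be at most 14 * l, the factor 28 keeps z ^ (2 * r) below
        exp (L / 2), which is the square root of N.\<close>
      define z where "z = exp (L / (28 * l))"
      define Z where "Z = nat \<lfloor>z\<rfloor>"
      define D where "D = nat \<lfloor>L\<rfloor>"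
      \<comment> \<open>As e <= 3 and s <= l + C0, the tail has exponent at most 9 * l + 9 * C0 - 2
        * r. With 2 * r >= 12 * l a saving of 3 * l remains, that is, the factor L ^ (-3).\<close>
      define r where "r = nat \<lceil>6 * l\<rceil>"
      define s where "s = (\<Sum>p | prime p \<and> D < p \<and> p \<le> Z. 1 / real p)"
      have L: "L \<ge> M0 + 3" using elim by (simp add: L_def)
      have l: "l \<ge> 1" using elim by (simp add: L_def l_def)
      have expl: "exp l = L" using L by (simp add: l_def)
      have N0: "real N > 0" using L by (cases "N = 0") (auto simp: L_def)
      have lz: "ln z = L / (28 * l)" "L / (28 * l) \<ge> 2" using elim by (auto simp: z_def L_def l_def)
      have zL: "z \<ge> L" using elim by (simp add: z_def L_def l_def)
      have zhalf: "z \<le> exp (L / 2)" unfolding z_def using l L by (simp add: field_simps)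
      have Zz: "real Z \<le> z" "real Z \<ge> z / 2"
        unfolding Z_def using zL L by (auto simp: le_nat_floor) linarith
      have DL: "real D \<le> L" unfolding D_def using L by simp
      have D3: "D \<ge> M0 + 3" unfolding D_def using L by (intro le_nat_floor) auto
      have DZ: "D \<le> Z" unfolding D_def Z_def using zL by (intro nat_mono floor_mono)
      have ssum: "s = (\<Sum>p::nat | prime p \<and> p \<le> Z. 1 / p) - (\<Sum>p::nat | prime p \<and> p \<le> D. 1 / p)"
      proof -
        have "{p. prime p \<and> p \<le> Z} = {p. prime p \<and> D < p \<and> p \<le> Z} \<union> {p. prime p \<and> p \<le> D}"
          using DZ by auto
        moreover have "finite {p. prime p \<and> D < p \<and> p \<le> Z}"
          by (rule finite_subset[OF _ finite_primes_le[of Z]]) auto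
        ultimately have "(\<Sum>p::nat | prime p \<and> p \<le> Z. 1 / real p) = s + (\<Sum>p::nat | prime p \<and> p \<le> D. 1 / p)"
          unfolding s_def by (simp only:) (rule sum.union_disjoint, auto)
        then show ?thesis by simp
      qed
      have s0: "s \<ge> 0" unfolding s_def by (intro sum_nonneg) auto
      have lnD: "ln (ln D) \<le> ln l"
      proof -
        have "ln (real D) \<le> l" unfolding l_def using DL D3 by (intro ln_mono) auto
        moreover have "ln (real D) > 0" using D3 by simp
        ultimately show ?thesis by (intro ln_mono) auto
      qed
      have lnZ: "ln Z \<ge> ln z / 2" "ln Z \<le> ln z"
      proof -
        have "ln (2::real) \<le> 1" using ln_2_less_1 by simp
        then have "ln z / 2 \<le> ln z - ln 2" using lz by simp
        also have "\<dots> = ln (z / 2)" using zL L by (simp add: ln_div)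
        also have "\<dots> \<le> ln Z" using Zz zL L by (intro ln_mono) auto
        finally show "ln Z \<ge> ln z / 2" .
        show "ln Z \<le> ln z" using Zz D3 DZ by (intro ln_mono) auto
      qed
      have "ln (L / (56 * l)) = l - ln 56 - ln l" using l L by (simp add: ln_div ln_mult l_def)
      moreover have "ln (L / (56 * l)) \<le> ln (ln Z)" using lnZ lz by (intro ln_mono) auto
      ultimately have "ln (ln Z) \<ge> l - ln 56 - ln l" by simp
      then have s_lower: "s \<ge> l - 2 * ln l - K"
        using M0[of Z] M0[of D] D3 DZ lnD unfolding ssum K_def by simp
      have "ln (ln Z) \<le> l"
      proof -
        have "L / (28 * l) \<le> L" using l L by (simp add: field_simps)
        then have "ln Z \<le> L" using lnZ lz by simp
        moreover have "ln Z > 0" using lnZ lz by simp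
        ultimately show ?thesis unfolding l_def by (intro ln_mono) auto
      qed
      moreover have "(\<Sum>p::nat | prime p \<and> p \<le> D. 1 / real p) \<ge> 0" by (intro sum_nonneg) auto
      ultimately have s_upper: "s \<le> l + C0"
        using M0[of Z] D3 DZ unfolding ssum by simp
      have e3: "exp (- (3 * s)) \<le> exp (3 * K) * (l ^ 6 / L ^ 3)"
      proof -
        have "exp (- (3 * s)) \<le> exp (3 * K + (6 * ln l - 3 * l))" using s_lower by simp
        also have "\<dots> = exp (3 * K) * (exp (ln l) ^ 6 / exp l ^ 3)"
          by (simp add: exp_add exp_diff flip: exp_of_nat_mult)
        finally show ?thesis using l expl by simp
      qed
      have rl: "12 * l \<le> 2 * real r" "2 * real r \<le> 14 * l"
        using l unfolding r_def by linarith+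
      have e9: "exp (exp 1 * 3 * s - 2 * r) \<le> exp (9 * C0) * (l ^ 6 / L ^ 3)"
      proof -
        have "exp 1 * 3 * s \<le> 9 * s" using exp_le s0 by (intro mult_right_mono) auto
        then have "exp 1 * 3 * s - 2 * r \<le> 9 * C0 + - (3 * l)" using rl s_upper by linarith
        then have "exp (exp 1 * 3 * s - 2 * r) \<le> exp (9 * C0 + - (3 * l))" by simp
        also have "\<dots> = exp (9 * C0) * exp (- (3 * l))" by (rule exp_add)
        also have "\<dots> = exp (9 * C0) * (1 / exp l ^ 3)"
          by (simp add: exp_minus inverse_eq_divide flip: exp_of_nat_mult)
        also have "\<dots> \<le> exp (9 * C0) * (l ^ 6 / L ^ 3)"
          unfolding expl using l L by (intro mult_left_mono divide_right_mono) auto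
        finally show ?thesis .
      qed
      have ez: "z ^ (2 * r) \<le> exp (L / 2)"
      proof -
        have "z ^ (2 * r) = exp (2 * real r * (L / (28 * l)))"
          unfolding z_def by (simp flip: exp_of_nat_mult)
        also have "2 * real r * (L / (28 * l)) \<le> 14 * l * (L / (28 * l))"
          using rl lz by (intro mult_right_mono) auto
        also have "14 * l * (L / (28 * l)) = L / 2" using l by simp
        finally show ?thesis by simp
      qed
      show ?case
      proof (intro allI impI)
        fix d' d :: nat assume d: "0 < d' \<and> d' < d \<and> real d \<le> ln N"
        have "real (card (prime_triples N d' d)) \<le>
          z + (N * exp (- (3 * s)) + N * exp (exp 1 * 3 * s - 2 * r) + z ^ (2 * r) * exp 3)"
        proof (rule prime_triples_sieve)
          show "d \<le> D" unfolding D_def L_def using d by (simp add: le_nat_floor)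
        qed (use d Zz zL L s_def in auto)
        also have "\<dots> \<le> exp (L / 2) + (N * (exp (3 * K) * (l ^ 6 / L ^ 3)) + N * (exp (9 * C0) * (l ^ 6 / L ^ 3)) + exp (L / 2) * exp 3)"
          using zhalf e3 e9 ez N0 by (intro add_mono mult_mono order_refl) auto
        also have "\<dots> = exp (L / 2) * (1 + exp 3) + (exp (3 * K) + exp (9 * C0)) * (N * l ^ 6 / L ^ 3)"
          by (simp add: algebra_simps add_divide_distrib)
        also have "\<dots> \<le> N * l ^ 6 / L ^ 3 + (exp (3 * K) + exp (9 * C0)) * (N * l ^ 6 / L ^ 3)"
          using elim by (simp add: L_def l_def)
        also have "\<dots> = C * (N * ln (ln N) ^ 6 / ln N ^ 3)"
          by (simp add: C_def L_def l_def algebra_simps add_divide_distrib)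
        finally show "real (card (prime_triples N d' d)) \<le> C * (N * ln (ln N) ^ 6 / ln N ^ 3)" .
      qed
    qed
  qed
  ultimately show ?thesis by (rule that)
qed

subsection \<open>Sums of reciprocal prime gaps\<close>

text \<open>Stopping before n keeps exactly the gaps whose two primes are at most
  \<open>nth_prime n\<close>, so that pair counts at N = \<open>nth_prime n\<close> apply
  directly.\<close>

definition recip_gap_sum :: "nat \<Rightarrow> real" where
  "recip_gap_sum n = (\<Sum>m=1..<n. 1 / real (prime_gap m))"

lemma nth_prime_gap: "m \<ge> 1 \<Longrightarrow> nth_prime (Suc m) = nth_prime m + prime_gap m"
  using nth_prime_less[of m "Suc m"] by (simp add: prime_gap_def)

lemma prime_gap_pos: "m \<ge> 1 \<Longrightarrow> prime_gap m > 0"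
  using nth_prime_less[of m "Suc m"] by (simp add: prime_gap_def)

lemma even_prime_gap:
  assumes "m \<ge> 2"
  shows "even (prime_gap m)"
proof -
  have "2 \<le> nth_prime 1" by (rule prime_ge_2_nat) simp
  moreover have "nth_prime 1 < nth_prime m" "nth_prime m < nth_prime (Suc m)"
    using assms by (auto intro: nth_prime_less)
  ultimately have "nth_prime m > 2" "nth_prime (Suc m) > 2" by linarith+
  then have "odd (nth_prime m)" "odd (nth_prime (Suc m))"
    by (simp_all add: prime_odd_nat)
  then show ?thesis using nth_prime_gap[of m] assms by (metis even_add one_le_numeral order.trans)
qed

definition gap_indices :: "nat \<Rightarrow> nat \<Rightarrow> nat set" where
  "gap_indices n d = {m \<in> {1..<n}. prime_gap m = d}"

lemma card_gap_indices_le: "card (gap_indices n d) \<le> card (prime_pairs (nth_prime n) d)"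
proof (rule card_inj_on_le)
  show "inj_on nth_prime (gap_indices n d)"
    by (rule inj_on_subset[OF inj_on_nth_prime]) (auto simp: gap_indices_def)
  show "nth_prime ` gap_indices n d \<subseteq> prime_pairs (nth_prime n) d"
  proof
    fix p assume "p \<in> nth_prime ` gap_indices n d"
    then obtain m where m: "m \<ge> 1" "m < n" "prime_gap m = d" "p = nth_prime m"
      by (auto simp: gap_indices_def)
    then have "p + d = nth_prime (Suc m)" by (simp add: nth_prime_gap)
    moreover have "nth_prime (Suc m) \<le> nth_prime n" using m by (intro nth_prime_le) auto
    ultimately show "p \<in> prime_pairs (nth_prime n) d" using m(4) by (simp add: prime_pairs_def)
  qed
qed auto

lemma card_gap_indices_ge:
  assumes "n \<ge> 1" "d > 0"
  shows "card (prime_pairs (nth_prime n) d) \<le>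
    card (gap_indices n d) + (\<Sum>d'\<in>{1..<d}. card (prime_triples (nth_prime n) d' d))"
proof -
  have "prime_pairs (nth_prime n) d \<subseteq>
    nth_prime ` gap_indices n d \<union> (\<Union>d'\<in>{1..<d}. prime_triples (nth_prime n) d' d)"
  proof
    fix p assume p: "p \<in> prime_pairs (nth_prime n) d"
    obtain m where m: "m \<ge> 1" "p = nth_prime m"
      using p ex_nth_prime by (auto simp: prime_pairs_def)
    obtain k where k: "k \<ge> 1" "p + d = nth_prime k"
      using p ex_nth_prime by (auto simp: prime_pairs_def)
    have "k \<le> n" using p k assms by (simp add: prime_pairs_def nth_prime_le_iff)
    moreover have "m < k" using nth_prime_le_iff[of k m] m k assms by linarith
    ultimately have mn: "m < n" by simp
    have "nth_prime (Suc m) \<le> nth_prime k" using \<open>m < k\<close> by (intro nth_prime_le) auto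
    then have gap: "prime_gap m \<le> d" using k(2) m nth_prime_gap[of m] by simp
    show "p \<in> nth_prime ` gap_indices n d \<union> (\<Union>d'\<in>{1..<d}. prime_triples (nth_prime n) d' d)"
    proof (cases "prime_gap m = d")
      case True
      then show ?thesis using m mn by (auto simp: gap_indices_def)
    next
      case False
      then have "prime_gap m \<in> {1..<d}" using gap prime_gap_pos[of m] m by auto
      moreover have "prime (p + prime_gap m)" using m nth_prime_gap[of m] by (metis prime_nth_prime)
      then have "p \<in> prime_triples (nth_prime n) (prime_gap m) d"
        using p by (auto simp: prime_triples_def prime_pairs_def)
      ultimately show ?thesis by blast
    qed
  qed
  then have "card (prime_pairs (nth_prime n) d) \<le>
    card (nth_prime ` gap_indices n d \<union> (\<Union>d'\<in>{1..<d}. prime_triples (nth_prime n) d' d))"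
    by (intro card_mono) (auto simp: gap_indices_def)
  also have "\<dots> \<le> card (nth_prime ` gap_indices n d) + card (\<Union>d'\<in>{1..<d}. prime_triples (nth_prime n) d' d)"
    by (rule card_Un_le)
  also have "\<dots> \<le> card (gap_indices n d) + (\<Sum>d'\<in>{1..<d}. card (prime_triples (nth_prime n) d' d))"
    by (intro add_mono card_UN_le card_image_le) (auto simp: gap_indices_def)
  finally show ?thesis .
qed

lemma sum_gap_indices:
  "(\<Sum>d\<in>E. real (card (gap_indices n d)) / real d) =
   (\<Sum>m=1..<n. \<Sum>d\<in>E. if prime_gap m = d then 1 / real d else 0)"
proof -
  have "real (card (gap_indices n d)) / real d = (\<Sum>m=1..<n. if prime_gap m = d then 1 / real d else 0)" for d
    unfolding gap_indices_def by (simp add: sum.inter_filter[symmetric])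
  then show ?thesis by (simp only: sum.swap[of _ E])
qed

text \<open>The first gap, the only odd one, is paid for by the summand 1, and every gap beyond D by
  1 / L. Only even gaps up to D have to be counted.\<close>

lemma recip_gap_sum_le:
  assumes "D > 0" "real D \<le> L" "L < real D + 1"
  shows "recip_gap_sum n \<le> 1 + n / L + (\<Sum>d\<in>evens_upto D. real (card (gap_indices n d)) / real d)"
proof -
  have L: "L > 0" using assms by linarith
  have "recip_gap_sum n \<le> (\<Sum>m=1..<n. (if m = 1 then 1 else 0) + 1 / L +
      (\<Sum>d\<in>evens_upto D. if prime_gap m = d then 1 / real d else 0))"
    unfolding recip_gap_sum_def
  proof (rule sum_mono)
    fix m assume m: "m \<in> {1..<n}"
    have nn: "(\<Sum>d\<in>evens_upto D. if prime_gap m = d then 1 / real d else 0) \<ge> (0::real)"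
      by (intro sum_nonneg) auto
    have pos: "prime_gap m > 0" using prime_gap_pos m by simp
    consider "m = 1" | "prime_gap m > D" | "m \<ge> 2" "prime_gap m \<le> D" using m by fastforce
    then show "1 / real (prime_gap m) \<le> (if m = 1 then 1 else 0) + 1 / L +
        (\<Sum>d\<in>evens_upto D. if prime_gap m = d then 1 / real d else 0)"
    proof cases
      case 1
      have "1 / real (prime_gap m) \<le> 1" using pos by simp
      then show ?thesis using 1 nn L by (simp add: add_increasing2)
    next
      case 2
      then have "L \<le> real (prime_gap m)" using assms by linarith
      then have "1 / real (prime_gap m) \<le> 1 / L" using L by (intro divide_left_mono) auto
      moreover have "(if m = 1 then 1 else 0 :: real) \<ge> 0" by simp
      ultimately show ?thesis using nn by linarith
    next
      case 3
      then have "even (prime_gap m)" by (intro even_prime_gap)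
      then have "prime_gap m \<in> evens_upto D" using 3 pos by (auto simp: evens_upto_def elim: evenE)
      then show ?thesis using L by (simp add: add_increasing)
    qed
  qed
  also have "\<dots> = (\<Sum>m=1..<n. if m = 1 then 1 else 0) + real (n - 1) / L +
      (\<Sum>d\<in>evens_upto D. real (card (gap_indices n d)) / real d)"
    by (simp add: sum.distrib sum_gap_indices)
  also have "\<dots> \<le> 1 + n / L + (\<Sum>d\<in>evens_upto D. real (card (gap_indices n d)) / real d)"
    using L by (intro add_mono order_refl divide_right_mono) auto
  finally show ?thesis .
qed

lemma recip_gap_sum_ge:
  "(\<Sum>d\<in>evens_upto D. real (card (gap_indices n d)) / real d) \<le> recip_gap_sum n"
  unfolding sum_gap_indices recip_gap_sum_def by (intro sum_mono) simp

text \<open>The predicted size of the sum of reciprocal gaps up to N: the pair conjecture supplies N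
  / (ln N)^2 times the singular series for each d, and the singular series divided by d sums to
  about ln ln N over d up to ln N.\<close>

definition gap_density :: "nat \<Rightarrow> real" where
  "gap_density N = N * ln (ln N) / (ln N)\<^sup>2"

lemma recip_gap_sum_upper:
  assumes HL: "hardy_littlewood_prime_pairs" and \<epsilon>: "\<epsilon> > 0"
  shows "\<forall>\<^sub>F n in sequentially. recip_gap_sum n \<le> (1 + \<epsilon>) * gap_density (nth_prime n)"
proof -
  define \<delta> where "\<delta> = \<epsilon> / 2"
  have \<delta>: "\<delta> > 0" using \<epsilon> by (simp add: \<delta>_def)
  have "\<forall>\<^sub>F N in sequentially. \<forall>d. 2 \<le> d \<and> real d \<le> 1 * ln N \<and> even d \<longrightarrow>
    \<bar>real (card (prime_pairs N d)) - singular_series d * N / (ln N)\<^sup>2\<bar> \<le> \<delta> * (singular_series d * N / (ln N)\<^sup>2)"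
    by (rule HL_prime_pairs[OF HL _ \<delta>]) simp
  moreover have "\<forall>\<^sub>F N in sequentially. real (prime_count N) \<le> (1 + 1 :: real) * N / ln N"
    by (rule prime_count_upper[OF HL]) simp
  moreover have "\<forall>\<^sub>F N::nat in sequentially. ln (real N) \<ge> 3" by real_asymp
  moreover have "\<forall>\<^sub>F N::nat in sequentially.
      1 + 2 * N / (ln N)\<^sup>2 + (1 + \<epsilon> / 2) * (N / (ln N)\<^sup>2) * (ln (ln N) + 1) \<le> (1 + \<epsilon>) * (N * ln (ln N) / (ln N)\<^sup>2)"
    using \<epsilon> by real_asymp
  \<comment> \<open>All asymptotic inputs hold along every integer N; n is therefore quantified
    inside, and \<open>eventually_nth_prime\<close> specializes N to primes at the end.\<close>
  ultimately have "\<forall>\<^sub>F N in sequentially. \<forall>n\<ge>1. N = nth_prime n \<longrightarrow> recip_gap_sum n \<le> (1 + \<epsilon>) * gap_density N"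
  proof eventually_elim
    case (elim N)
    show ?case
    proof (intro allI impI)
      fix n assume n: "n \<ge> 1" and N: "N = nth_prime n"
      define L where "L = ln (real N)"
      define D where "D = nat \<lfloor>L\<rfloor>"
      have L: "L \<ge> 3" using elim by (simp add: L_def)
      have D: "real D \<le> L" "L < real D + 1" unfolding D_def using L by auto
      have D0: "D > 0" using D L by linarith
      have "n = prime_count N" using n by (simp add: N prime_count_nth_prime)
      then have "real n \<le> 2 * N / L" using elim by (simp add: L_def)
      then have "n / L \<le> 2 * N / L / L" using L by (intro divide_right_mono) auto
      then have nL: "n / L \<le> 2 * N / L\<^sup>2" by (simp add: power2_eq_square)
      have "(\<Sum>d\<in>evens_upto D. real (card (gap_indices n d)) / real d) \<le>
          (\<Sum>d\<in>evens_upto D. (1 + \<delta>) * (N / L\<^sup>2) * (singular_series d / real d))"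
      proof (rule sum_mono)
        fix d assume d: "d \<in> evens_upto D"
        then have "2 \<le> d \<and> real d \<le> 1 * ln N \<and> even d"
          using D by (auto simp: evens_upto_def L_def)
        then have "\<bar>real (card (prime_pairs N d)) - singular_series d * N / (ln N)\<^sup>2\<bar> \<le> \<delta> * (singular_series d * N / (ln N)\<^sup>2)"
          using elim by blast
        then have "real (card (prime_pairs N d)) \<le> (1 + \<delta>) * (N / L\<^sup>2) * singular_series d"
          by (simp add: L_def abs_le_iff algebra_simps add_divide_distrib)
        moreover have "real (card (gap_indices n d)) \<le> card (prime_pairs N d)"
          using card_gap_indices_le[of n d] N by simp
        ultimately have "real (card (gap_indices n d)) / d \<le> (1 + \<delta>) * (N / L\<^sup>2) * singular_series d / d"
          by (intro divide_right_mono) auto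
        then show "real (card (gap_indices n d)) / d \<le> (1 + \<delta>) * (N / L\<^sup>2) * (singular_series d / d)" by simp
      qed
      also have "\<dots> = (1 + \<delta>) * (N / L\<^sup>2) * (\<Sum>d\<in>evens_upto D. singular_series d / real d)"
        by (rule sum_distrib_left[symmetric])
      also have "\<dots> \<le> (1 + \<delta>) * (N / L\<^sup>2) * (ln L + 1)"
      proof (intro mult_left_mono)
        have "(\<Sum>d\<in>evens_upto D. singular_series d / real d) \<le> harm D" by (rule sum_singular_series_div_le)
        also have "\<dots> \<le> ln D + 1"
          using euler_mascheroni_sequence_decreasing[of 1 D] D0 by (simp add: harm_expand)
        also have "\<dots> \<le> ln L + 1" using D D0 by simp
        finally show "(\<Sum>d\<in>evens_upto D. singular_series d / real d) \<le> ln L + 1" .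
      qed (use \<delta> in auto)
      finally have "recip_gap_sum n \<le> 1 + 2 * N / L\<^sup>2 + (1 + \<delta>) * (N / L\<^sup>2) * (ln L + 1)"
        using recip_gap_sum_le[OF D0 D, of n] nL by linarith
      then show "recip_gap_sum n \<le> (1 + \<epsilon>) * gap_density N"
        using elim by (simp add: L_def gap_density_def \<delta>_def)
    qed
  qed
  from eventually_nth_prime[OF this] eventually_ge_at_top[of 1] show ?thesis
    by eventually_elim auto
qed

lemma recip_gap_sum_lower:
  assumes HL: "hardy_littlewood_prime_pairs" and \<epsilon>: "0 < \<epsilon>" "\<epsilon> < 1"
  shows "\<forall>\<^sub>F n in sequentially. (1 - \<epsilon>) * gap_density (nth_prime n) \<le> recip_gap_sum n"
proof -
  \<comment> \<open>One factor 1 - \<delta> is lost to the pair conjecture and one to the average of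
    the singular series; the product exceeds 1 - 2 * \<delta>, hence 1 - \<epsilon>.\<close>
  define \<delta> where "\<delta> = \<epsilon> / 4"
  have \<delta>: "\<delta> > 0" "\<delta> < 1" using \<epsilon> by (auto simp: \<delta>_def)
  obtain C where C: "C > 0" "\<forall>\<^sub>F N in sequentially. \<forall>d' d. 0 < d' \<and> d' < d \<and> real d \<le> ln N \<longrightarrow>
      real (card (prime_triples N d' d)) \<le> C * (N * ln (ln N) ^ 6 / ln N ^ 3)"
    by (rule prime_triples_upper[OF HL])
  obtain K where K: "\<And>n. n \<ge> 1 \<Longrightarrow> (\<Sum>d\<in>evens_upto n. singular_series d / real d) \<ge> (1 - \<delta>) * ln n - K"
    using sum_singular_series_div_ge[OF \<delta>(1)] by blast
  \<comment> \<open>The lower bound to be reached, divided by N / (ln N)^2, as a function of l = ln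
    ln N: l - ln 2 - 6 * ln l bounds ln D from below, and C is the total cost of the
    triples.\<close>
  define g where "g l = (1 - \<delta>) * ((1 - \<delta>) * (l - ln 2 - 6 * ln l) - K) - C" for l
  have "((\<lambda>l. g l / l) \<longlongrightarrow> (1 - \<delta>) * (1 - \<delta>)) at_top"
    unfolding g_def using \<delta> by real_asymp
  moreover have "1 - \<epsilon> < (1 - \<delta>) * (1 - \<delta>)"
  proof -
    have "(1 - \<delta>) * (1 - \<delta>) = 1 - 2 * \<delta> + \<delta> * \<delta>" by (simp add: algebra_simps)
    moreover have "\<delta> * \<delta> \<ge> 0" "\<epsilon> = 4 * \<delta>" by (simp_all add: \<delta>_def)
    ultimately show ?thesis using \<delta>(1) by linarith
  qed
  ultimately have "\<forall>\<^sub>F l in at_top. 1 - \<epsilon> < g l / l" by (rule order_tendstoD)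
  then have "\<forall>\<^sub>F l in at_top. (1 - \<epsilon>) * l \<le> g l"
    using eventually_gt_at_top[of 0] by eventually_elim (simp add: field_simps)
  moreover have "filterlim (\<lambda>N::nat. ln (ln (real N))) at_top sequentially" by real_asymp
  ultimately have "\<forall>\<^sub>F N::nat in sequentially. (1 - \<epsilon>) * ln (ln (real N)) \<le> g (ln (ln (real N)))"
    by (rule eventually_compose_filterlim)
  moreover have "\<forall>\<^sub>F N in sequentially. \<forall>d. 2 \<le> d \<and> real d \<le> 1 * ln N \<and> even d \<longrightarrow>
    \<bar>real (card (prime_pairs N d)) - singular_series d * N / (ln N)\<^sup>2\<bar> \<le> \<delta> * (singular_series d * N / (ln N)\<^sup>2)"
    by (rule HL_prime_pairs[OF HL _ \<delta>(1)]) simp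
  moreover note C(2)
  moreover have "\<forall>\<^sub>F N::nat in sequentially. ln (ln (real N)) \<ge> 1" by real_asymp
  moreover have "\<forall>\<^sub>F N::nat in sequentially. ln (real N) / ln (ln (real N)) ^ 6 \<ge> 2" by real_asymp
  ultimately have "\<forall>\<^sub>F N in sequentially. \<forall>n\<ge>1. N = nth_prime n \<longrightarrow> (1 - \<epsilon>) * gap_density N \<le> recip_gap_sum n"
  proof eventually_elim
    case (elim N)
    show ?case
    proof (intro allI impI)
      fix n assume n: "n \<ge> 1" and N: "N = nth_prime n"
      define L where "L = ln (real N)"
      define l where "l = ln L"
      define D where "D = nat \<lfloor>L / l ^ 6\<rfloor>"
      define T where "T = C * (N * l ^ 6 / L ^ 3)"
      have l: "l \<ge> 1" using elim by (simp add: L_def l_def)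
      have Ll: "L / l ^ 6 \<ge> 2" using elim by (simp add: L_def l_def)
      have l6: "l ^ 6 \<ge> 1" using l by simp
      have L: "L > 0" using Ll l6 by (smt (verit) divide_nonpos_pos)
      have D: "real D \<le> L / l ^ 6" "real D \<ge> L / l ^ 6 / 2" "D \<ge> 1"
        unfolding D_def using Ll by (auto simp: le_nat_floor) linarith
      have DL: "real D \<le> L"
      proof -
        have "L / l ^ 6 \<le> L" using L l6 by (simp add: divide_le_eq)
        then show ?thesis using D by simp
      qed
      have T0: "T \<ge> 0" unfolding T_def using C L l by simp
      have NL: "N / L\<^sup>2 \<ge> 0" by simp
      have "(\<Sum>d\<in>evens_upto D. (1 - \<delta>) * (N / L\<^sup>2) * (singular_series d / real d) - T) \<le>
         (\<Sum>d\<in>evens_upto D. real (card (gap_indices n d)) / real d)"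
      proof (rule sum_mono)
        fix d assume d: "d \<in> evens_upto D"
        then have d0: "d > 0" "real d \<le> L" using DL by (auto simp: evens_upto_def)
        have "2 \<le> d \<and> real d \<le> 1 * ln N \<and> even d"
          using d d0 by (auto simp: evens_upto_def L_def)
        then have "\<bar>real (card (prime_pairs N d)) - singular_series d * N / (ln N)\<^sup>2\<bar> \<le> \<delta> * (singular_series d * N / (ln N)\<^sup>2)"
          using elim by blast
        then have "real (card (prime_pairs N d)) \<ge> (1 - \<delta>) * (N / L\<^sup>2) * singular_series d"
          by (simp add: L_def abs_le_iff algebra_simps diff_divide_distrib)
        moreover have "real (card (prime_pairs N d)) \<le> card (gap_indices n d) + (\<Sum>d'\<in>{1..<d}. real (card (prime_triples N d' d)))"
          using card_gap_indices_ge[OF n d0(1)] unfolding N[symmetric] by (metis of_nat_add of_nat_le_iff of_nat_sum)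
        moreover have "(\<Sum>d'\<in>{1..<d}. real (card (prime_triples N d' d))) \<le> (\<Sum>d'\<in>{1..<d}. T)"
          using elim d0 by (intro sum_mono) (auto simp: T_def L_def l_def)
        moreover have "(\<Sum>d'\<in>{1..<d}. T) \<le> d * T" using T0 by (simp add: mult_right_mono)
        ultimately have "(1 - \<delta>) * (N / L\<^sup>2) * singular_series d - d * T \<le> card (gap_indices n d)" by linarith
        then have "((1 - \<delta>) * (N / L\<^sup>2) * singular_series d - d * T) / d \<le> card (gap_indices n d) / d"
          by (intro divide_right_mono) auto
        then show "(1 - \<delta>) * (N / L\<^sup>2) * (singular_series d / real d) - T \<le> card (gap_indices n d) / d"
          using d0 by (simp add: diff_divide_distrib)
      qed
      also have "\<dots> \<le> recip_gap_sum n" by (rule recip_gap_sum_ge)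
      finally have A: "(1 - \<delta>) * (N / L\<^sup>2) * (\<Sum>d\<in>evens_upto D. singular_series d / real d) - card (evens_upto D) * T \<le> recip_gap_sum n"
        by (simp add: sum_subtractf sum_distrib_left)
      have "card (evens_upto D) \<le> card {1..D}" by (intro card_mono) (auto simp: evens_upto_def)
      then have "card (evens_upto D) * T \<le> L / l ^ 6 * T" using D T0 by (intro mult_right_mono) auto
      also have "L / l ^ 6 * T = C * (N / L\<^sup>2)"
        unfolding T_def using L l by (simp add: power2_eq_square power3_eq_cube)
      finally have B: "card (evens_upto D) * T \<le> C * (N / L\<^sup>2)" .
      have "l - ln 2 - 6 * ln l = ln (L / l ^ 6 / 2)"
        using L l by (simp add: ln_div ln_mult ln_realpow l_def[symmetric])
      also have "\<dots> \<le> ln D" using D L l by (intro ln_mono) auto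
      finally have "(1 - \<delta>) * (l - ln 2 - 6 * ln l) - K \<le> (1 - \<delta>) * ln D - K"
        using \<delta> by (intro diff_right_mono mult_left_mono) auto
      also have "\<dots> \<le> (\<Sum>d\<in>evens_upto D. singular_series d / real d)" by (rule K[OF D(3)])
      finally have "(1 - \<delta>) * (N / L\<^sup>2) * ((1 - \<delta>) * (l - ln 2 - 6 * ln l) - K) \<le>
          (1 - \<delta>) * (N / L\<^sup>2) * (\<Sum>d\<in>evens_upto D. singular_series d / real d)"
        using \<delta> by (intro mult_left_mono) auto
      moreover have "M * g l = (1 - \<delta>) * M * ((1 - \<delta>) * (l - ln 2 - 6 * ln l) - K) - C * M" for M
        by (simp add: g_def algebra_simps)
      ultimately have "N / L\<^sup>2 * g l \<le> recip_gap_sum n" using A B by (smt (verit))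
      moreover have "N / L\<^sup>2 * ((1 - \<epsilon>) * l) \<le> N / L\<^sup>2 * g l"
        using elim by (intro mult_left_mono) (auto simp: L_def l_def)
      ultimately show "(1 - \<epsilon>) * gap_density N \<le> recip_gap_sum n"
        by (simp add: gap_density_def L_def l_def mult_ac)
    qed
  qed
  from eventually_nth_prime[OF this] eventually_ge_at_top[of 1] show ?thesis
    by eventually_elim auto
qed

subsection \<open>Asymptotic equivalence of partial sums\<close>

lemma asymp_equiv_realI:
  fixes f g :: "nat \<Rightarrow> real"
  assumes pos: "\<forall>\<^sub>F n in sequentially. g n > 0"
    and le: "\<And>\<epsilon>. 0 < \<epsilon> \<Longrightarrow> \<epsilon> < 1 \<Longrightarrow> \<forall>\<^sub>F n in sequentially. f n \<le> (1 + \<epsilon>) * g n"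
    and ge: "\<And>\<epsilon>. 0 < \<epsilon> \<Longrightarrow> \<epsilon> < 1 \<Longrightarrow> \<forall>\<^sub>F n in sequentially. (1 - \<epsilon>) * g n \<le> f n"
  shows "f \<sim>[sequentially] g"
proof (rule asymp_equivI')
  show "(\<lambda>n. f n / g n) \<longlonglongrightarrow> 1"
  proof (rule tendstoI)
    fix e :: real assume "e > 0"
    define \<epsilon> where "\<epsilon> = min e 1 / 2"
    have \<epsilon>: "0 < \<epsilon>" "\<epsilon> < 1" "\<epsilon> < e" using \<open>e > 0\<close> by (auto simp: \<epsilon>_def)
    from le[OF \<epsilon>(1,2)] ge[OF \<epsilon>(1,2)] pos
    show "\<forall>\<^sub>F n in sequentially. dist (f n / g n) 1 < e"
    proof eventually_elim
      case (elim n)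
      then have "f n / g n \<le> 1 + \<epsilon>" "1 - \<epsilon> \<le> f n / g n" by (auto simp: field_simps)
      then show ?case using \<epsilon> by (simp add: dist_real_def abs_less_iff)
    qed
  qed
qed

lemma asymp_equiv_realD:
  fixes f g :: "nat \<Rightarrow> real"
  assumes equiv: "f \<sim>[sequentially] g" and pos: "\<forall>\<^sub>F n in sequentially. g n > 0" and \<epsilon>: "\<epsilon> > 0"
  shows "\<forall>\<^sub>F n in sequentially. (1 - \<epsilon>) * g n \<le> f n \<and> f n \<le> (1 + \<epsilon>) * g n"
proof -
  have "(\<lambda>n. if f n = 0 \<and> g n = 0 then 1 else f n / g n) \<longlonglongrightarrow> 1"
    using equiv by (rule asymp_equivD)
  then have "\<forall>\<^sub>F n in sequentially. dist (if f n = 0 \<and> g n = 0 then 1 else f n / g n) 1 < \<epsilon>"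
    using \<epsilon> by (rule tendstoD)
  with pos show ?thesis
  proof eventually_elim
    case (elim n)
    then have "\<bar>f n / g n - 1\<bar> < \<epsilon>" by (simp add: dist_real_def)
    then have "f n / g n \<le> 1 + \<epsilon>" "1 - \<epsilon> \<le> f n / g n" by linarith+
    then show ?case using elim by (simp add: field_simps)
  qed
qed

text \<open>Comparing summands eventually compares sums only up to a constant from the initial
  terms. As T tends to infinity, half of \<epsilon> absorbs that constant.\<close>

lemma asymp_equiv_absorb:
  fixes A T :: "nat \<Rightarrow> real"
  assumes T: "filterlim T at_top sequentially"
    and le: "\<And>\<epsilon>. 0 < \<epsilon> \<Longrightarrow> \<epsilon> < 1 \<Longrightarrow> \<exists>C. \<forall>\<^sub>F n in sequentially. A n \<le> (1 + \<epsilon>) * T n + C"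
    and ge: "\<And>\<epsilon>. 0 < \<epsilon> \<Longrightarrow> \<epsilon> < 1 \<Longrightarrow> \<exists>C. \<forall>\<^sub>F n in sequentially. (1 - \<epsilon>) * T n - C \<le> A n"
  shows "A \<sim>[sequentially] T"
proof (rule asymp_equiv_realI)
  show "\<forall>\<^sub>F n in sequentially. T n > 0" using T by (rule filterlim_at_top_dense[THEN iffD1, THEN spec])
  fix \<epsilon> :: real assume \<epsilon>: "0 < \<epsilon>" "\<epsilon> < 1"
  then have \<epsilon>2: "0 < \<epsilon> / 2" "\<epsilon> / 2 < 1" by auto
  have big: "\<forall>\<^sub>F n in sequentially. 2 * C / \<epsilon> \<le> T n" for C
    using T by (simp add: filterlim_at_top)
  obtain C where "\<forall>\<^sub>F n in sequentially. A n \<le> (1 + \<epsilon> / 2) * T n + C" using le[OF \<epsilon>2] by blast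
  then show "\<forall>\<^sub>F n in sequentially. A n \<le> (1 + \<epsilon>) * T n"
    using big[of C]
  proof eventually_elim
    case (elim n)
    then have "C \<le> \<epsilon> / 2 * T n" using \<epsilon> by (simp add: field_simps)
    then show ?case using elim by (simp add: algebra_simps)
  qed
  obtain C where "\<forall>\<^sub>F n in sequentially. (1 - \<epsilon> / 2) * T n - C \<le> A n" using ge[OF \<epsilon>2] by blast
  then show "\<forall>\<^sub>F n in sequentially. (1 - \<epsilon>) * T n \<le> A n"
    using big[of C]
  proof eventually_elim
    case (elim n)
    then have "C \<le> \<epsilon> / 2 * T n" using \<epsilon> by (simp add: field_simps)
    then show ?case using elim by (simp add: algebra_simps)
  qed
qed

lemma sum_le_eventually:
  fixes t u :: "nat \<Rightarrow> real"
  assumes "\<forall>\<^sub>F n in sequentially. t n \<le> u n"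
  obtains C where "\<And>N. (\<Sum>n=a..N. t n) \<le> (\<Sum>n=a..N. u n) + C"
proof -
  obtain n0 where n0: "\<And>n. n \<ge> n0 \<Longrightarrow> t n \<le> u n" using assms by (auto simp: eventually_sequentially)
  define C where "C = (\<Sum>n<n0. \<bar>t n - u n\<bar>)"
  show ?thesis
  proof (rule that)
    fix N
    have "(\<Sum>n=a..N. t n) - (\<Sum>n=a..N. u n) = (\<Sum>n=a..N. t n - u n)" by (simp add: sum_subtractf)
    also have "\<dots> \<le> (\<Sum>n=a..N. if n < n0 then \<bar>t n - u n\<bar> else 0)"
      using n0 by (intro sum_mono) (auto simp: not_less)
    also have "\<dots> = (\<Sum>n | n \<in> {a..N} \<and> n < n0. \<bar>t n - u n\<bar>)"
      by (rule sum.inter_filter[symmetric]) simp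
    also have "\<dots> \<le> C" unfolding C_def by (intro sum_mono2) auto
    finally show "(\<Sum>n=a..N. t n) \<le> (\<Sum>n=a..N. u n) + C" by simp
  qed
qed

lemma asymp_equiv_sum:
  fixes t u :: "nat \<Rightarrow> real"
  assumes equiv: "t \<sim>[sequentially] u" and pos: "\<forall>\<^sub>F n in sequentially. u n > 0"
    and U: "filterlim (\<lambda>N. \<Sum>n=a..N. u n) at_top sequentially"
  shows "(\<lambda>N. \<Sum>n=a..N. t n) \<sim>[sequentially] (\<lambda>N. \<Sum>n=a..N. u n)"
proof (rule asymp_equiv_absorb[OF U])
  fix \<epsilon> :: real assume "0 < \<epsilon>"
  note ev = asymp_equiv_realD[OF equiv pos this]
  have "\<forall>\<^sub>F n in sequentially. t n \<le> (1 + \<epsilon>) * u n" using ev by eventually_elim simp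
  then obtain C where "\<And>N. (\<Sum>n=a..N. t n) \<le> (\<Sum>n=a..N. (1 + \<epsilon>) * u n) + C" by (rule sum_le_eventually[where a = a]) blast
  then show "\<exists>C. \<forall>\<^sub>F N in sequentially. (\<Sum>n=a..N. t n) \<le> (1 + \<epsilon>) * (\<Sum>n=a..N. u n) + C"
    unfolding sum_distrib_left[symmetric] by (intro exI always_eventually allI)
  have "\<forall>\<^sub>F n in sequentially. (1 - \<epsilon>) * u n \<le> t n" using ev by eventually_elim simp
  then obtain C' where "\<And>N. (\<Sum>n=a..N. (1 - \<epsilon>) * u n) \<le> (\<Sum>n=a..N. t n) + C'" by (rule sum_le_eventually[where a = a]) blast
  then have "\<And>N. (1 - \<epsilon>) * (\<Sum>n=a..N. u n) - C' \<le> (\<Sum>n=a..N. t n)"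
    unfolding sum_distrib_left[symmetric] by (simp add: algebra_simps)
  then show "\<exists>C. \<forall>\<^sub>F N in sequentially. (1 - \<epsilon>) * (\<Sum>n=a..N. u n) - C \<le> (\<Sum>n=a..N. t n)"
    by (intro exI always_eventually allI)
qed

text \<open>F plays the part of an antiderivative. Telescoping gives F (Suc N) - F a; the constant
  is absorbed because F tends to infinity, and the shift because F (Suc n) ~ F n.\<close>

lemma asymp_equiv_sum_telescope:
  fixes v F :: "nat \<Rightarrow> real"
  assumes equiv: "v \<sim>[sequentially] (\<lambda>n. F (Suc n) - F n)"
    and pos: "\<forall>\<^sub>F n in sequentially. F (Suc n) - F n > 0"
    and F: "filterlim F at_top sequentially" and Suc: "(\<lambda>n. F (Suc n)) \<sim>[sequentially] F"
  shows "(\<lambda>N. \<Sum>n=a..N. v n) \<sim>[sequentially] F"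
proof -
  have tele: "\<forall>\<^sub>F N in sequentially. - F a + F (Suc N) = (\<Sum>n=a..N. F (Suc n) - F n)"
    using eventually_ge_at_top[of a] by eventually_elim (simp add: sum_telescope_atLeastAtMost)
  have FS: "filterlim (\<lambda>n. F (Suc n)) at_top sequentially"
    using F by (subst filterlim_sequentially_Suc)
  have lim: "filterlim (\<lambda>N. - F a + F (Suc N)) at_top sequentially"
    by (rule filterlim_tendsto_add_at_top[OF tendsto_const FS])
  have lim': "filterlim (\<lambda>N. \<Sum>n=a..N. F (Suc n) - F n) at_top sequentially"
    using lim by (rule filterlim_cong[OF refl refl tele, THEN iffD1])
  have "(\<lambda>N. \<Sum>n=a..N. v n) \<sim>[sequentially] (\<lambda>N. \<Sum>n=a..N. F (Suc n) - F n)"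
    by (rule asymp_equiv_sum[OF equiv pos lim'])
  also have "\<dots> \<sim>[sequentially] F"
  proof (rule asymp_equiv_absorb[OF F])
    fix \<epsilon> :: real assume \<epsilon>: "0 < \<epsilon>" "\<epsilon> < 1"
    have "\<forall>\<^sub>F n in sequentially. F n > 0" using F by (rule filterlim_at_top_dense[THEN iffD1, THEN spec])
    from asymp_equiv_realD[OF Suc this \<epsilon>(1)] tele
    have ev: "\<forall>\<^sub>F N in sequentially. (\<Sum>n=a..N. F (Suc n) - F n) \<le> (1 + \<epsilon>) * F N + \<bar>F a\<bar> \<and>
        (1 - \<epsilon>) * F N - \<bar>F a\<bar> \<le> (\<Sum>n=a..N. F (Suc n) - F n)"
      by eventually_elim linarith
    show "\<exists>C. \<forall>\<^sub>F N in sequentially. (\<Sum>n=a..N. F (Suc n) - F n) \<le> (1 + \<epsilon>) * F N + C"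
      by (rule exI[of _ "\<bar>F a\<bar>"]) (use ev in eventually_elim, simp)
    show "\<exists>C. \<forall>\<^sub>F N in sequentially. (1 - \<epsilon>) * F N - C \<le> (\<Sum>n=a..N. F (Suc n) - F n)"
      by (rule exI[of _ "\<bar>F a\<bar>"]) (use ev in eventually_elim, simp)
  qed
  finally show ?thesis .
qed

subsection \<open>Removing the primes\<close>

definition weight :: "real \<Rightarrow> nat \<Rightarrow> real" where
  "weight c n = 1 / (real n * ln (ln n) powr c)"

text \<open>The v_n of the overview; its antiderivative is (ln ln x)^(2 - c) / (2 - c), or ln ln ln
  x for c = 2.\<close>

definition main_weight :: "real \<Rightarrow> nat \<Rightarrow> real" where
  "main_weight c n = ln (ln n) powr (1 - c) / (real n * ln n)"

text \<open>The b_n of the overview. It is known to be at least 1 - o(1) and bounded, but only its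
  average is shown to be 1.\<close>

definition prime_ratio :: "nat \<Rightarrow> real" where
  "prime_ratio n = nth_prime n / (real n * ln n)"

lemma ln_ln_pos: "n \<ge> 3 \<Longrightarrow> ln (ln (real n)) > 0"
proof -
  assume "n \<ge> 3"
  then have "exp 1 < real n" using e_less_272 by linarith
  then have "1 < ln (real n)" by (metis exp_less_cancel_iff exp_ln exp_gt_zero order.strict_trans)
  then show ?thesis by simp
qed

lemma main_weight_pos: "n \<ge> 3 \<Longrightarrow> main_weight c n > 0"
  unfolding main_weight_def using ln_ln_pos[of n] by (intro divide_pos_pos mult_pos_pos) auto

lemma weight_pos: "n \<ge> 3 \<Longrightarrow> weight c n > 0"
  unfolding weight_def using ln_ln_pos[of n] by (intro divide_pos_pos mult_pos_pos) auto

lemma ln_nth_prime_asymp: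
  assumes HL: "hardy_littlewood_prime_pairs"
  shows "(\<lambda>n. ln (nth_prime n)) \<sim>[sequentially] (\<lambda>n. ln (real n))"
proof (rule asymp_equiv_realI)
  show pos: "\<forall>\<^sub>F n::nat in sequentially. ln (real n) > 0" by real_asymp
  fix \<epsilon> :: real assume \<epsilon>: "0 < \<epsilon>" "\<epsilon> < 1"
  show "\<forall>\<^sub>F n in sequentially. ln (nth_prime n) \<le> (1 + \<epsilon>) * ln (real n)"
    by (rule ln_nth_prime_upper[OF HL \<epsilon>(1)])
  show "\<forall>\<^sub>F n in sequentially. (1 - \<epsilon>) * ln (real n) \<le> ln (nth_prime n)"
    using pos eventually_ge_at_top[of 1]
  proof eventually_elim
    case (elim n)
    have "(1 - \<epsilon>) * ln (real n) \<le> 1 * ln (real n)" using \<epsilon> elim by (intro mult_right_mono) auto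
    also have "\<dots> \<le> ln (nth_prime n)" using nth_prime_ge[of n] elim by simp
    finally show ?case .
  qed
qed

lemma ln_ln_nth_prime_asymp:
  assumes HL: "hardy_littlewood_prime_pairs"
  shows "(\<lambda>n. ln (ln (nth_prime n))) \<sim>[sequentially] (\<lambda>n. ln (ln (real n)))"
proof (rule asymp_equiv_realI)
  show "\<forall>\<^sub>F n::nat in sequentially. ln (ln (real n)) > 0" by real_asymp
  fix \<epsilon> :: real assume \<epsilon>: "0 < \<epsilon>" "\<epsilon> < 1"
  have "\<forall>\<^sub>F n in sequentially. ln (nth_prime n) \<le> (1 + 1) * ln (real n)"
    by (rule ln_nth_prime_upper[OF HL]) simp
  moreover have "\<forall>\<^sub>F n::nat in sequentially. ln (2 * ln (real n)) \<le> (1 + \<epsilon>) * ln (ln n)"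
    using \<epsilon> by real_asymp
  ultimately show "\<forall>\<^sub>F n in sequentially. ln (ln (nth_prime n)) \<le> (1 + \<epsilon>) * ln (ln (real n))"
    using eventually_ge_at_top[of 3]
  proof eventually_elim
    case (elim n)
    then have "nth_prime n > 1" using nth_prime_ge[of n] by simp
    then have "ln (ln (nth_prime n)) \<le> ln (2 * ln n)" using elim by (intro ln_mono) auto
    then show ?case using elim by simp
  qed
  show "\<forall>\<^sub>F n in sequentially. (1 - \<epsilon>) * ln (ln (real n)) \<le> ln (ln (nth_prime n))"
    using eventually_ge_at_top[of 3]
  proof eventually_elim
    case (elim n)
    have "(1 - \<epsilon>) * ln (ln (real n)) \<le> 1 * ln (ln (real n))"
      using \<epsilon> ln_ln_pos[OF elim] by (intro mult_right_mono) auto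
    also have "\<dots> \<le> ln (ln (nth_prime n))"
    proof -
      have "ln (real n) \<le> ln (nth_prime n)" using nth_prime_ge[of n] elim by simp
      moreover have "ln (real n) > 0" using elim by simp
      ultimately show ?thesis by (simp add: ln_mono)
    qed
    finally show ?case .
  qed
qed

text \<open>Inside logarithms p_n may be replaced by n, because p_n lies between n and a constant
  times n ln n. The outer factor p_n has to stay, its size being known only up to a constant
  factor.\<close>

lemma recip_gap_sum_asymp:
  assumes HL: "hardy_littlewood_prime_pairs"
  shows "recip_gap_sum \<sim>[sequentially] (\<lambda>n. nth_prime n * ln (ln (real n)) / (ln (real n))\<^sup>2)"
proof -
  have "\<forall>\<^sub>F N::nat in sequentially. gap_density N > 0" unfolding gap_density_def by real_asymp
  then have "\<forall>\<^sub>F n in sequentially. gap_density (nth_prime n) > 0" by (rule eventually_nth_prime)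
  then have "recip_gap_sum \<sim>[sequentially] (\<lambda>n. gap_density (nth_prime n))"
    using recip_gap_sum_upper[OF HL] recip_gap_sum_lower[OF HL] by (rule asymp_equiv_realI)
  also have "\<dots> \<sim>[sequentially] (\<lambda>n. nth_prime n * ln (ln (real n)) / (ln (real n))\<^sup>2)"
    unfolding gap_density_def
    by (intro asymp_equiv_intros ln_nth_prime_asymp ln_ln_nth_prime_asymp HL)
  finally show ?thesis .
qed

text \<open>If b is bounded, b >= 1 - o(1), and 1 / b has mean at least 1 - o(1), then b has mean 1:
  were b noticeably above 1 on a positive proportion, the mean of 1 / b would drop below 1. The mean
  of 1 / b is known for the weights 1 / n, and partial summation transfers it to
  \<open>main_weight\<close>.\<close>

lemma prime_ratio_sum_asymp:
  assumes HL: "hardy_littlewood_prime_pairs"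
    and T: "filterlim (\<lambda>N. \<Sum>n=3..N. main_weight c n) at_top sequentially"
  shows "(\<lambda>N. \<Sum>n=3..N. prime_ratio n * main_weight c n) \<sim>[sequentially] (\<lambda>N. \<Sum>n=3..N. main_weight c n)"
proof (rule asymp_equiv_absorb[OF T])
  define T where "T N = (\<Sum>n=3..N. main_weight c n)" for N
  \<comment> \<open>The sum of \<open>main_weight c n\<close> divided by
    \<open>prime_ratio n\<close>, that is, the weighted sum of 1 / b.\<close>
  define Q where "Q N = (\<Sum>n=3..N. ln (ln (real n)) powr (1 - c) / nth_prime n)" for N
  fix \<epsilon> :: real assume \<epsilon>: "0 < \<epsilon>" "\<epsilon> < 1"
  have lower: "\<forall>\<^sub>F n in sequentially. n * ln n \<le> (1 + \<epsilon>) * nth_prime n" if "\<epsilon> > 0" for \<epsilon> :: real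
    by (rule nth_prime_lower[OF HL that])

  show "\<exists>C. \<forall>\<^sub>F N in sequentially. (1 - \<epsilon>) * (\<Sum>n=3..N. main_weight c n) - C \<le> (\<Sum>n=3..N. prime_ratio n * main_weight c n)"
  proof -
    have "\<forall>\<^sub>F n in sequentially. (1 - \<epsilon>) * main_weight c n \<le> prime_ratio n * main_weight c n"
      using lower[OF \<epsilon>(1)] eventually_ge_at_top[of 3]
    proof eventually_elim
      case (elim n)
      have pos: "real n * ln n > 0" using elim by simp
      have "(1 - \<epsilon>) * (n * ln n) \<le> (1 - \<epsilon>) * ((1 + \<epsilon>) * nth_prime n)"
        using elim \<epsilon> by (intro mult_left_mono) auto
      also have "\<dots> = (1 - \<epsilon> * \<epsilon>) * nth_prime n" by (simp add: algebra_simps)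
      also have "\<dots> \<le> 1 * real (nth_prime n)" by (intro mult_right_mono) auto
      finally have "1 - \<epsilon> \<le> prime_ratio n" using pos by (simp add: prime_ratio_def pos_le_divide_eq)
      then show ?case using main_weight_pos[of n c] elim by (intro mult_right_mono) auto
    qed
    then obtain C where "\<And>N. (\<Sum>n=3..N. (1 - \<epsilon>) * main_weight c n) \<le> (\<Sum>n=3..N. prime_ratio n * main_weight c n) + C"
      by (rule sum_le_eventually[where a = 3]) blast
    then have "\<And>N. (1 - \<epsilon>) * (\<Sum>n=3..N. main_weight c n) - C \<le> (\<Sum>n=3..N. prime_ratio n * main_weight c n)"
      unfolding sum_distrib_left[symmetric] by (simp add: algebra_simps)
    then show ?thesis by (intro exI always_eventually allI)
  qed

  obtain K where K: "K > 0" "\<forall>\<^sub>F n in sequentially. nth_prime n \<le> K * (n * ln n)"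
    by (rule nth_prime_upper[OF HL])
  \<comment> \<open>The main terms will combine to T + K * (1 + \<delta>) * T - K * (1 - \<delta>) *
    T, an excess of 2 * K * \<delta> * T over T.\<close>
  define \<delta> where "\<delta> = min (1 / 2) (\<epsilon> / (2 * K))"
  have \<delta>: "0 < \<delta>" "\<delta> < 1" "2 * K * \<delta> \<le> \<epsilon>" using \<epsilon> K(1) by (auto simp: \<delta>_def min_def field_simps)

  text \<open>\<open>b - 1 \<le> K * (1 + \<delta> - 1 / b)\<close> for \<open>1 / (1 + \<delta>) \<le> b \<le> K\<close>, so an upper bound for the
    average of \<open>prime_ratio\<close> follows from a lower bound for the average of its reciprocal.\<close>
  have "\<forall>\<^sub>F n in sequentially. prime_ratio n * main_weight c n \<le>
      (1 + K * (1 + \<delta>)) * main_weight c n - K * (ln (ln (real n)) powr (1 - c) / nth_prime n)"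
    using lower[OF \<delta>(1)] K(2) eventually_ge_at_top[of 3]
  proof eventually_elim
    case (elim n)
    define b where "b = prime_ratio n"
    have pos: "real n * ln n > 0" using elim by simp
    have np: "nth_prime n > 0" by (simp add: prime_gt_0_nat)
    have b0: "b > 0" unfolding b_def prime_ratio_def using pos np by (intro divide_pos_pos) auto
    have bK: "b \<le> K" using elim pos by (simp add: b_def prime_ratio_def pos_divide_le_eq)
    have "1 / b = n * ln n / nth_prime n" by (simp add: b_def prime_ratio_def)
    then have x: "1 / b \<le> 1 + \<delta>" using elim np by (simp add: pos_divide_le_eq)
    have "b - 1 = b * (1 - 1 / b)" using b0 by (simp add: right_diff_distrib)
    also have "\<dots> \<le> b * (1 + \<delta> - 1 / b)" using b0 \<delta> by (intro mult_left_mono) auto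
    also have "\<dots> \<le> K * (1 + \<delta> - 1 / b)" using bK x by (intro mult_right_mono) auto
    finally have "b \<le> 1 + K * (1 + \<delta>) - K * (1 / b)" by (simp add: algebra_simps)
    then have "b * main_weight c n \<le> (1 + K * (1 + \<delta>) - K * (1 / b)) * main_weight c n"
      using main_weight_pos[of n c] elim by (intro mult_right_mono) auto
    moreover have "1 / b * main_weight c n = ln (ln (real n)) powr (1 - c) / nth_prime n"
      using pos np by (simp add: b_def prime_ratio_def main_weight_def)
    moreover have "(1 + K * (1 + \<delta>) - K * (1 / b)) * main_weight c n =
        (1 + K * (1 + \<delta>)) * main_weight c n - K * (1 / b * main_weight c n)"
      by (simp only: left_diff_distrib mult.assoc)
    ultimately show ?case unfolding b_def by (simp only:)
  qed
  then obtain C1 where "\<And>N. (\<Sum>n=3..N. prime_ratio n * main_weight c n) \<le>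
      (\<Sum>n=3..N. (1 + K * (1 + \<delta>)) * main_weight c n - K * (ln (ln (real n)) powr (1 - c) / nth_prime n)) + C1"
    by (rule sum_le_eventually[where a = 3]) blast
  then have up: "(\<Sum>n=3..N. prime_ratio n * main_weight c n) \<le> (1 + K * (1 + \<delta>)) * T N - K * Q N + C1" for N
    by (simp only: sum_subtractf sum_distrib_left[symmetric] T_def Q_def)

  \<comment> \<open>Partial summation with \<phi> n = n * \<open>main_weight c n\<close>: it turns 1
    / n into \<open>main_weight c n\<close> and ln n / p_n into the summand of \<open>Q\<close>.
    Replacing ln p_n by (1 + \<delta>) * ln n is paid for by the factor 1 - \<delta>, since (1 -
    \<delta>) * (1 + \<delta>) <= 1.\<close>
  have "\<exists>C2. \<forall>\<^sub>F N in sequentially. (1 - \<delta>) * T N \<le> Q N + C2"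
  proof -
    define \<phi> where "\<phi> n = ln (ln (real n)) powr (1 - c) / ln n" for n :: nat
    \<comment> \<open>For c < 1 the power of ln ln n increases, yet the division by ln n wins
      eventually; this is why the comparison starts at a sufficiently large a.\<close>
    have "\<forall>\<^sub>F n::nat in sequentially. ln (ln (real n + 1)) powr (1 - c) / ln (real n + 1) \<le> ln (ln (real n)) powr (1 - c) / ln (real n)"
      by real_asymp
    then have "\<forall>\<^sub>F n in sequentially. \<phi> (Suc n) \<le> \<phi> n" by (simp add: \<phi>_def add.commute)
    moreover have "\<forall>\<^sub>F n in sequentially. ln (nth_prime n) \<le> (1 + \<delta>) * ln n"
      by (rule ln_nth_prime_upper[OF HL \<delta>(1)])
    ultimately have "\<forall>\<^sub>F n in sequentially. \<phi> (Suc n) \<le> \<phi> n \<and> ln (nth_prime n) \<le> (1 + \<delta>) * ln n"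
      by (rule eventually_conj)
    then obtain a0 where a0: "\<And>n. n \<ge> a0 \<Longrightarrow> \<phi> (Suc n) \<le> \<phi> n \<and> ln (nth_prime n) \<le> (1 + \<delta>) * ln n"
      by (auto simp: eventually_sequentially)
    define a where "a = max a0 3"
    have a: "a \<ge> 3" "a \<ge> a0" by (auto simp: a_def)
    obtain C where C: "\<And>n. n \<ge> 1 \<Longrightarrow> (\<Sum>m=1..n. ln (nth_prime m) / nth_prime m) \<ge> ln n - C"
      using sum_ln_nth_prime_div_lower by blast
    define C' where "C' = \<bar>C\<bar> + (\<Sum>m=1..<a. ln (nth_prime m) / nth_prime m) + 1"
    have "(\<Sum>n=a..N. \<phi> n * ((1 - \<delta>) / n)) \<le> (\<Sum>n=a..N. \<phi> n * (ln n / nth_prime n)) + C' * \<phi> a"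
      if "N \<ge> a" for N
    proof (rule abel_comparison[where a = a and \<phi> = \<phi>, OF _ _ _ that])
      fix N assume N: "N \<ge> a"
      have "(\<Sum>n=a..N. 1 / real n) \<le> (\<Sum>n=1..N. 1 / real n)" using a by (intro sum_mono2) auto
      also have "\<dots> = harm N" by (simp add: harm_def inverse_eq_divide)
      also have "\<dots> \<le> ln N + 1"
        using euler_mascheroni_sequence_decreasing[of 1 N] a N by (simp add: harm_expand)
      finally have H: "(\<Sum>n=a..N. 1 / real n) \<le> ln N + 1" .
      have "{1..N} = {1..<a} \<union> {a..N}" using a N by auto
      then have "(\<Sum>m=1..N. ln (nth_prime m) / nth_prime m) = (\<Sum>m=1..<a. ln (nth_prime m) / nth_prime m) +
          (\<Sum>m=a..N. ln (nth_prime m) / nth_prime m)"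
        by (simp only:) (rule sum.union_disjoint, auto)
      then have "(\<Sum>n=a..N. 1 / real n) \<le> (\<Sum>m=a..N. ln (nth_prime m) / nth_prime m) + C'"
        using C[of N] a N H unfolding C'_def by simp
      also have "(\<Sum>m=a..N. ln (nth_prime m) / nth_prime m) \<le> (\<Sum>m=a..N. (1 + \<delta>) * (ln m / nth_prime m))"
      proof (rule sum_mono)
        fix m assume "m \<in> {a..N}"
        then have "ln (nth_prime m) \<le> (1 + \<delta>) * ln m" using a0[of m] a by simp
        then have "ln (nth_prime m) / nth_prime m \<le> (1 + \<delta>) * ln m / nth_prime m"
          by (intro divide_right_mono) auto
        then show "ln (nth_prime m) / nth_prime m \<le> (1 + \<delta>) * (ln m / nth_prime m)" by simp
      qed
      also have "\<dots> = (1 + \<delta>) * (\<Sum>m=a..N. ln m / nth_prime m)" by (rule sum_distrib_left[symmetric])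
      finally have "(1 - \<delta>) * (\<Sum>n=a..N. 1 / real n) \<le> (1 - \<delta>) * ((1 + \<delta>) * (\<Sum>m=a..N. ln m / nth_prime m) + C')"
        using \<delta> by (intro mult_left_mono) auto
      also have "\<dots> = (\<Sum>m=a..N. ln m / nth_prime m) + C' - \<delta> * \<delta> * (\<Sum>m=a..N. ln m / nth_prime m) - \<delta> * C'"
        by (simp add: algebra_simps)
      also have "\<dots> \<le> (\<Sum>m=a..N. ln m / nth_prime m) + C'"
      proof -
        have "(\<Sum>m=a..N. ln m / nth_prime m) \<ge> 0" using a by (intro sum_nonneg divide_nonneg_nonneg) auto
        then have "\<delta> * \<delta> * (\<Sum>m=a..N. ln m / nth_prime m) \<ge> 0" by simp
        moreover have "(\<Sum>m=1..<a. ln (nth_prime m) / nth_prime m) \<ge> 0"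
          by (intro sum_nonneg divide_nonneg_nonneg) (auto intro!: ln_ge_zero simp: Suc_le_eq prime_gt_0_nat)
        then have "\<delta> * C' \<ge> 0" using \<delta> unfolding C'_def by simp
        ultimately show ?thesis by linarith
      qed
      finally show "(\<Sum>n=a..N. (1 - \<delta>) / n) \<le> (\<Sum>n=a..N. ln n / nth_prime n) + C'"
        by (simp add: sum_distrib_left)
    next
      fix n assume "n \<ge> a"
      then have n: "n \<ge> 3" "n \<ge> a0" using a by auto
      show "\<phi> (Suc n) \<le> \<phi> n" using a0[OF n(2)] by simp
      show "\<phi> n \<ge> 0" unfolding \<phi>_def using n by simp
    qed
    moreover have "(\<Sum>n=a..N. \<phi> n * ((1 - \<delta>) / n)) = (1 - \<delta>) * (\<Sum>n=a..N. main_weight c n)" for N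
      unfolding sum_distrib_left by (intro sum.cong) (auto simp: \<phi>_def main_weight_def mult.commute)
    moreover have "(\<Sum>n=a..N. \<phi> n * (ln n / nth_prime n)) = (\<Sum>n=a..N. ln (ln (real n)) powr (1 - c) / nth_prime n)" for N
      using a by (intro sum.cong) (auto simp: \<phi>_def)
    ultimately have main: "(1 - \<delta>) * (\<Sum>n=a..N. main_weight c n) \<le>
        (\<Sum>n=a..N. ln (ln (real n)) powr (1 - c) / nth_prime n) + C' * \<phi> a" if "N \<ge> a" for N
      using that by simp
    have "(1 - \<delta>) * T N \<le> Q N + (C' * \<phi> a + (1 - \<delta>) * (\<Sum>n=3..<a. main_weight c n))" if N: "N \<ge> a" for N
    proof -
      have split: "{3..N} = {3..<a} \<union> {a..N}" using a N by auto
      have "T N = (\<Sum>n=3..<a. main_weight c n) + (\<Sum>n=a..N. main_weight c n)"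
        unfolding T_def split by (rule sum.union_disjoint) auto
      moreover have "(\<Sum>n=a..N. ln (ln (real n)) powr (1 - c) / nth_prime n) \<le> Q N"
        unfolding Q_def using a by (intro sum_mono2) auto
      ultimately show ?thesis using main[OF N] by (simp add: distrib_left)
    qed
    then show ?thesis unfolding eventually_sequentially by blast
  qed
  then obtain C2 where C2: "\<forall>\<^sub>F N in sequentially. (1 - \<delta>) * T N \<le> Q N + C2" by blast
  have T0: "T N \<ge> 0" for N
    unfolding T_def using main_weight_pos[of _ c] by (intro sum_nonneg) (auto intro: less_imp_le)
  have "\<forall>\<^sub>F N in sequentially. (\<Sum>n=3..N. prime_ratio n * main_weight c n) \<le> (1 + \<epsilon>) * T N + (C1 + K * C2)"
    using C2
  proof eventually_elim
    case (elim N)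
    have "K * ((1 - \<delta>) * T N) \<le> K * (Q N + C2)" using elim K(1) by (intro mult_left_mono) auto
    then have "(\<Sum>n=3..N. prime_ratio n * main_weight c n) \<le> T N + 2 * K * \<delta> * T N + (C1 + K * C2)"
      using up[of N] by (simp add: algebra_simps)
    moreover have "2 * K * \<delta> * T N \<le> \<epsilon> * T N" using \<delta> T0 by (intro mult_right_mono) auto
    ultimately show ?case by (simp add: algebra_simps)
  qed
  then show "\<exists>C. \<forall>\<^sub>F N in sequentially. (\<Sum>n=3..N. prime_ratio n * main_weight c n) \<le> (1 + \<epsilon>) * (\<Sum>n=3..N. main_weight c n) + C"
    unfolding T_def by blast
qed

subsection \<open>The gap sum\<close>

definition gap_partial_sum :: "real \<Rightarrow> nat \<Rightarrow> real" where
  "gap_partial_sum c N = (\<Sum>n=3..N. weight c n * (1 / real (prime_gap n)))"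

definition abel_term :: "real \<Rightarrow> nat \<Rightarrow> real" where
  "abel_term c n = recip_gap_sum n * (weight c (n - 1) - weight c n)"

lemma gap_sum_eq:
  assumes "X \<ge> 0"
  shows "gap_sum c X = gap_partial_sum c (nat \<lfloor>X\<rfloor>)"
proof -
  have "{n::nat. 3 \<le> n \<and> real n \<le> X} = {3..nat \<lfloor>X\<rfloor>}"
    using assms by (auto simp: le_nat_floor) linarith
  then show ?thesis
    unfolding gap_sum_def gap_partial_sum_def weight_def by (intro sum.cong) (auto simp: mult.commute)
qed

lemma recip_gap_sum_Suc: "n \<ge> 1 \<Longrightarrow> recip_gap_sum (Suc n) = recip_gap_sum n + 1 / real (prime_gap n)"
  by (simp add: recip_gap_sum_def)

lemma recip_gap_sum_nonneg: "recip_gap_sum n \<ge> 0"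
  unfolding recip_gap_sum_def by (intro sum_nonneg) auto

text \<open>Summation by parts; \<open>recip_gap_sum\<close> is taken at Suc N because its value at
  N stops before the gap number N. In \<open>weight c 2\<close> the number ln ln 2 is negative, but
  this value cancels between the constant and the first \<open>abel_term\<close>.\<close>

lemma gap_partial_sum_abel:
  assumes "N \<ge> 3"
  shows "gap_partial_sum c N =
    weight c N * recip_gap_sum (Suc N) - weight c 2 * recip_gap_sum 3 + (\<Sum>n=3..N. abel_term c n)"
  using assms
proof (induction N rule: dec_induct)
  case base
  show ?case using recip_gap_sum_Suc[of 3]
    by (simp add: gap_partial_sum_def abel_term_def algebra_simps)
next
  case (step N)
  have "gap_partial_sum c (Suc N) = gap_partial_sum c N + weight c (Suc N) * (recip_gap_sum (Suc (Suc N)) - recip_gap_sum (Suc N))"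
    using step recip_gap_sum_Suc[of "Suc N"] by (simp add: gap_partial_sum_def)
  also have "\<dots> = weight c (Suc N) * recip_gap_sum (Suc (Suc N)) - weight c 2 * recip_gap_sum 3 +
      ((\<Sum>n=3..N. abel_term c n) + abel_term c (Suc N))"
    unfolding step.IH by (simp add: abel_term_def algebra_simps)
  also have "(\<Sum>n=3..N. abel_term c n) + abel_term c (Suc N) = (\<Sum>n=3..Suc N. abel_term c n)"
    using step by simp
  finally show ?case .
qed

text \<open>The decrease of \<open>weight\<close> is that of 1 / n times a slowly varying power of
  ln ln n. Regrouping the product isolates p_n in \<open>prime_ratio\<close>.\<close>

lemma abel_term_asymp:
  assumes HL: "hardy_littlewood_prime_pairs"
  shows "abel_term c \<sim>[sequentially] (\<lambda>n. prime_ratio n * main_weight c n)"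
proof -
  have "(\<lambda>n. weight c (n - 1) - weight c n) \<sim>[sequentially] (\<lambda>n::nat. 1 / ((real n)\<^sup>2 * ln (ln (real n)) powr c))"
  proof -
    have "(\<lambda>n::nat. 1 / ((real n - 1) * ln (ln (real n - 1)) powr c) - 1 / (real n * ln (ln (real n)) powr c))
      \<sim>[sequentially] (\<lambda>n::nat. 1 / ((real n)\<^sup>2 * ln (ln (real n)) powr c))" by real_asymp
    moreover have "\<forall>\<^sub>F n in sequentially. 1 / ((real n - 1) * ln (ln (real n - 1)) powr c) - 1 / (real n * ln (ln (real n)) powr c)
        = weight c (n - 1) - weight c n"
      using eventually_ge_at_top[of 1] by eventually_elim (simp add: weight_def of_nat_diff)
    ultimately show ?thesis by (subst (asm) asymp_equiv_cong[OF _ always_eventually]) auto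
  qed
  then have "abel_term c \<sim>[sequentially] (\<lambda>n. nth_prime n * ln (ln (real n)) / (ln (real n))\<^sup>2 *
      (1 / ((real n)\<^sup>2 * ln (ln (real n)) powr c)))"
    unfolding abel_term_def by (intro asymp_equiv_mult recip_gap_sum_asymp HL)
  also have "(\<lambda>n. nth_prime n * ln (ln (real n)) / (ln (real n))\<^sup>2 *
      (1 / ((real n)\<^sup>2 * ln (ln (real n)) powr c))) \<sim>[sequentially] (\<lambda>n. prime_ratio n * main_weight c n)"
  proof (rule asymp_equiv_refl_ev)
    show "\<forall>\<^sub>F n in sequentially. nth_prime n * ln (ln (real n)) / (ln (real n))\<^sup>2 *
      (1 / ((real n)\<^sup>2 * ln (ln (real n)) powr c)) = prime_ratio n * main_weight c n"
      using eventually_ge_at_top[of 3]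
    proof eventually_elim
      case (elim n)
      then show ?case using ln_ln_pos[OF elim]
        by (simp add: prime_ratio_def main_weight_def powr_diff power2_eq_square)
    qed
  qed
  finally show ?thesis .
qed

lemma prime_ratio_main_weight_pos: "\<forall>\<^sub>F n in sequentially. prime_ratio n * main_weight c n > 0"
  using eventually_ge_at_top[of 3]
proof eventually_elim
  case (elim n)
  have "prime_ratio n > 0" unfolding prime_ratio_def
    using elim prime_gt_0_nat[OF prime_nth_prime[of n]] by (intro divide_pos_pos mult_pos_pos) auto
  then show ?case using main_weight_pos[OF elim] by simp
qed

text \<open>With p_N = O(N ln N) the boundary term is O((ln ln N)^(1 - c) / ln N); it tends to 0, so
  the bound 1 is merely convenient.\<close>

lemma abel_boundary_bounded:
  assumes HL: "hardy_littlewood_prime_pairs"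
  shows "\<forall>\<^sub>F N in sequentially. 0 \<le> weight c N * recip_gap_sum (Suc N) \<and> weight c N * recip_gap_sum (Suc N) \<le> 1"
proof -
  obtain K :: real where K: "K > 0" "\<forall>\<^sub>F n in sequentially. nth_prime n \<le> K * (n * ln n)"
    by (rule nth_prime_upper[OF HL])
  have pos: "\<forall>\<^sub>F n in sequentially. nth_prime n * ln (ln (real n)) / (ln (real n))\<^sup>2 > 0"
    using eventually_ge_at_top[of 3]
  proof eventually_elim
    case (elim n)
    then show ?case using ln_ln_pos[OF elim] prime_gt_0_nat[OF prime_nth_prime[of n]] by simp
  qed
  have "\<forall>\<^sub>F n in sequentially. recip_gap_sum n \<le> 2 * K * (n * ln (ln n) / ln n)"
    using asymp_equiv_realD[OF recip_gap_sum_asymp[OF HL] pos zero_less_one] K(2) eventually_ge_at_top[of 3]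
  proof eventually_elim
    case (elim n)
    have l: "ln (ln (real n)) > 0" "ln (real n) > 0" using elim ln_ln_pos[of n] by auto
    have "recip_gap_sum n \<le> 2 * (nth_prime n * ln (ln (real n)) / (ln (real n))\<^sup>2)" using elim by simp
    also have "\<dots> \<le> 2 * (K * (n * ln n) * ln (ln (real n)) / (ln (real n))\<^sup>2)"
      using elim l by (intro mult_left_mono divide_right_mono mult_right_mono) auto
    also have "\<dots> = 2 * K * (n * ln (ln n) / ln n)" using l by (simp add: power2_eq_square)
    finally show ?case .
  qed
  then have "\<forall>\<^sub>F n in sequentially. recip_gap_sum (Suc n) \<le> 2 * K * (Suc n * ln (ln (Suc n)) / ln (Suc n))"
    by (rule eventually_compose_filterlim) (rule filterlim_Suc)
  moreover have "\<forall>\<^sub>F n::nat in sequentially. 1 / (real n * ln (ln (real n)) powr c) *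
      (2 * K * ((real n + 1) * ln (ln (real n + 1)) / ln (real n + 1))) \<le> 1"
    using K(1) by real_asymp
  ultimately show ?thesis using eventually_ge_at_top[of 3]
  proof eventually_elim
    case (elim n)
    have w: "weight c n \<ge> 0" using weight_pos[of n c] elim by simp
    have "weight c n * recip_gap_sum (Suc n) \<le> weight c n * (2 * K * (Suc n * ln (ln (Suc n)) / ln (Suc n)))"
      using elim w by (intro mult_left_mono) auto
    also have "\<dots> \<le> 1" using elim by (simp add: weight_def add.commute)
    finally show ?case using w recip_gap_sum_nonneg by simp
  qed
qed

lemma gap_partial_sum_near_abel:
  assumes HL: "hardy_littlewood_prime_pairs"
  obtains C where "\<forall>\<^sub>F N in sequentially. \<bar>gap_partial_sum c N - (\<Sum>n=3..N. abel_term c n)\<bar> \<le> C"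
proof -
  have "\<forall>\<^sub>F N in sequentially. \<bar>gap_partial_sum c N - (\<Sum>n=3..N. abel_term c n)\<bar> \<le> 1 + \<bar>weight c 2 * recip_gap_sum 3\<bar>"
    using abel_boundary_bounded[OF HL, of c] eventually_ge_at_top[of 3]
  proof eventually_elim
    case (elim N)
    then show ?case using gap_partial_sum_abel[OF elim(2), of c] by linarith
  qed
  then show ?thesis by (rule that)
qed

lemma filterlim_nat_floor: "filterlim (\<lambda>X::real. nat \<lfloor>X\<rfloor>) sequentially at_top"
  by (rule filterlim_compose[OF filterlim_nat_sequentially filterlim_floor_sequentially])

text \<open>F is an antiderivative of \<open>main_weight c\<close>. Because it tends to infinity,
  the bounded difference between the gap sum and its Abel-summed form is absorbed; the last
  hypothesis passes from integers to real X.\<close>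

lemma gap_sum_asymp:
  fixes F :: "real \<Rightarrow> real"
  assumes HL: "hardy_littlewood_prime_pairs"
    and equiv: "main_weight c \<sim>[sequentially] (\<lambda>n. F (real n + 1) - F (real n))"
    and pos: "\<forall>\<^sub>F n::nat in sequentially. F (real n + 1) - F (real n) > 0"
    and F: "filterlim F at_top at_top"
    and Suc: "(\<lambda>n::nat. F (real n + 1)) \<sim>[sequentially] (\<lambda>n. F (real n))"
    and floor: "(\<lambda>x. F (of_int \<lfloor>x\<rfloor>)) \<sim>[at_top] F"
  shows "gap_sum c \<sim>[at_top] F"
proof -
  define G where "G n = F (real n)" for n :: nat
  have GS: "F (real n + 1) = G (Suc n)" for n by (simp add: G_def add.commute)
  have G: "filterlim G at_top sequentially"
    unfolding G_def by (rule filterlim_compose[OF F filterlim_real_sequentially])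
  have T: "(\<lambda>N. \<Sum>n=3..N. main_weight c n) \<sim>[sequentially] G"
    using equiv pos G Suc unfolding GS G_def[symmetric] by (rule asymp_equiv_sum_telescope)
  have Tlim: "filterlim (\<lambda>N. \<Sum>n=3..N. main_weight c n) at_top sequentially"
    using T G by (metis asymp_equiv_at_top_transfer asymp_equiv_sym)
  have PT: "(\<lambda>N. \<Sum>n=3..N. prime_ratio n * main_weight c n) \<sim>[sequentially] (\<lambda>N. \<Sum>n=3..N. main_weight c n)"
    by (rule prime_ratio_sum_asymp[OF HL Tlim])
  have Plim: "filterlim (\<lambda>N. \<Sum>n=3..N. prime_ratio n * main_weight c n) at_top sequentially"
    using PT Tlim by (metis asymp_equiv_at_top_transfer asymp_equiv_sym)
  have "(\<lambda>N. \<Sum>n=3..N. abel_term c n) \<sim>[sequentially] (\<lambda>N. \<Sum>n=3..N. prime_ratio n * main_weight c n)"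
    by (rule asymp_equiv_sum[OF abel_term_asymp[OF HL] prime_ratio_main_weight_pos Plim])
  also note PT
  also note T
  finally have A: "(\<lambda>N. \<Sum>n=3..N. abel_term c n) \<sim>[sequentially] G" .
  have Gpos: "\<forall>\<^sub>F n in sequentially. G n > 0"
    using G by (rule filterlim_at_top_dense[THEN iffD1, THEN spec])
  obtain C where C: "\<forall>\<^sub>F N in sequentially. \<bar>gap_partial_sum c N - (\<Sum>n=3..N. abel_term c n)\<bar> \<le> C"
    by (rule gap_partial_sum_near_abel[OF HL])
  have "gap_partial_sum c \<sim>[sequentially] G"
  proof (rule asymp_equiv_absorb[OF G])
    fix \<epsilon> :: real assume "0 < \<epsilon>"
    note ev = asymp_equiv_realD[OF A Gpos this]
    show "\<exists>C. \<forall>\<^sub>F n in sequentially. gap_partial_sum c n \<le> (1 + \<epsilon>) * G n + C"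
      by (rule exI[of _ C]) (use ev C in \<open>eventually_elim, linarith\<close>)
    show "\<exists>C. \<forall>\<^sub>F n in sequentially. (1 - \<epsilon>) * G n - C \<le> gap_partial_sum c n"
      by (rule exI[of _ C]) (use ev C in \<open>eventually_elim, linarith\<close>)
  qed
  note asymp_equiv_compose'[OF this filterlim_nat_floor]
  moreover have "gap_sum c \<sim>[at_top] (\<lambda>X. gap_partial_sum c (nat \<lfloor>X\<rfloor>))"
    by (rule asymp_equiv_refl_ev) (use eventually_ge_at_top[of 0] in \<open>eventually_elim, simp add: gap_sum_eq\<close>)
  moreover have "(\<lambda>X. G (nat \<lfloor>X\<rfloor>)) \<sim>[at_top] (\<lambda>X. F (of_int \<lfloor>X\<rfloor>))"
    by (rule asymp_equiv_refl_ev) (use eventually_ge_at_top[of 0] in \<open>eventually_elim, simp add: G_def\<close>)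
  ultimately show ?thesis using floor by (blast intro: asymp_equiv_trans)
qed

lemma gap_partial_sum_mono: "incseq (gap_partial_sum c)"
proof (rule incseq_SucI)
  fix N
  show "gap_partial_sum c N \<le> gap_partial_sum c (Suc N)"
    unfolding gap_partial_sum_def
    by (rule sum_mono2) (auto intro!: divide_nonneg_nonneg less_imp_le[OF weight_pos])
qed

text \<open>The partial sums increase, so boundedness is enough, and for it the bound K on
  \<open>prime_ratio\<close> can replace its average. For c > 2 the antiderivative F is negative and
  tends to 0, so the telescoped sums stay below - F 3.\<close>

lemma gap_sum_convergent:
  assumes HL: "hardy_littlewood_prime_pairs" and c: "c > 2"
  shows "\<exists>\<gamma>. (gap_sum c \<longlongrightarrow> \<gamma>) at_top"
proof -
  define F where "F n = ln (ln (real n)) powr (2 - c) / (2 - c)" for n :: nat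
  have "main_weight c \<sim>[sequentially] (\<lambda>n. F (Suc n) - F n)"
    unfolding main_weight_def[abs_def] F_def of_nat_Suc using c by real_asymp
  moreover have "\<forall>\<^sub>F n in sequentially. F (Suc n) - F n > 0"
    unfolding F_def of_nat_Suc using c by real_asymp
  ultimately have mw: "\<forall>\<^sub>F n in sequentially. main_weight c n \<le> 2 * (F (Suc n) - F n)"
    using asymp_equiv_realD[of _ _ 1] by (force elim: eventually_mono)
  obtain K :: real where K: "K > 0" "\<forall>\<^sub>F n in sequentially. nth_prime n \<le> K * (n * ln n)"
    by (rule nth_prime_upper[OF HL])
  have "\<forall>\<^sub>F n in sequentially. abel_term c n \<le> 4 * K * (F (Suc n) - F n)"
    using asymp_equiv_realD[OF abel_term_asymp[OF HL] prime_ratio_main_weight_pos zero_less_one, of c]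
      K(2) mw eventually_ge_at_top[of 3]
  proof eventually_elim
    case (elim n)
    have pr: "prime_ratio n \<le> K" using elim by (simp add: prime_ratio_def divide_le_eq)
    have "abel_term c n \<le> 2 * (prime_ratio n * main_weight c n)" using elim by simp
    also have "\<dots> \<le> 2 * (K * (2 * (F (Suc n) - F n)))"
      using pr elim K(1) main_weight_pos[of n c] by (intro mult_left_mono mult_mono) auto
    finally show ?case by (simp add: algebra_simps)
  qed
  then obtain C where "\<And>N. (\<Sum>n=3..N. abel_term c n) \<le> (\<Sum>n=3..N. 4 * K * (F (Suc n) - F n)) + C"
    by (rule sum_le_eventually[where a = 3]) blast
  then have C: "(\<Sum>n=3..N. abel_term c n) \<le> 4 * K * (\<Sum>n=3..N. F (Suc n) - F n) + C" for N
    by (simp only: sum_distrib_left[symmetric])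
  obtain C' where "\<forall>\<^sub>F N in sequentially. \<bar>gap_partial_sum c N - (\<Sum>n=3..N. abel_term c n)\<bar> \<le> C'"
    by (rule gap_partial_sum_near_abel[OF HL])
  then have "\<forall>\<^sub>F N in sequentially. gap_partial_sum c N \<le> 4 * K * (- F 3) + C + C'"
    using eventually_ge_at_top[of 3]
  proof eventually_elim
    case (elim N)
    have "(\<Sum>n=3..N. F (Suc n) - F n) = F (Suc N) - F 3" using elim by (intro sum_telescope_atLeastAtMost)
    moreover have "F (Suc N) \<le> 0" using c by (simp add: F_def divide_nonneg_nonpos)
    ultimately have "4 * K * (\<Sum>n=3..N. F (Suc n) - F n) \<le> 4 * K * (- F 3)"
      using K(1) by (intro mult_left_mono) auto
    then show ?case using C[of N] elim by linarith
  qed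
  then obtain B where "\<And>N. gap_partial_sum c N \<le> B" by (rule eventually_le_imp_bounded) blast
  then obtain \<gamma> where "gap_partial_sum c \<longlonglongrightarrow> \<gamma>"
    using incseq_convergent[OF gap_partial_sum_mono, of c B] by blast
  note filterlim_compose[OF this filterlim_nat_floor]
  moreover have "\<forall>\<^sub>F X in at_top. gap_partial_sum c (nat \<lfloor>X\<rfloor>) = gap_sum c X"
    using eventually_ge_at_top[of 0] by eventually_elim (simp add: gap_sum_eq)
  ultimately have "(gap_sum c \<longlongrightarrow> \<gamma>) at_top" by (rule Lim_transform_eventually)
  then show ?thesis by blast
qed

theorem corollary1p2:
  fixes c :: real
  assumes "hardy_littlewood_prime_pairs"
  shows "(c > 2 \<longrightarrow> (\<exists>\<gamma>::real. (gap_sum c \<longlongrightarrow> \<gamma>) at_top)) \<and>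
         (c = 2 \<longrightarrow> gap_sum c \<sim>[at_top] (\<lambda>X. ln (ln (ln X)))) \<and>
         (c < 2 \<longrightarrow> gap_sum c \<sim>[at_top] (\<lambda>X. ln (ln X) powr (2 - c) / (2 - c)))"
proof (intro conjI impI)
  assume "c > 2"
  then show "\<exists>\<gamma>::real. (gap_sum c \<longlongrightarrow> \<gamma>) at_top" by (rule gap_sum_convergent[OF assms])
next
  assume c: "c = 2"
  show "gap_sum c \<sim>[at_top] (\<lambda>X. ln (ln (ln X)))"
    \<comment> \<open>For c = 2 the weight is 1 / (n ln n ln ln n), the derivative of ln ln ln; what
      remains is elementary asymptotics of explicit functions.\<close>
    by (rule gap_sum_asymp[OF assms]; (unfold main_weight_def[abs_def] c)?; real_asymp)
next
  assume c: "c < 2"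
  then show "gap_sum c \<sim>[at_top] (\<lambda>X. ln (ln X) powr (2 - c) / (2 - c))"
    by (intro gap_sum_asymp[OF assms]; (unfold main_weight_def[abs_def])?; real_asymp)
qed

end
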